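(* Let $k\in\mathbb{Z}$, $m\in\mathbb{Z}_{>0}$, and let $\phi:\mathbb{C}\times\mathbb{H}\to\mathbb{C}$ be such that for each fixed $\tau$, $z\mapsto\phi(z;\tau)$ is meromorphic, and suppose $\phi$ satisfies (E). Then for $\tau\in\mathbb{H}$ and $z\notin\operatorname{Sing}\phi(\cdot;\tau)$, $$\phi(z;\tau)=\sum_{l\bmod 2m}h_l(\tau)\theta_{m,l}(z;\tau)-2\pi i\sum_{u\in\operatorname{Sing}\phi(\cdot;\tau)\bmod\Lambda_\tau}\operatorname{Res}_{v=u}\big[\tilde f_v(z;\tau)\phi(v;\tau)\big],$$ where $\Lambda_\tau=\mathbb{Z}\tau+\mathbb{Z}$, $\operatorname{Sing}\phi(\cdot;\tau)$ is the set of poles of $z\mapsto\phi(z;\tau)$, and for $0\le l\le2m-1$ and any $p\in\mathbb{C}$ such that no pole lies on the boundary of $P_p=p+(0,1)\tau+(0,1)$, $$h_l(\tau)=e^{-\pi il^2\tau/2m}\int_p^{p+1}\phi(z;\tau)e^{-2\pi ilz}dz-\pi i\sum_{u\in\operatorname{Sing}\phi(\cdot;\tau)\cap P_p}\operatorname{Res}_{v=u}\big[R_{m,l}(v;\tau)\phi(v;\tau)\big]$$ (with $h_l$ extended $2m$-periodically in $l$). If $\phi$ also satisfies (M), then for each $l$: $h_l(\tau+1)=e^{-\pi il^2/2m}h_l(\tau)$ and $h_l(-\frac1\tau)=\frac{\tau^k}{\sqrt{-i\tau}}\frac{1}{\sqrt{2m}}\sum_{\nu\bmod 2m}e^{\pi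 il\nu/m}h_\nu(\tau)$.
   Context: Condition (E): $\phi(z+\lambda\tau+\mu;\tau)=e^{-2\pi im(\lambda^2\tau+2\lambda z)}\phi(z;\tau)$ for all $\lambda,\mu\in\mathbb{Z}$. Condition (M): $\phi(\frac{z}{c\tau+d};\frac{a\tau+b}{c\tau+d})=(c\tau+d)^ke^{2\pi imcz^2/(c\tau+d)}\phi(z;\tau)$ for all $\begin{pmatrix}a&b\\c&d\end{pmatrix}\in\mathrm{SL}_2(\mathbb{Z})$. With $y=\operatorname{Im}\tau$: $\theta_{m,l}(z;\tau)=\sum_{\lambda\equiv l\ (2m)}e^{\pi i\lambda^2\tau/2m+2\pi i\lambda z}$; $f_u(z;\tau)=\sum_{\lambda\in\mathbb{Z}}\frac{e^{2\pi im\lambda^2\tau+4\pi im\lambda z}}{1-e^{2\pi i\lambda\tau+2\pi i(z-u)}}$; $R_{m,l}(u;\tau)=\sum_{\lambda\equiv l\ (2m)}\{\operatorname{sign}(\lambda+\frac12)-E((\lambda+2m\operatorname{Im}(u)/y)\sqrt{y/m})\}e^{-\pi i\lambda^2\tau/2m-2\pi i\lambda u}$, $E(z)=2\int_0^ze^{-\pi t^2}dt$; $\tilde f_u(z;\tau)=f_u(z;\tau)-\frac12\sum_{l\bmod2m}R_{m,l}(u;\tau)\theta_{m,l}(z;\tau)$ (real-analytic in $u$). Residue convention: if $f$ is real-analytic near $u$ and $g$ meromorphic with a pole of order $s$ at $u$, then near $u$, $fg=\sum_{n\ge-s}\sum_{j\ge0}a_{nj}(v-u)^n(\bar v-\bar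 u)^j$ and $\operatorname{Res}_{v=u}[f(v)g(v)]:=a_{-1,0}=\frac{1}{(s-1)!}\frac{\partial^{s-1}}{\partial v^{s-1}}\big|_{v=u}\big(f(v)(v-u)^sg(v)\big)$. $\sqrt{-i\tau}$ is the principal branch. *)

theory Defs
  imports "HOL-Complex_Analysis.Complex_Analysis"
begin

definition theta_ml :: "nat \<Rightarrow> int \<Rightarrow> complex \<Rightarrow> complex \<Rightarrow> complex" where
  "theta_ml m l z \<tau> =
     (\<Sum>\<^sub>\<infinity>n\<in>{n::int. n mod (2 * int m) = l mod (2 * int m)}.
        exp (pi * \<i> * of_int n ^ 2 * \<tau> / (2 * of_nat m) + 2 * pi * \<i> * of_int n * z))"

definition f_u :: "nat \<Rightarrow> complex \<Rightarrow> complex \<Rightarrow> complex \<Rightarrow> complex" where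
  "f_u m u z \<tau> =
     (\<Sum>\<^sub>\<infinity>n\<in>(UNIV::int set).
        exp (2 * pi * \<i> * of_nat m * of_int n ^ 2 * \<tau> + 4 * pi * \<i> * of_nat m * of_int n * z)
        / (1 - exp (2 * pi * \<i> * of_int n * \<tau> + 2 * pi * \<i> * (z - u))))"

definition E_err :: "real \<Rightarrow> real" where
  "E_err x = 2 * (if 0 \<le> x then integral {0..x} (\<lambda>t. exp (- pi * t ^ 2))
                  else - integral {x..0} (\<lambda>t. exp (- pi * t ^ 2)))"

definition R_ml :: "nat \<Rightarrow> int \<Rightarrow> complex \<Rightarrow> complex \<Rightarrow> complex" where
  "R_ml m l u \<tau> =
     (\<Sum>\<^sub>\<infinity>n\<in>{n::int. n mod (2 * int m) = l mod (2 * int m)}.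
        complex_of_real (sgn (real_of_int n + 1/2)
            - E_err ((real_of_int n + 2 * real m * Im u / Im \<tau>) * sqrt (Im \<tau> / real m)))
        * exp (- pi * \<i> * of_int n ^ 2 * \<tau> / (2 * of_nat m) - 2 * pi * \<i> * of_int n * u))"

definition f_tilde :: "nat \<Rightarrow> complex \<Rightarrow> complex \<Rightarrow> complex \<Rightarrow> complex" where
  "f_tilde m u z \<tau> =
     f_u m u z \<tau> - 1/2 * (\<Sum>l\<in>{0..<2 * int m}. R_ml m l u \<tau> * theta_ml m l z \<tau>)"

definition wirtinger :: "(complex \<Rightarrow> complex) \<Rightarrow> complex \<Rightarrow> complex" where
  "wirtinger F v =
     (vector_derivative (\<lambda>t::real. F (v + of_real t)) (at 0)
      - \<i> * vector_derivative (\<lambda>t::real. F (v + \<i> * of_real t)) (at 0)) / 2"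

text \<open>Res_{v=u}[f(v) g(v)] for g with a pole of order s at u:
  (1/(s-1)!) (d/dv)^(s-1) at v=u of f(v) (v-u)^s g(v); here (v-u)^s g(v) is the
  holomorphic (removable-singularity-free) function zor_poly g u.\<close>
definition res_ra :: "(complex \<Rightarrow> complex) \<Rightarrow> (complex \<Rightarrow> complex) \<Rightarrow> complex \<Rightarrow> complex" where
  "res_ra f g u =
     (let s = nat (- zorder g u)
      in (wirtinger ^^ (s - 1)) (\<lambda>v. f v * zor_poly g u v) u / fact (s - 1))"

definition Sing :: "(complex \<Rightarrow> complex \<Rightarrow> complex) \<Rightarrow> complex \<Rightarrow> complex set" where
  "Sing \<phi> \<tau> = {z. is_pole (\<lambda>w. \<phi> w \<tau>) z}"

definition lattice :: "complex \<Rightarrow> complex set" where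
  "lattice \<tau> = {of_int a * \<tau> + of_int b | a b. True}"

definition par_open :: "complex \<Rightarrow> complex \<Rightarrow> complex set" where
  "par_open p \<tau> = {p + of_real s * \<tau> + of_real t | s t. 0 < s \<and> s < 1 \<and> 0 < t \<and> t < 1}"

definition par_boundary :: "complex \<Rightarrow> complex \<Rightarrow> complex set" where
  "par_boundary p \<tau> = {p + of_real s * \<tau> + of_real t | s t.
      0 \<le> s \<and> s \<le> 1 \<and> 0 \<le> t \<and> t \<le> 1 \<and> (s = 0 \<or> s = 1 \<or> t = 0 \<or> t = 1)}"

text \<open>Values of phi at poles are meaningless, so the identities are required off the poles.\<close>
definition condE :: "nat \<Rightarrow> (complex \<Rightarrow> complex \<Rightarrow> complex) \<Rightarrow> bool" where
  "condE m \<phi> \<longleftrightarrow> (\<forall>\<tau> z (n::int) (\<mu>::int). Im \<tau> > 0 \<and> z \<notin> Sing \<phi> \<tau> \<longrightarrow>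
      \<phi> (z + of_int n * \<tau> + of_int \<mu>) \<tau>
        = exp (- 2 * pi * \<i> * of_nat m * (of_int n ^ 2 * \<tau> + 2 * of_int n * z)) * \<phi> z \<tau>)"

definition condM :: "int \<Rightarrow> nat \<Rightarrow> (complex \<Rightarrow> complex \<Rightarrow> complex) \<Rightarrow> bool" where
  "condM k m \<phi> \<longleftrightarrow> (\<forall>\<tau> z (a::int) (b::int) (c::int) (d::int).
      Im \<tau> > 0 \<and> a * d - b * c = 1 \<and> z \<notin> Sing \<phi> \<tau> \<longrightarrow>
      \<phi> (z / (of_int c * \<tau> + of_int d)) ((of_int a * \<tau> + of_int b) / (of_int c * \<tau> + of_int d))
        = (of_int c * \<tau> + of_int d) powi k
          * exp (2 * pi * \<i> * of_nat m * of_int c * z ^ 2 / (of_int c * \<tau> + of_int d)) * \<phi> z \<tau>)"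

definition h_formula :: "nat \<Rightarrow> (complex \<Rightarrow> complex \<Rightarrow> complex) \<Rightarrow> int \<Rightarrow> complex \<Rightarrow> complex \<Rightarrow> complex" where
  "h_formula m \<phi> l \<tau> p =
     exp (- pi * \<i> * of_int l ^ 2 * \<tau> / (2 * of_nat m))
       * contour_integral (linepath p (p + 1)) (\<lambda>z. \<phi> z \<tau> * exp (- 2 * pi * \<i> * of_int l * z))
     - pi * \<i> * (\<Sum>u\<in>Sing \<phi> \<tau> \<inter> par_open p \<tau>. res_ra (\<lambda>v. R_ml m l v \<tau>) (\<lambda>v. \<phi> v \<tau>) u)"

end

theory Submission
  imports Defs "HOL-Probability.Distributions" "HOL-Real_Asymp.Real_Asymp"
begin

text \<open>R is not holomorphic in u, but it polarises: with E replaced by its entire extension and cnj u by an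
independent variable w, it becomes a function of (v, w) that is holomorphic in each variable, and Wirtinger derivatives
along w = cnj v are holomorphic derivatives in v. So every residue in the statement is an ordinary residue at u, taken
with w = cnj u frozen.

The expansion is the residue theorem for v \<mapsto> f_v(z) \<phi>(v) on a period parallelogram: the pole at z contributes
\<phi>(z), and the quasi-periodicity of f_v(z) in v turns the boundary integral into a combination of the theta functions.
Because these are linearly independent, h does not depend on p, and its modular behaviour follows from that of theta and of the
corrected Appell function.

For \<tau> \<mapsto> -1/\<tau>, let G be the difference of the two sides of the transformation law of the polarised corrected
Appell function. The w-derivative of the polarised R is a Gaussian times a theta function, so the inversion formula for theta gives
that G does not depend on w. Then G is an entire function of v satisfying the elliptic law of the negative
index -m, and such a function is bounded by a Gaussian, hence zero by Liouville.\<close>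

subsection \<open>Wirtinger derivatives and polarisation\<close>

text \<open>The residue theorem needs a function holomorphic in v, hence the uncorrected f_v(z). Its
  residues against \<phi> are not invariant under translation of the pole by \<tau>, because f_v
  picks up theta functions; those of the corrected function are, and they transform well under S. So
  each residue of f_v \<phi> at a pole u is split into one of the corrected function and ones of R_l
  \<phi>, all with w = cnj u; the latter come with theta functions of z and are absorbed into h_l.
  Freezing w is compatible with translations because (v, w) moves by (\<tau>, cnj \<tau>).

  The expansion uses no modularity and holds at each fixed \<tau>. It can therefore be applied to a
  theta function at -1/\<tau>, which after a Gaussian factor satisfies the elliptic law for \<tau>:
  the inversion formula for theta is the case without poles, its coefficients being Gaussian
  integrals evaluated through E.\<close>

definition sep_holo :: "(complex \<Rightarrow> complex \<Rightarrow> complex) \<Rightarrow> complex set \<Rightarrow> complex set \<Rightarrow> bool" where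
  "sep_holo F U W \<longleftrightarrow> open U \<and> open W \<and> continuous_on (U \<times> W) (\<lambda>(v, w). F v w)
     \<and> (\<forall>w\<in>W. (\<lambda>v. F v w) holomorphic_on U) \<and> (\<forall>v\<in>U. F v holomorphic_on W)"

text \<open>Joint continuity bounds F on a compact product, Cauchy's inequality then bounds the
  second v-derivative uniformly in w, and Taylor's formula makes the error of the difference
  quotient linear in \<open>norm (h n)\<close>. Uniformity in both variables is what lets properties
  of F pass to its v-derivative.\<close>

lemma sep_holo_difference_quotient:
  assumes F: "sep_holo F U W" and v0: "v0 \<in> U" and w0: "w0 \<in> W"
  obtains r s :: real and h :: "nat \<Rightarrow> complex" where "r > 0" "s > 0"
    "cball v0 r \<subseteq> U" "cball w0 s \<subseteq> W" "\<And>n. h n \<noteq> 0"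
    "\<And>n v. v \<in> cball v0 r \<Longrightarrow> v + h n \<in> U"
    "uniform_limit (cball v0 r \<times> cball w0 s) (\<lambda>n (v, w). (F (v + h n) w - F v w) / h n)
       (\<lambda>(v, w). deriv (\<lambda>x. F x w) v) sequentially"
proof -
  from F have oU: "open U" and oW: "open W" and cont: "continuous_on (U \<times> W) (\<lambda>(v, w). F v w)"
    and hol: "\<And>w. w \<in> W \<Longrightarrow> (\<lambda>v. F v w) holomorphic_on U"
    by (auto simp: sep_holo_def)
  obtain R where R: "R > 0" "cball v0 R \<subseteq> U" using oU v0 open_contains_cball by blast
  obtain s where s: "s > 0" "cball w0 s \<subseteq> W" using oW w0 open_contains_cball by blast
  \<comment> \<open>Half of R, so that a Cauchy circle of radius r about any point of
    \<open>cball v0 r\<close> stays inside \<open>cball v0 R\<close>, where the bound B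
    holds.\<close>
  define r where "r = R / 2"
  have r: "r > 0" using R by (simp add: r_def)
  have "compact ((\<lambda>(v, w). F v w) ` (cball v0 R \<times> cball w0 s))"
    by (intro compact_continuous_image continuous_on_subset[OF cont] compact_Times compact_cball)
       (use R s in auto)
  then obtain B where B: "\<And>v w. v \<in> cball v0 R \<Longrightarrow> w \<in> cball w0 s \<Longrightarrow> norm (F v w) \<le> B"
    using compact_imp_bounded bounded_iff by (fastforce simp: bounded_iff)
  have B0: "B \<ge> 0" using B[of v0 w0] R s by (smt (verit) centre_in_cball norm_ge_zero)
  define h where "h n = complex_of_real (r / (2 * real (Suc n)))" for n
  have hnz: "h n \<noteq> 0" for n
    unfolding h_def of_real_eq_0_iff using r by simp
  have hn: "norm (h n) = r / (2 * real (Suc n))" for n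
    using r unfolding h_def norm_of_real by (simp add: abs_of_pos)
  have hle: "norm (h n) \<le> r / 2" for n
    unfolding hn using r by (simp add: field_simps)
  have mem: "v + h n \<in> cball v0 r" if "v \<in> cball v0 (r/2)" for v n
  proof -
    have "norm ((v - v0) + h n) \<le> norm (v - v0) + norm (h n)" by (rule norm_triangle_ineq)
    also have "\<dots> \<le> r" using that hle[of n] by (simp add: dist_norm norm_minus_commute)
    also have "(v - v0) + h n = (v + h n) - v0" by simp
    finally show ?thesis by (simp add: dist_norm norm_minus_commute)
  qed
  have rR: "cball v0 r \<subseteq> cball v0 R" using R by (auto simp: r_def)
  have hol2: "norm ((deriv ^^ 2) (\<lambda>v. F v w) x) \<le> 2 * B / r ^ 2" if "x \<in> cball v0 r" "w \<in> cball w0 s" for x w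
  proof -
    have sub: "cball x r \<subseteq> cball v0 R"
      using that R cball_subset_cball_iff[of x r v0 R] by (simp add: r_def dist_commute)
    have hx: "(\<lambda>v. F v w) holomorphic_on cball x r"
      using hol[of w] that s sub R holomorphic_on_subset by blast
    have "norm ((deriv ^^ 2) (\<lambda>v. F v w) x) \<le> fact 2 * B / r ^ 2"
    proof (rule Cauchy_inequality)
      show "(\<lambda>v. F v w) holomorphic_on ball x r" by (rule holomorphic_on_subset[OF hx]) auto
      show "continuous_on (cball x r) (\<lambda>v. F v w)" using hx holomorphic_on_imp_continuous_on by blast
      show "norm (F y w) \<le> B" if "norm (x - y) = r" for y
      proof -
        have "y \<in> cball x r" using that by (auto simp: dist_norm)
        thus ?thesis using sub \<open>w \<in> cball w0 s\<close> B by blast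
      qed
    qed (use r in auto)
    thus ?thesis by (simp add: fact_2)
  qed
  have est: "norm ((F (v + h n) w - F v w) / h n - deriv (\<lambda>x. F x w) v) \<le> 2 * B / r ^ 2 * norm (h n)"
    if v: "v \<in> cball v0 (r/2)" and w: "w \<in> cball w0 s" for v w n
  proof -
    let ?f = "\<lambda>i. (deriv ^^ i) (\<lambda>v. F v w)"
    have holw: "(\<lambda>v. F v w) holomorphic_on U" using hol w s by blast
    have vin: "v \<in> cball v0 r" using v r by auto
    have "norm (?f 0 (v + h n) - (\<Sum>i\<le>1. ?f i v * (v + h n - v) ^ i / fact i))
          \<le> 2 * B / r ^ 2 * norm (v + h n - v) ^ Suc 1 / fact 1"
    proof (rule complex_Taylor[where S = "cball v0 r"])
      show "(?f i has_field_derivative ?f (Suc i) x) (at x within cball v0 r)" if "x \<in> cball v0 r" for i x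
      proof -
        have "x \<in> U" using that R rR by blast
        from holomorphic_derivI[OF holomorphic_higher_deriv[OF holw oU, of i] oU this] show ?thesis by simp
      qed
      show "norm (?f (Suc 1) x) \<le> 2 * B / r ^ 2" if "x \<in> cball v0 r" for x
        using hol2[OF that w] by (simp add: eval_nat_numeral)
    qed (use mem[OF v] vin in auto)
    hence A: "norm (F (v + h n) w - F v w - deriv (\<lambda>x. F x w) v * h n) \<le> 2 * B / r ^ 2 * norm (h n) ^ 2"
      by (simp add: power2_eq_square algebra_simps)
    note h0 = hnz[of n]
    have "(F (v + h n) w - F v w) / h n - deriv (\<lambda>x. F x w) v
        = (F (v + h n) w - F v w - deriv (\<lambda>x. F x w) v * h n) / h n"
      using h0 by (simp add: field_simps)
    also have "norm \<dots> \<le> (2 * B / r ^ 2 * norm (h n) ^ 2) / norm (h n)"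
      unfolding norm_divide by (intro divide_right_mono A) auto
    also have "\<dots> = 2 * B / r ^ 2 * norm (h n)"
      using h0 by (simp add: power2_eq_square)
    finally show ?thesis .
  qed
  have lim0: "(\<lambda>n. 2 * B / r ^ 2 * norm (h n)) \<longlonglongrightarrow> 0"
  proof -
    have "(\<lambda>n. 2 * B / r ^ 2 * (r / 2) * inverse (real (Suc n))) \<longlonglongrightarrow> 2 * B / r ^ 2 * (r / 2) * 0"
      by (intro tendsto_intros LIMSEQ_inverse_real_of_nat)
    moreover have "2 * B / r ^ 2 * (r / 2) * inverse (real (Suc n)) = 2 * B / r ^ 2 * (r / (2 * real (Suc n)))" for n
      by (simp only: divide_inverse inverse_mult_distrib mult_ac)
    ultimately show ?thesis unfolding hn by simp
  qed
  have ul: "uniform_limit (cball v0 (r/2) \<times> cball w0 s) (\<lambda>n (v, w). (F (v + h n) w - F v w) / h n)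
       (\<lambda>(v, w). deriv (\<lambda>x. F x w) v) sequentially"
  proof (rule uniform_limitI)
    fix e :: real assume "e > 0"
    with lim0 have "\<forall>\<^sub>F n in sequentially. 2 * B / r ^ 2 * norm (h n) < e"
      by (rule order_tendstoD)
    thus "\<forall>\<^sub>F n in sequentially. \<forall>x\<in>cball v0 (r/2) \<times> cball w0 s.
        dist (case x of (v, w) \<Rightarrow> (F (v + h n) w - F v w) / h n) (case x of (v, w) \<Rightarrow> deriv (\<lambda>x. F x w) v) < e"
    proof eventually_elim
      case (elim n)
      show ?case
      proof (clarify)
        fix v w assume "v \<in> cball v0 (r/2)" "w \<in> cball w0 s"
        from est[OF this, of n] elim
        show "dist ((F (v + h n) w - F v w) / h n) (deriv (\<lambda>x. F x w) v) < e"
          unfolding dist_norm by linarith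
      qed
    qed
  qed
  show ?thesis
  proof (rule that[OF _ s(1) _ s(2) _ _ ul])
    show "r / 2 > 0" using r by simp
    show "cball v0 (r/2) \<subseteq> U" using r R by (auto simp: r_def)
    show "h n \<noteq> 0" for n by (rule hnz)
    show "v + h n \<in> U" if "v \<in> cball v0 (r/2)" for n v using mem[OF that] rR R by blast
  qed
qed

text \<open>The v-derivative is a locally uniform limit of difference quotients that are jointly
  continuous and holomorphic in w, and both properties survive such limits. The class is thus closed
  under differentiation, as higher Wirtinger derivatives require.\<close>

lemma sep_holo_deriv:
  assumes F: "sep_holo F U W"
  shows "sep_holo (\<lambda>v w. deriv (\<lambda>x. F x w) v) U W"
proof -
  from F have oU: "open U" and oW: "open W" and cont: "continuous_on (U \<times> W) (\<lambda>(v, w). F v w)"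
    and hol: "\<And>w. w \<in> W \<Longrightarrow> (\<lambda>v. F v w) holomorphic_on U"
    and hol2: "\<And>v. v \<in> U \<Longrightarrow> F v holomorphic_on W"
    by (auto simp: sep_holo_def)
  have "isCont (\<lambda>(v, w). deriv (\<lambda>x. F x w) v) (v0, w0)
      \<and> (\<lambda>w. deriv (\<lambda>x. F x w) v0) field_differentiable (at w0)" if vw: "v0 \<in> U" "w0 \<in> W" for v0 w0
  proof -
    obtain r s h where rs: "r > 0" "s > 0" "cball v0 r \<subseteq> U" "cball w0 s \<subseteq> W" "\<And>n. (h n :: complex) \<noteq> 0"
      "\<And>n v. v \<in> cball v0 r \<Longrightarrow> v + h n \<in> U"
      "uniform_limit (cball v0 r \<times> cball w0 s) (\<lambda>n (v, w). (F (v + h n) w - F v w) / h n)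
         (\<lambda>(v, w). deriv (\<lambda>x. F x w) v) sequentially"
      by (rule sep_holo_difference_quotient[OF F vw]) blast
    have c1: "continuous_on (cball v0 r \<times> cball w0 s) (\<lambda>p. F (fst p + h n) (snd p))" for n
      by (rule continuous_on_compose2[OF cont, where f = "\<lambda>p. (fst p + h n, snd p)", simplified])
         (use rs in \<open>auto intro!: continuous_intros\<close>)
    have c2: "continuous_on (cball v0 r \<times> cball w0 s) (\<lambda>p. F (fst p) (snd p))"
      by (rule continuous_on_subset[OF cont[unfolded case_prod_unfold]]) (use rs in auto)
    have "continuous_on (cball v0 r \<times> cball w0 s) (\<lambda>(v, w). deriv (\<lambda>x. F x w) v)"
      by (rule uniform_limit_theorem[OF _ rs(7)])
         (use rs in \<open>auto simp: case_prod_unfold intro!: always_eventually continuous_intros c1 c2\<close>)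
    hence "continuous_on (ball v0 r \<times> ball w0 s) (\<lambda>(v, w). deriv (\<lambda>x. F x w) v)"
      by (rule continuous_on_subset) auto
    moreover have "open (ball v0 r \<times> ball w0 s)" by (intro open_Times) auto
    moreover have "(v0, w0) \<in> ball v0 r \<times> ball w0 s" using rs by auto
    ultimately have A: "isCont (\<lambda>(v, w). deriv (\<lambda>x. F x w) v) (v0, w0)"
      by (metis continuous_on_eq_continuous_at)
    have hw: "(\<lambda>w. (F (v0 + h n) w - F v0 w) / h n) holomorphic_on cball w0 s" for n
      using rs(1,5) by (intro holomorphic_intros holomorphic_on_subset[OF hol2 rs(4)] rs(6) vw) auto
    have ul: "uniform_limit (cball w0 s) (\<lambda>n w. (F (v0 + h n) w - F v0 w) / h n)
         (\<lambda>w. deriv (\<lambda>x. F x w) v0) sequentially"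
      using rs(7) unfolding uniform_limit_iff using rs(1) by (fastforce elim!: eventually_mono)
    have "continuous_on (cball w0 s) (\<lambda>w. (F (v0 + h n) w - F v0 w) / h n)
        \<and> (\<lambda>w. (F (v0 + h n) w - F v0 w) / h n) holomorphic_on ball w0 s" for n
      using holomorphic_on_imp_continuous_on[OF hw] holomorphic_on_subset[OF hw ball_subset_cball] by blast
    hence "(\<lambda>w. deriv (\<lambda>x. F x w) v0) holomorphic_on ball w0 s"
      using holomorphic_uniform_limit[OF always_eventually ul] by auto
    hence "(\<lambda>w. deriv (\<lambda>x. F x w) v0) field_differentiable (at w0)"
      by (rule holomorphic_on_imp_differentiable_at) (use rs in auto)
    with A show ?thesis by blast
  qed
  note * = this
  show ?thesis unfolding sep_holo_def
  proof (intro conjI ballI oU oW)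
    show "continuous_on (U \<times> W) (\<lambda>(v, w). deriv (\<lambda>x. F x w) v)"
      using * by (intro continuous_at_imp_continuous_on) auto
    show "(\<lambda>v. deriv (\<lambda>x. F x w) v) holomorphic_on U" if "w \<in> W" for w
      using holomorphic_deriv[OF hol[OF that] oU] .
    show "(\<lambda>w. deriv (\<lambda>x. F x w) v) holomorphic_on W" if "v \<in> U" for v
      using * that oW by (auto simp: holomorphic_on_open field_differentiable_def)
  qed
qed

lemma sep_holo_swap: "sep_holo F U W \<Longrightarrow> sep_holo (\<lambda>w v. F v w) W U"
  unfolding sep_holo_def
  by (auto simp: case_prod_unfold intro!: continuous_on_compose2[of "U \<times> W" "\<lambda>p. F (fst p) (snd p)" _ "\<lambda>p. (snd p, fst p)", simplified] continuous_intros)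

text \<open>The total derivative exists because both partial derivatives do and the one in w is
  continuous. It feeds the chain rule along w = cnj v, where both arguments move at once.\<close>

lemma sep_holo_has_derivative:
  assumes F: "sep_holo F U W" and vw: "v \<in> U" "w \<in> W"
  shows "((\<lambda>(x, y). F x y) has_derivative
     (\<lambda>(dx, dy). deriv (\<lambda>x. F x w) v * dx + deriv (F v) w * dy)) (at (v, w))"
proof -
  from F have oU: "open U" and oW: "open W"
    and hol: "\<And>w. w \<in> W \<Longrightarrow> (\<lambda>v. F v w) holomorphic_on U"
    and hol2: "\<And>v. v \<in> U \<Longrightarrow> F v holomorphic_on W"
    by (auto simp: sep_holo_def)
  obtain s where s: "s > 0" "ball w s \<subseteq> W" using oW vw open_contains_ball by blast
  have "sep_holo (\<lambda>v w. deriv (F v) w) U W"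
    using sep_holo_swap[OF sep_holo_deriv[OF sep_holo_swap[OF F]]] by simp
  hence c: "continuous_on (U \<times> ball w s) (\<lambda>(v, w). deriv (F v) w)"
    using s unfolding sep_holo_def by (auto intro: continuous_on_subset)
  have o: "open (U \<times> ball w s)" using oU by (intro open_Times) auto
  have m: "(v, w) \<in> U \<times> ball w s" using vw s by auto
  have "((\<lambda>(x, y). F x y) has_derivative
     (\<lambda>(tx, ty). deriv (\<lambda>x. F x w) v * tx + blinfun_apply (blinfun_mult_right (deriv (F v) w)) ty)) (at (v, w) within U \<times> ball w s)"
  proof (rule has_derivative_partialsI)
    show "((\<lambda>x. F x w) has_derivative (*) (deriv (\<lambda>x. F x w) v)) (at v within U)"
      using holomorphic_derivI[OF hol oU] vw has_field_derivative_at_within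
      unfolding has_field_derivative_def by blast
    show "(F x has_derivative blinfun_apply (blinfun_mult_right (deriv (F x) y))) (at y within ball w s)"
      if "x \<in> U" "y \<in> ball w s" for x y
      using holomorphic_derivI[OF hol2 oW, of x y] that s has_field_derivative_at_within
      unfolding has_field_derivative_def blinfun_mult_right.rep_eq by blast
    have "continuous (at (v, w) within U \<times> ball w s) (\<lambda>(x, y). deriv (F x) y)"
      using c m by (auto simp: continuous_on_eq_continuous_within)
    hence "continuous (at (v, w) within U \<times> ball w s) (\<lambda>p. blinfun_mult_right (deriv (F (fst p)) (snd p)))"
      unfolding case_prod_unfold by (intro bounded_linear.continuous[OF bounded_linear_blinfun_mult_right])
    thus "continuous (at (v, w) within U \<times> ball w s) (\<lambda>(x, y). blinfun_mult_right (deriv (F x) y))"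
      by (simp add: case_prod_unfold)
  qed (use s in auto)
  thus ?thesis
    using at_within_open[OF m o] by (simp add: blinfun_mult_right.rep_eq)
qed

text \<open>By the chain rule the derivative along v + c t is a c + b cnj c, with a and b the
  partial derivatives in v and w. The combination of c = 1 and c = \<i> in \<open>wirtinger\<close>
  cancels b and leaves a.\<close>

lemma sep_holo_wirtinger:
  assumes F: "sep_holo F U W" and v: "v \<in> U" "cnj v \<in> W"
    and f: "\<And>x. x \<in> U \<Longrightarrow> cnj x \<in> W \<Longrightarrow> f x = F x (cnj x)"
  shows "wirtinger f v = deriv (\<lambda>x. F x (cnj v)) v"
proof -
  from F have oU: "open U" and oW: "open W" by (auto simp: sep_holo_def)
  define D where "D = U \<inter> cnj -` W"
  have oD: "open D" unfolding D_def using oU oW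
    by (intro open_Int open_vimage) (auto intro!: continuous_intros)
  let ?a = "deriv (\<lambda>x. F x (cnj v)) v" and ?b = "deriv (F v) (cnj v)"
  have *: "((\<lambda>t::real. f (v + c * of_real t)) has_vector_derivative (?a * c + ?b * cnj c)) (at 0)" for c
  proof -
    have "((\<lambda>(x, y). F x y) has_derivative (\<lambda>(dx, dy). ?a * dx + ?b * dy)) (at (v + c * of_real 0, cnj (v + c * of_real 0)))"
      using sep_holo_has_derivative[OF F v] by simp
    moreover have "((\<lambda>t::real. (v + c * of_real t, cnj (v + c * of_real t))) has_derivative (\<lambda>t. (c * of_real t, cnj (c * of_real t)))) (at 0)"
      by (auto intro!: derivative_eq_intros)
    ultimately have "((\<lambda>t::real. F (v + c * of_real t) (cnj (v + c * of_real t))) has_derivative (\<lambda>t. ?a * (c * of_real t) + ?b * cnj (c * of_real t))) (at 0)"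
      using has_derivative_compose[of "\<lambda>t::real. (v + c * of_real t, cnj (v + c * of_real t))" _ 0 UNIV "\<lambda>(x, y). F x y"] by (fastforce)
    hence "((\<lambda>t::real. F (v + c * of_real t) (cnj (v + c * of_real t))) has_vector_derivative (?a * c + ?b * cnj c)) (at 0)"
      unfolding has_vector_derivative_def by (simp add: scaleR_conv_of_real algebra_simps)
    moreover have "open ((\<lambda>t::real. v + c * of_real t) -` D)"
      by (intro open_vimage oD) (auto intro!: continuous_intros)
    moreover have "0 \<in> (\<lambda>t::real. v + c * of_real t) -` D" using v by (auto simp: D_def)
    ultimately show ?thesis
      by (rule has_vector_derivative_transform_within_open) (auto simp: D_def f)
  qed
  from *[of 1] *[of \<i>] show ?thesis
    unfolding wirtinger_def by (simp add: vector_derivative_at algebra_simps)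
qed

text \<open>The induction needs F and f arbitrary and agreement on a whole neighbourhood: one
  Wirtinger derivative of f is again the restriction to w = cnj x of a function of the same class,
  namely the v-derivative of F.\<close>

lemma sep_holo_wirtinger_funpow:
  assumes "sep_holo F U W" and "v \<in> U" "cnj v \<in> W"
    and "\<And>x. x \<in> U \<Longrightarrow> cnj x \<in> W \<Longrightarrow> f x = F x (cnj x)"
  shows "(wirtinger ^^ j) f v = (deriv ^^ j) (\<lambda>x. F x (cnj v)) v"
  using assms
proof (induction j arbitrary: F f)
  case (Suc j)
  have "(wirtinger ^^ Suc j) f v = (wirtinger ^^ j) (wirtinger f) v"
    by (simp add: funpow_swap1)
  also have "\<dots> = (deriv ^^ j) (\<lambda>x. deriv (\<lambda>y. F y (cnj v)) x) v"
    using Suc.prems by (intro Suc.IH[OF sep_holo_deriv] sep_holo_wirtinger) auto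
  also have "\<dots> = (deriv ^^ Suc j) (\<lambda>x. F x (cnj v)) v"
    by (simp add: funpow_swap1)
  finally show ?case .
qed auto

text \<open>The factor \<open>zor_poly g u\<close> is holomorphic near u, so it can be absorbed into
  F. The iterated Wirtinger derivative becomes an iterated complex derivative, which is the residue
  of a holomorphic function over a power of v - u.\<close>

lemma res_ra_eq_residue:
  assumes F: "sep_holo F U W" and u: "u \<in> U" "cnj u \<in> W"
    and f: "\<And>x. x \<in> U \<Longrightarrow> cnj x \<in> W \<Longrightarrow> f x = F x (cnj x)"
    and pole: "is_pole g u" and iso: "isolated_singularity_at g u"
  shows "res_ra f g u = residue (\<lambda>v. F v (cnj u) * g v) u"
proof -
  from F have oU: "open U" and oW: "open W" and cont: "continuous_on (U \<times> W) (\<lambda>(v, w). F v w)"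
    and hol: "\<And>w. w \<in> W \<Longrightarrow> (\<lambda>v. F v w) holomorphic_on U"
    and hol2: "\<And>v. v \<in> U \<Longrightarrow> F v holomorphic_on W"
    by (auto simp: sep_holo_def)
  from iso obtain r0 where r0: "r0 > 0" "g analytic_on ball u r0 - {u}"
    unfolding isolated_singularity_at_def by auto
  have gh: "g holomorphic_on ball u r0 - {u}" using r0 analytic_imp_holomorphic by blast
  define P where "P = zor_poly g u"
  define s where "s = nat (- zorder g u)"
  obtain r where neg: "zorder g u < 0" and r: "r > 0" "cball u r \<subseteq> ball u r0" "P holomorphic_on cball u r"
    "\<And>w. w \<in> cball u r - {u} \<Longrightarrow> g w = P w / (w - u) ^ s"
    using zorder_exist_pole[OF gh _ _ pole] r0 unfolding P_def s_def by auto
  obtain n where n: "s = Suc n" using neg unfolding s_def by (metis not0_implies_Suc nat_eq_iff2 zero_less_nat_eq less_irrefl neg_0_less_iff_less)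
  define V where "V = U \<inter> ball u r"
  have oV: "open V" and uV: "u \<in> V" using oU u r by (auto simp: V_def)
  have Ph: "P holomorphic_on V" using r(3) holomorphic_on_subset unfolding V_def by (metis Int_lower2 ball_subset_cball order_trans)
  have G: "sep_holo (\<lambda>v w. F v w * P v) V W"
    unfolding sep_holo_def
  proof (intro conjI ballI oV oW)
    have "continuous_on (V \<times> W) (\<lambda>p. F (fst p) (snd p))"
      by (rule continuous_on_subset[OF cont[unfolded case_prod_unfold]]) (auto simp: V_def)
    moreover have "continuous_on (V \<times> W) (\<lambda>p. P (fst p))"
      by (rule continuous_on_compose2[OF holomorphic_on_imp_continuous_on[OF Ph]]) (auto intro!: continuous_intros)
    ultimately show "continuous_on (V \<times> W) (\<lambda>(v, w). F v w * P v)"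
      unfolding case_prod_unfold by (intro continuous_intros)
    show "(\<lambda>v. F v w * P v) holomorphic_on V" if "w \<in> W" for w
      using hol[OF that] Ph by (intro holomorphic_intros) (auto simp: V_def intro: holomorphic_on_subset)
    show "(\<lambda>w. F v w * P v) holomorphic_on W" if "v \<in> V" for v
      using hol2[of v] that by (intro holomorphic_intros) (auto simp: V_def)
  qed
  have "res_ra f g u = (wirtinger ^^ n) (\<lambda>v. f v * P v) u / fact n"
    unfolding res_ra_def Let_def P_def[symmetric] s_def[symmetric] n by simp
  also have "(wirtinger ^^ n) (\<lambda>v. f v * P v) u = (deriv ^^ n) (\<lambda>v. F v (cnj u) * P v) u"
    by (rule sep_holo_wirtinger_funpow[OF G]) (use uV u f in \<open>auto simp: V_def\<close>)
  also have "\<dots> / fact n = residue (\<lambda>v. F v (cnj u) * P v / (v - u) ^ Suc n) u"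
    by (rule residue_holomorphic_over_power[symmetric, OF oV uV])
       (use G u in \<open>auto simp: sep_holo_def\<close>)
  also have "\<dots> = residue (\<lambda>v. F v (cnj u) * g v) u"
  proof (rule residue_cong)
    have "\<forall>\<^sub>F v in at u. v \<in> ball u r - {u}"
      using r eventually_at_ball'[of r u UNIV] by (auto elim: eventually_mono)
    thus "\<forall>\<^sub>F v in at u. F v (cnj u) * P v / (v - u) ^ Suc n = F v (cnj u) * g v"
      by eventually_elim (use r n in auto)
  qed auto
  finally show ?thesis .
qed

subsection \<open>Dominated series of functions\<close>

text \<open>The finite exceptional set N may depend on K. It absorbs the finitely many terms of the
  Appell series whose denominators can come close to 0 on K.\<close>

definition dominated_on :: "('a::metric_space) set \<Rightarrow> 'i set \<Rightarrow> ('i \<Rightarrow> 'a \<Rightarrow> complex) \<Rightarrow> bool" where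
  "dominated_on S A f \<longleftrightarrow> (\<forall>K. compact K \<and> K \<subseteq> S \<longrightarrow>
     (\<exists>N M. finite N \<and> M summable_on A \<and> (\<forall>n\<in>A - N. \<forall>x\<in>K. norm (f n x) \<le> M n)))"

text \<open>The exceptional terms are continuous, hence bounded on K; replacing the majorant on N by
  these bounds gives one that is valid for all indices.\<close>

lemma dominated_on_compact:
  fixes f :: "'i \<Rightarrow> 'a::metric_space \<Rightarrow> complex"
  assumes dom: "dominated_on S A f" and cont: "\<And>n. n \<in> A \<Longrightarrow> continuous_on S (f n)"
    and K: "compact K" "K \<subseteq> S"
  obtains M :: "'i \<Rightarrow> real" where "M summable_on A" "\<And>n x. n \<in> A \<Longrightarrow> x \<in> K \<Longrightarrow> norm (f n x) \<le> M n"
proof -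
  obtain N M where N: "finite N" and M: "M summable_on A" "\<And>n x. n \<in> A - N \<Longrightarrow> x \<in> K \<Longrightarrow> norm (f n x) \<le> M n"
    using dom K unfolding dominated_on_def by metis
  have "\<exists>B. \<forall>x\<in>K. norm (f n x) \<le> B" if "n \<in> A" for n
  proof -
    have "compact (f n ` K)"
      by (intro compact_continuous_image K continuous_on_subset[OF cont[OF that] K(2)])
    thus ?thesis using compact_imp_bounded bounded_iff by (metis image_eqI)
  qed
  then obtain B where B: "\<And>n x. n \<in> A \<Longrightarrow> x \<in> K \<Longrightarrow> norm (f n x) \<le> B n" by metis
  define M' where "M' n = (if n \<in> N then B n else M n)" for n
  have "M summable_on (A - N)" using M(1) by (rule summable_on_subset_banach) auto
  hence "M' summable_on (A - N)" by (rule summable_on_cong[THEN iffD1, rotated]) (auto simp: M'_def)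
  moreover have "M' summable_on (A \<inter> N)" using N by (intro summable_on_finite) auto
  ultimately have "M' summable_on ((A - N) \<union> (A \<inter> N))" by (rule summable_on_Un_disjoint) auto
  moreover have "(A - N) \<union> (A \<inter> N) = A" by auto
  ultimately have "M' summable_on A" by simp
  thus ?thesis by (rule that) (use B M in \<open>auto simp: M'_def\<close>)
qed

lemma dominated_on_uniform_limit:
  fixes f :: "'i \<Rightarrow> 'a::metric_space \<Rightarrow> complex"
  assumes "dominated_on S A f" and "\<And>n. n \<in> A \<Longrightarrow> continuous_on S (f n)"
    and "compact K" "K \<subseteq> S"
  shows "uniform_limit K (\<lambda>X x. \<Sum>n\<in>X. f n x) (\<lambda>x. \<Sum>\<^sub>\<infinity>n\<in>A. f n x) (finite_subsets_at_top A)"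
proof -
  obtain M :: "'i \<Rightarrow> real" where "M summable_on A" "\<And>n x. n \<in> A \<Longrightarrow> x \<in> K \<Longrightarrow> norm (f n x) \<le> M n"
    using dominated_on_compact[OF assms] by blast
  thus ?thesis by (intro Weierstrass_m_test_general)
qed

lemma dominated_on_summable:
  fixes f :: "'i \<Rightarrow> 'a::metric_space \<Rightarrow> complex"
  assumes "dominated_on S A f" and "\<And>n. n \<in> A \<Longrightarrow> continuous_on S (f n)" and "x \<in> S"
  shows "(\<lambda>n. f n x) summable_on A"
proof -
  obtain M :: "'i \<Rightarrow> real" where M: "M summable_on A" "\<And>n y. n \<in> A \<Longrightarrow> y \<in> {x} \<Longrightarrow> norm (f n y) \<le> M n"
    using dominated_on_compact[OF assms(1,2), of "{x}"] assms(3) by auto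
  show ?thesis
    by (rule abs_summable_summable, rule Infinite_Sum.abs_summable_on_comparison_test'[OF M(1)]) (use M in auto)
qed

lemma dominated_on_continuous:
  fixes f :: "'i \<Rightarrow> 'a::heine_borel \<Rightarrow> complex"
  assumes "dominated_on S A f" and cont: "\<And>n. n \<in> A \<Longrightarrow> continuous_on S (f n)" and S: "open S"
  shows "continuous_on S (\<lambda>x. \<Sum>\<^sub>\<infinity>n\<in>A. f n x)"
proof (rule continuous_at_imp_continuous_on, rule ballI)
  fix x assume "x \<in> S"
  then obtain e where e: "e > 0" "cball x e \<subseteq> S" using S open_contains_cball by blast
  have "continuous_on (cball x e) (\<lambda>x. \<Sum>\<^sub>\<infinity>n\<in>A. f n x)"
  proof (rule uniform_limit_theorem[OF _ dominated_on_uniform_limit[OF assms(1,2) compact_cball e(2)]])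
    show "\<forall>\<^sub>F X in finite_subsets_at_top A. continuous_on (cball x e) (\<lambda>x. \<Sum>n\<in>X. f n x)"
      using eventually_finite_subsets_at_top_weakI
      by (rule eventually_mono)
         (auto intro!: continuous_on_sum continuous_on_subset[OF cont e(2)])
  qed auto
  thus "isCont (\<lambda>x. \<Sum>\<^sub>\<infinity>n\<in>A. f n x) x" using e
    by (meson centre_in_ball continuous_on_interior interior_cball mem_interior_cball order_refl)
qed

lemma eventually_finite_subsets_subset: "\<forall>\<^sub>F X in finite_subsets_at_top A. finite X \<and> X \<subseteq> A"
  by (rule eventually_finite_subsets_at_top_weakI) auto

text \<open>Termwise differentiation, from the uniform convergence of the finite partial sums on a
  disc. One D is both the derivative of the sum and the sum of the derivatives; the w-derivative of
  R is identified through it.\<close>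

lemma dominated_on_has_sum_deriv:
  fixes f :: "'i \<Rightarrow> complex \<Rightarrow> complex"
  assumes dom: "dominated_on S A f" and hol: "\<And>n. n \<in> A \<Longrightarrow> f n holomorphic_on S" and S: "open S" "x \<in> S"
  shows "\<exists>D. ((\<lambda>x. \<Sum>\<^sub>\<infinity>n\<in>A. f n x) has_field_derivative D) (at x) \<and> ((\<lambda>n. deriv (f n) x) has_sum D) A"
proof -
  obtain e where e: "e > 0" "cball x e \<subseteq> S" using S open_contains_cball by blast
  have ul: "uniform_limit (cball x e) (\<lambda>X x. \<Sum>n\<in>X. f n x) (\<lambda>x. \<Sum>\<^sub>\<infinity>n\<in>A. f n x) (finite_subsets_at_top A)"
    by (rule dominated_on_uniform_limit[OF dom _ compact_cball e(2)])
       (use hol holomorphic_on_imp_continuous_on in blast)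
  have "\<forall>\<^sub>F X in finite_subsets_at_top A. continuous_on (cball x e) (\<lambda>x. \<Sum>n\<in>X. f n x)
     \<and> (\<forall>w\<in>ball x e. ((\<lambda>x. \<Sum>n\<in>X. f n x) has_field_derivative (\<Sum>n\<in>X. deriv (f n) w)) (at w))"
    using eventually_finite_subsets_subset
  proof eventually_elim
    case (elim X)
    have "(f n has_field_derivative deriv (f n) w) (at w)" if "n \<in> X" "w \<in> ball x e" for n w
      using hol[of n] that elim e S by (intro holomorphic_derivI[of _ S]) auto
    moreover have "continuous_on (cball x e) (f n)" if "n \<in> X" for n
      using continuous_on_subset[OF holomorphic_on_imp_continuous_on[OF hol] e(2), of n] that elim by auto
    ultimately show ?case by (auto intro!: continuous_on_sum DERIV_sum)
  qed
  from has_complex_derivative_uniform_limit[OF this ul _ e(1)] obtain g' where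
   "\<And>w. w \<in> ball x e \<Longrightarrow> ((\<lambda>x. \<Sum>\<^sub>\<infinity>n\<in>A. f n x) has_field_derivative (g' w)) (at w)
         \<and> ((\<lambda>X. \<Sum>n\<in>X. deriv (f n) w) \<longlongrightarrow> g' w) (finite_subsets_at_top A)"
    by auto
  from this[of x] e show ?thesis by (auto simp: has_sum_def)
qed

lemma dominated_on_holomorphic:
  fixes f :: "'i \<Rightarrow> complex \<Rightarrow> complex"
  assumes dom: "dominated_on S A f" and hol: "\<And>n. n \<in> A \<Longrightarrow> f n holomorphic_on S" and S: "open S"
  shows "(\<lambda>x. \<Sum>\<^sub>\<infinity>n\<in>A. f n x) holomorphic_on S"
  using dominated_on_has_sum_deriv[OF dom hol S] S by (auto simp: holomorphic_on_open)

lemma dominated_on_contour_integral: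
  fixes f :: "'i \<Rightarrow> complex \<Rightarrow> complex"
  assumes dom: "dominated_on S A f" and cont: "\<And>n. n \<in> A \<Longrightarrow> continuous_on S (f n)"
    and ab: "closed_segment a b \<subseteq> S"
  shows "((\<lambda>n. contour_integral (linepath a b) (f n)) has_sum
            contour_integral (linepath a b) (\<lambda>x. \<Sum>\<^sub>\<infinity>n\<in>A. f n x)) A"
proof -
  have int: "f n contour_integrable_on linepath a b" if "n \<in> A" for n
    using continuous_on_subset[OF cont[OF that] ab] by (rule contour_integrable_continuous_linepath)
  have "((\<lambda>X. contour_integral (linepath a b) (\<lambda>x. \<Sum>n\<in>X. f n x)) \<longlongrightarrow>
          contour_integral (linepath a b) (\<lambda>x. \<Sum>\<^sub>\<infinity>n\<in>A. f n x)) (finite_subsets_at_top A)"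
  proof (rule contour_integral_uniform_limit(2))
    show "\<forall>\<^sub>F X in finite_subsets_at_top A. (\<lambda>x. \<Sum>n\<in>X. f n x) contour_integrable_on linepath a b"
      using eventually_finite_subsets_subset
      by eventually_elim (auto intro!: contour_integrable_sum int)
    show "uniform_limit (path_image (linepath a b)) (\<lambda>X x. \<Sum>n\<in>X. f n x) (\<lambda>x. \<Sum>\<^sub>\<infinity>n\<in>A. f n x) (finite_subsets_at_top A)"
      by (rule dominated_on_uniform_limit[OF dom cont]) (use ab in auto)
    show "norm (vector_derivative (linepath a b) (at t)) \<le> norm (b - a)" for t by simp
  qed auto
  also have "?this \<longleftrightarrow> ((\<lambda>X. \<Sum>n\<in>X. contour_integral (linepath a b) (f n)) \<longlongrightarrow>
          contour_integral (linepath a b) (\<lambda>x. \<Sum>\<^sub>\<infinity>n\<in>A. f n x)) (finite_subsets_at_top A)"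
  proof (rule tendsto_cong)
    show "\<forall>\<^sub>F X in finite_subsets_at_top A. contour_integral (linepath a b) (\<lambda>x. \<Sum>n\<in>X. f n x)
             = (\<Sum>n\<in>X. contour_integral (linepath a b) (f n))"
      using eventually_finite_subsets_subset
      by eventually_elim (use int in \<open>auto intro!: contour_integral_sum\<close>)
  qed
  finally show ?thesis by (simp add: has_sum_def)
qed

section \<open>Gaussian majorants over the integers\<close>

lemma summable_on_exp_neg_abs_int: "(\<lambda>n::int. exp (- real_of_int \<bar>n\<bar>)) summable_on UNIV"
proof -
  let ?f = "\<lambda>n::int. exp (- real_of_int \<bar>n\<bar>)"
  have "summable (\<lambda>n. exp (-1::real) ^ n)" by (rule summable_geometric) auto
  hence s: "(\<lambda>n::nat. exp (- real n)) summable_on UNIV"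
    by (subst summable_on_UNIV_nonneg_real_iff) (auto simp: exp_of_nat_mult[symmetric] mult.commute)
  have "?f summable_on (range int)"
    by (subst summable_on_reindex) (use s in \<open>auto simp: o_def inj_on_def\<close>)
  moreover have "?f summable_on (range (\<lambda>n. - int n))"
    by (subst summable_on_reindex) (use s in \<open>auto simp: o_def inj_on_def\<close>)
  ultimately have "?f summable_on (range int \<union> range (\<lambda>n. - int n))"
    by (rule summable_on_union)
  moreover have "range int \<union> range (\<lambda>n. - int n) = UNIV"
    by (auto simp: image_def) (metis int_cases2)
  ultimately show ?thesis by simp
qed

text \<open>Completing the square bounds - a n^2 + b |n| by a constant minus |n|, so a two-sided
  geometric series dominates.\<close>

lemma summable_on_gauss:
  fixes a b c :: real
  assumes a: "a > 0"
  shows "(\<lambda>n::int. c * exp (- a * real_of_int n ^ 2 + b * \<bar>real_of_int n\<bar>)) summable_on UNIV"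
proof -
  have le: "exp (- a * real_of_int n ^ 2 + b * \<bar>real_of_int n\<bar>) \<le> exp ((b + 1) ^ 2 / (4 * a)) * exp (- real_of_int \<bar>n\<bar>)" for n
  proof -
    have "0 \<le> a * (\<bar>real_of_int n\<bar> - (b + 1) / (2 * a)) ^ 2" using a by simp
    also have "\<dots> = a * real_of_int n ^ 2 - (b + 1) * \<bar>real_of_int n\<bar> + (b + 1) ^ 2 / (4 * a)"
      using a by (simp add: power2_eq_square field_simps)
    finally show ?thesis unfolding exp_add[symmetric] by (simp add: algebra_simps)
  qed
  have "(\<lambda>n. exp ((b + 1) ^ 2 / (4 * a)) * exp (- real_of_int \<bar>n\<bar>)) summable_on UNIV"
    by (intro summable_on_cmult_right summable_on_exp_neg_abs_int)
  from summable_on_comparison_test[OF this] le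
  have "(\<lambda>n::int. exp (- a * real_of_int n ^ 2 + b * \<bar>real_of_int n\<bar>)) summable_on UNIV" by simp
  thus ?thesis by (rule summable_on_cmult_right)
qed

lemma dominated_on_gauss:
  fixes f :: "int \<Rightarrow> 'a::metric_space \<Rightarrow> complex"
  assumes "a > 0"
    and "\<And>K. compact K \<Longrightarrow> K \<subseteq> S \<Longrightarrow> \<exists>b c N. finite N \<and>
           (\<forall>n\<in>A - N. \<forall>x\<in>K. norm (f n x) \<le> c * exp (- a * real_of_int n ^ 2 + b * \<bar>real_of_int n\<bar>))"
  shows "dominated_on S A f"
  unfolding dominated_on_def
proof (intro allI impI, elim conjE)
  fix K assume "compact K" "K \<subseteq> S"
  then obtain b c N where "finite N" "\<forall>n\<in>A - N. \<forall>x\<in>K. norm (f n x) \<le> c * exp (- a * real_of_int n ^ 2 + b * \<bar>real_of_int n\<bar>)"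
    using assms(2) by metis
  moreover have "(\<lambda>n::int. c * exp (- a * real_of_int n ^ 2 + b * \<bar>real_of_int n\<bar>)) summable_on A"
    by (rule summable_on_subset_banach[OF summable_on_gauss[OF assms(1)]]) auto
  ultimately show "\<exists>N M. finite N \<and> M summable_on A \<and> (\<forall>n\<in>A - N. \<forall>x\<in>K. norm (f n x) \<le> M n)"
    by blast
qed

subsection \<open>The entire function extending E\<close>

definition E_entire :: "complex \<Rightarrow> complex" where
  "E_entire z = contour_integral (linepath 0 z) (\<lambda>s. 2 * exp (- pi * s ^ 2))"

lemma
  fixes a b z :: complex
  shows E_entire_diff: "((\<lambda>s. 2 * exp (- pi * s ^ 2)) has_contour_integral (E_entire b - E_entire a)) (linepath a b)"
  and E_entire_deriv: "(E_entire has_field_derivative 2 * exp (- pi * z ^ 2)) (at z)"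
proof -
  have "(\<lambda>s::complex. 2 * exp (- pi * s ^ 2)) holomorphic_on UNIV"
    by (intro holomorphic_intros)
  from holomorphic_convex_primitive'[OF convex_UNIV open_UNIV this]
  obtain g where "\<And>x. x \<in> UNIV \<Longrightarrow> (g has_field_derivative 2 * exp (- complex_of_real pi * x ^ 2)) (at x within UNIV)"
    by auto
  hence g: "(g has_field_derivative 2 * exp (- complex_of_real pi * x ^ 2)) (at x)" for x by simp
  have *: "((\<lambda>s. 2 * exp (- pi * s ^ 2)) has_contour_integral (g b - g a)) (linepath a b)" for a b
    using contour_integral_primitive[of UNIV g "\<lambda>s. 2 * exp (- pi * s ^ 2)" "linepath a b"] g by simp
  have E: "E_entire z = g z - g 0" for z
    unfolding E_entire_def by (rule contour_integral_unique[OF *])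
  show "((\<lambda>s. 2 * exp (- pi * s ^ 2)) has_contour_integral (E_entire b - E_entire a)) (linepath a b)"
    using *[of b a] by (simp add: E)
  have "((\<lambda>z. g z - g 0) has_field_derivative 2 * exp (- pi * z ^ 2)) (at z)"
    using g by (auto intro!: derivative_eq_intros)
  thus "(E_entire has_field_derivative 2 * exp (- pi * z ^ 2)) (at z)"
    by (simp add: E[abs_def])
qed

lemma E_entire_0 [simp]: "E_entire 0 = 0"
  by (simp add: E_entire_def)

lemma E_entire_holomorphic: "E_entire holomorphic_on S"
  unfolding holomorphic_on_def field_differentiable_def
  using E_entire_deriv has_field_derivative_at_within by blast

lemma E_entire_holomorphic' [holomorphic_intros]: "f holomorphic_on S \<Longrightarrow> (\<lambda>z. E_entire (f z)) holomorphic_on S"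
  using holomorphic_on_compose[OF _ E_entire_holomorphic] by (simp add: o_def)

lemma E_entire_continuous' [continuous_intros]:
   "continuous_on S f \<Longrightarrow> continuous_on S (\<lambda>z. E_entire (f z))"
  using continuous_on_compose2[OF holomorphic_on_imp_continuous_on[OF E_entire_holomorphic[of UNIV]]] by blast

lemma E_entire_minus: "E_entire (- z) = - E_entire z"
proof -
  have "((\<lambda>z. E_entire (- z) + E_entire z) has_field_derivative 0) (at z)" for z
  proof -
    have "((\<lambda>z. E_entire (- z) + E_entire z) has_field_derivative 2 * exp (- pi * (- z) ^ 2) * (-1) + 2 * exp (- pi * z ^ 2)) (at z)"
      by (intro DERIV_add E_entire_deriv DERIV_chain2[where g = uminus]) (auto intro!: derivative_eq_intros)
    thus ?thesis by simp
  qed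
  hence "\<exists>c. \<forall>z\<in>UNIV. E_entire (- z) + E_entire z = c"
    by (intro has_field_derivative_zero_constant) auto
  then obtain c where c: "\<And>z. E_entire (- z) + E_entire z = c" by auto
  from c[of 0] c[of z] show ?thesis by (simp add: eq_neg_iff_add_eq_0)
qed

lemma exp_pi_of_real: "exp (- (complex_of_real pi * of_real x ^ 2)) = of_real (exp (- (pi * x ^ 2)))"
  by (simp flip: exp_of_real)

lemma integrable_exp_pi: "(\<lambda>t::real. exp (- pi * t ^ 2)) integrable_on {a..b}"
  by (intro integrable_continuous_interval continuous_intros)

lemma E_entire_diff_of_real:
  assumes "a \<le> b"
  shows "E_entire (of_real b) - E_entire (of_real a) = of_real (2 * integral {a..b} (\<lambda>t. exp (- pi * t ^ 2)))"
proof (cases "a = b")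
  case False
  hence ab: "a < b" using assms by simp
  have "E_entire (of_real b) - E_entire (of_real a) = integral {a..b} (\<lambda>x. 2 * exp (- pi * (complex_of_real x) ^ 2))"
    using contour_integral_linepath_Reals_eq[of "of_real a" "of_real b" "\<lambda>s. 2 * exp (- pi * s ^ 2)"]
      contour_integral_unique[OF E_entire_diff[of "of_real b" "of_real a"]] ab by simp
  also have "(\<lambda>x. 2 * exp (- pi * (complex_of_real x) ^ 2)) = (\<lambda>x. complex_of_real (2 * exp (- pi * x ^ 2)))"
    by (simp add: exp_pi_of_real)
  also have "integral {a..b} \<dots> = of_real (integral {a..b} (\<lambda>x. 2 * exp (- pi * x ^ 2)))"
    by (rule integral_unique) (intro has_integral_of_real integrable_integral integrable_on_mult_right integrable_exp_pi)
  finally show ?thesis by simp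
qed auto

lemma E_entire_of_real: "E_entire (of_real x) = of_real (E_err x)"
proof (cases "x \<ge> 0")
  case True
  thus ?thesis using E_entire_diff_of_real[of 0 x] by (simp add: E_err_def)
next
  case False
  hence "- E_entire (of_real x) = of_real (2 * integral {x..0} (\<lambda>t. exp (- pi * t ^ 2)))"
    using E_entire_diff_of_real[of x 0] by simp
  also have "\<dots> = - of_real (E_err x)" using False by (simp add: E_err_def)
  finally show ?thesis by simp
qed

lemma E_err_deriv: "(E_err has_real_derivative 2 * exp (- pi * x ^ 2)) (at x)"
proof -
  have "((\<lambda>x. E_entire (of_real x)) has_vector_derivative of_real (2 * exp (- (pi * x ^ 2)))) (at x)"
    using has_vector_derivative_real_field[OF E_entire_deriv[of "of_real x"]] by (simp add: exp_pi_of_real)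
  hence "((\<lambda>x. Re (E_entire (of_real x))) has_vector_derivative Re (of_real (2 * exp (- (pi * x ^ 2))))) (at x)"
    by (rule bounded_linear.has_vector_derivative[OF bounded_linear_Re])
  thus ?thesis unfolding E_entire_of_real
    by (simp add: has_real_derivative_iff_has_vector_derivative)
qed

lemma E_err_mono: "x \<le> y \<Longrightarrow> E_err x \<le> E_err y"
  by (rule DERIV_nonneg_imp_nondecreasing[of x y E_err]) (use E_err_deriv in \<open>auto intro!: exI\<close>)

lemma E_err_minus: "E_err (- x) = - E_err x"
  using E_entire_minus[of "of_real x"] E_entire_of_real by (metis of_real_eq_iff of_real_minus)

lemma E_err_tendsto_1: "(E_err \<longlongrightarrow> 1) at_top"
proof -
  let ?g = "\<lambda>x::real. exp (- pi * x ^ 2)"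
  \<comment> \<open>For this standard deviation the normal density is exactly exp(- pi x^2), which
    gives the total mass 1.\<close>
  define \<sigma> where "\<sigma> = 1 / sqrt (2 * pi)"
  have s: "\<sigma> > 0" "\<sigma>\<^sup>2 = 1 / (2 * pi)" by (auto simp: \<sigma>_def power_divide)
  have "normal_density 0 \<sigma> = ?g"
    using s by (auto simp: normal_density_def fun_eq_iff)
  hence "integrable lborel ?g" "integral\<^sup>L lborel ?g = 1"
    using integrable_normal_density[OF s(1), of 0] integral_normal_density[OF s(1), of 0] by auto
  hence hi: "(?g has_integral 1) UNIV"
    using has_integral_integral_lborel by metis
  show ?thesis
  proof (rule tendstoI)
    fix e :: real assume "e > 0"
    then obtain B where B: "B > 0" "\<And>a b. ball 0 B \<subseteq> cbox a b \<Longrightarrow> norm (integral (cbox a b) ?g - 1) < e"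
      using hi unfolding has_integral_alt'[of ?g] by auto
    show "\<forall>\<^sub>F x in at_top. dist (E_err x) 1 < e"
      using eventually_ge_at_top[of B]
    proof eventually_elim
      case (elim x)
      have "ball 0 B \<subseteq> cbox (-x) x" using elim by (auto simp: dist_norm)
      moreover have "complex_of_real (E_err x - E_err (- x)) = complex_of_real (2 * integral {-x..x} ?g)"
        using E_entire_diff_of_real[of "-x" x] elim B E_entire_of_real[of x] E_entire_of_real[of "-x"] by simp
      hence "E_err x - E_err (- x) = 2 * integral {-x..x} ?g" using of_real_eq_iff by blast
      hence "E_err x = integral (cbox (-x) x) ?g" by (simp add: E_err_minus)
      ultimately show ?case using B(2)[of "-x" x] by (simp add: dist_norm)
    qed
  qed
qed

lemma E_err_le_1: "E_err x \<le> 1"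
  using tendsto_lowerbound[OF E_err_tendsto_1, of "E_err x"] E_err_mono eventually_ge_at_top[of x]
  by (metis (mono_tags, lifting) eventually_mono trivial_limit_at_top_linorder)

text \<open>For x \<ge> 1 the difference exp(- pi x^2) - (1 - E x) is decreasing, since its
  derivative is 2 (1 - pi t) exp(- pi t^2), and it tends to 0. The factor exp pi is there for 0
  \<le> x < 1, where it makes the right-hand side at least 1.\<close>

lemma one_minus_E_err_le:
  assumes "x \<ge> 0"
  shows "1 - E_err x \<le> exp pi * exp (- pi * x ^ 2)"
proof (cases "x \<ge> 1")
  case True
  let ?G = "\<lambda>x. exp (- pi * x ^ 2) - (1 - E_err x)"
  have "?G y \<le> ?G x" if "x \<le> y" for y
  proof (rule DERIV_nonpos_imp_nonincreasing[OF that])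
    fix t assume t: "x \<le> t" "t \<le> y"
    have "(?G has_real_derivative ((- pi * (2 * t)) * exp (- pi * t ^ 2) + 2 * exp (- pi * t ^ 2))) (at t)"
      by (auto intro!: derivative_eq_intros E_err_deriv)
    moreover have "(- pi * (2 * t)) * exp (- pi * t ^ 2) + 2 * exp (- pi * t ^ 2) = 2 * (1 - pi * t) * exp (- pi * t ^ 2)"
      by (simp add: algebra_simps)
    moreover have "pi * t \<ge> 1" using mult_mono[of 1 pi 1 t] pi_gt3 t True by simp
    ultimately show "\<exists>d. (?G has_real_derivative d) (at t) \<and> d \<le> 0"
      by (intro exI[of _ "2 * (1 - pi * t) * exp (- pi * t ^ 2)"]) (auto simp: mult_le_0_iff)
  qed
  moreover have "(?G \<longlongrightarrow> 0 - (1 - 1)) at_top"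
    by (intro tendsto_diff tendsto_const E_err_tendsto_1) real_asymp
  ultimately have "0 - (1 - 1) \<le> ?G x"
    by (intro tendsto_upperbound[of ?G _ at_top]) (auto intro: eventually_mono[OF eventually_ge_at_top[of x]])
  moreover have "1 * exp (- pi * x ^ 2) \<le> exp pi * exp (- pi * x ^ 2)" by (intro mult_right_mono) auto
  ultimately show ?thesis by linarith
next
  case False
  have "E_err x \<ge> 0" using E_err_mono[OF assms] E_entire_of_real[of 0] by simp
  moreover have "pi * x ^ 2 \<le> pi * 1" using False assms by (intro mult_left_mono power_le_one) auto
  hence "1 \<le> exp pi * exp (- pi * x ^ 2)" unfolding exp_add[symmetric] by simp
  ultimately show ?thesis by linarith
qed

lemma E_entire_increment_bound:
  assumes B: "\<And>s. s \<in> closed_segment a b \<Longrightarrow> c \<le> Re (s ^ 2)"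
  shows "norm (E_entire b - E_entire a) \<le> 2 * exp (- pi * c) * norm (b - a)"
proof (rule has_contour_integral_bound_linepath[OF E_entire_diff])
  fix s assume "s \<in> closed_segment a b"
  hence "pi * c \<le> pi * Re (s ^ 2)" using B by (intro mult_left_mono) auto
  thus "norm (2 * exp (- pi * s ^ 2)) \<le> 2 * exp (- pi * c)"
    by (simp add: norm_mult)
qed auto

text \<open>The argument of E in the polarised R is not real but differs from a real number by a
  bounded \<zeta>. On the segment from x to x + \<zeta> the real part of s^2 falls below x^2 by at
  most 2 B |x| + B^2, so the Gaussian decay survives up to a factor exponential in |x|.\<close>

lemma E_entire_bound:
  assumes e: "e = 1 \<and> x \<ge> 0 \<or> e = -1 \<and> x \<le> 0" and \<zeta>: "norm \<zeta> \<le> B"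
  shows "norm (of_real e - E_entire (of_real x + \<zeta>))
          \<le> (exp pi + 2 * B * exp (pi * B ^ 2)) * exp (- pi * x ^ 2 + 2 * pi * B * \<bar>x\<bar>)"
proof -
  have B0: "B \<ge> 0" using \<zeta> norm_ge_zero order_trans by blast
  have 1: "norm (of_real e - E_entire (of_real x)) \<le> exp pi * exp (- pi * x ^ 2)"
  proof -
    have "norm (of_real e - E_entire (of_real x)) = \<bar>e - E_err x\<bar>"
      unfolding E_entire_of_real by (metis norm_of_real of_real_diff)
    also have "\<dots> \<le> exp pi * exp (- pi * x ^ 2)"
      using one_minus_E_err_le[of x] one_minus_E_err_le[of "- x"] E_err_le_1[of x] E_err_le_1[of "-x"] e E_err_minus[of x]
      by auto
    finally show ?thesis .
  qed
  have "norm (E_entire (of_real x + \<zeta>) - E_entire (of_real x))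
      \<le> 2 * exp (- pi * (x ^ 2 - 2 * B * \<bar>x\<bar> - B ^ 2)) * norm ((of_real x + \<zeta>) - of_real x)"
  proof (rule E_entire_increment_bound)
    fix s assume "s \<in> closed_segment (of_real x) (of_real x + \<zeta>)"
    then obtain t where t: "0 \<le> t" "t \<le> 1" "s = of_real x + of_real t * \<zeta>"
      by (auto simp: in_segment scaleR_conv_of_real algebra_simps)
    define w where "w = of_real t * \<zeta>"
    have "norm w \<le> 1 * B" unfolding w_def norm_mult using t \<zeta> by (intro mult_mono) auto
    hence w: "norm w \<le> B" by simp
    have "Re (s ^ 2) = x ^ 2 + 2 * x * Re w + Re (w ^ 2)"
      by (simp add: t(3) flip: w_def) (simp add: power2_eq_square algebra_simps)
    moreover have "\<bar>2 * x * Re w\<bar> \<le> 2 * \<bar>x\<bar> * B"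
      unfolding abs_mult using abs_Re_le_cmod[of w] w by (intro mult_mono) auto
    moreover have "\<bar>Re (w ^ 2)\<bar> \<le> norm (w ^ 2)" by (rule abs_Re_le_cmod)
    moreover have "norm (w ^ 2) \<le> B ^ 2" unfolding norm_power using w by (intro power_mono) auto
    ultimately show "x ^ 2 - 2 * B * \<bar>x\<bar> - B ^ 2 \<le> Re (s ^ 2)" by (simp add: algebra_simps)
  qed
  also have "\<dots> \<le> 2 * exp (- pi * (x ^ 2 - 2 * B * \<bar>x\<bar> - B ^ 2)) * B"
    using \<zeta> by (intro mult_left_mono) auto
  also have "\<dots> = 2 * B * exp (pi * B ^ 2) * exp (- pi * x ^ 2 + 2 * pi * B * \<bar>x\<bar>)"
    by (simp add: algebra_simps flip: exp_add)
  finally have 2: "norm (E_entire (of_real x + \<zeta>) - E_entire (of_real x)) \<le> \<dots>" .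
  have "norm (of_real e - E_entire (of_real x + \<zeta>)) \<le> norm (of_real e - E_entire (of_real x)) + norm (E_entire (of_real x + \<zeta>) - E_entire (of_real x))"
    using norm_triangle_ineq4[of "of_real e - E_entire (of_real x)" "E_entire (of_real x + \<zeta>) - E_entire (of_real x)"] by simp
  also have "exp pi * exp (- pi * x ^ 2) \<le> exp pi * exp (- pi * x ^ 2 + 2 * pi * B * \<bar>x\<bar>)"
    using B0 by (intro mult_left_mono) auto
  with 1 2 have "norm (of_real e - E_entire (of_real x)) + norm (E_entire (of_real x + \<zeta>) - E_entire (of_real x)) \<le>
     exp pi * exp (- pi * x ^ 2 + 2 * pi * B * \<bar>x\<bar>) + 2 * B * exp (pi * B ^ 2) * exp (- pi * x ^ 2 + 2 * pi * B * \<bar>x\<bar>)"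
    by linarith
  finally show ?thesis by (simp add: algebra_simps)
qed

text \<open>E(z) is compared with E(Re z) along a vertical segment. There Re(s^2) is smallest at z
  itself, and Re(\<alpha>^2) > 0 makes it grow quadratically in x, so the difference tends to 0 and
  the real case decides.\<close>

lemma E_entire_tendsto_1:
  assumes \<alpha>: "Re \<alpha> > 0" "Re (\<alpha> ^ 2) > 0"
  shows "((\<lambda>x::real. E_entire (\<alpha> * of_real x + \<beta>)) \<longlongrightarrow> 1) at_top"
proof -
  let ?z = "\<lambda>x::real. \<alpha> * of_real x + \<beta>"
  let ?q = "\<lambda>x::real. Re (\<alpha> ^ 2) * x ^ 2 + 2 * Re (\<alpha> * \<beta>) * x + Re (\<beta> ^ 2)"
  have bd: "norm (E_entire (?z x) - E_entire (of_real (Re (?z x)))) \<le> 2 * exp (- pi * ?q x) * (\<bar>Im \<alpha>\<bar> * \<bar>x\<bar> + \<bar>Im \<beta>\<bar>)" for x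
  proof -
    have "norm (E_entire (?z x) - E_entire (of_real (Re (?z x)))) \<le> 2 * exp (- pi * Re (?z x ^ 2)) * norm (?z x - of_real (Re (?z x)))"
    proof (rule E_entire_increment_bound)
      fix s assume "s \<in> closed_segment (of_real (Re (?z x))) (?z x)"
      then obtain t where t: "0 \<le> t" "t \<le> 1" "s = (1 - t) *\<^sub>R of_real (Re (?z x)) + t *\<^sub>R (?z x)"
        by (auto simp: in_segment)
      have R: "Re s = Re (?z x)" and I: "Im s = t * Im (?z x)" by (auto simp: t(3) algebra_simps)
      have "(Im s)\<^sup>2 \<le> (Im (?z x))\<^sup>2"
        unfolding I power_mult_distrib using t by (intro mult_left_le_one_le power_le_one) auto
      thus "Re (?z x ^ 2) \<le> Re (s ^ 2)" unfolding Re_power2 R by simp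
    qed
    also have "Re (?z x ^ 2) = ?q x" by (simp add: power2_eq_square algebra_simps)
    also have "norm (?z x - of_real (Re (?z x))) = \<bar>Im (?z x)\<bar>"
      by (simp add: cmod_def)
    also have "\<bar>Im (?z x)\<bar> \<le> \<bar>Im \<alpha>\<bar> * \<bar>x\<bar> + \<bar>Im \<beta>\<bar>"
      using abs_triangle_ineq[of "Im \<alpha> * x" "Im \<beta>"] by (simp add: abs_mult)
    finally show ?thesis by (simp add: mult_left_mono)
  qed
  have "((\<lambda>x. 2 * exp (- pi * ?q x) * (\<bar>Im \<alpha>\<bar> * x + \<bar>Im \<beta>\<bar>)) \<longlongrightarrow> 0) at_top"
  proof -
    define a b c A B where abc: "a = Re (\<alpha> ^ 2)" "b = 2 * Re (\<alpha> * \<beta>)" "c = Re (\<beta> ^ 2)" "A = \<bar>Im \<alpha>\<bar>" "B = \<bar>Im \<beta>\<bar>"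
    have "a > 0" using \<alpha> abc by simp
    hence "((\<lambda>x. 2 * exp (- pi * (a * x ^ 2 + b * x + c)) * (A * x + B)) \<longlongrightarrow> 0) at_top"
      by real_asymp
    thus ?thesis by (simp only: abc)
  qed
  moreover have "\<forall>\<^sub>F x in at_top. norm (E_entire (?z x) - E_entire (of_real (Re (?z x)))) \<le> 2 * exp (- pi * ?q x) * (\<bar>Im \<alpha>\<bar> * x + \<bar>Im \<beta>\<bar>)"
    using eventually_ge_at_top[of 0]
  proof eventually_elim
    case (elim x)
    hence "\<bar>x\<bar> = x" by simp
    thus ?case using bd[of x] by (simp only:)
  qed
  ultimately have l1: "((\<lambda>x. E_entire (?z x) - E_entire (of_real (Re (?z x)))) \<longlongrightarrow> 0) at_top"
    by (rule Lim_null_comparison[rotated])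
  have "filterlim (\<lambda>x. Re (?z x)) at_top at_top"
  proof -
    define a b where "a = Re \<alpha>" "b = Re \<beta>"
    have "a > 0" using \<alpha> by (simp add: a_b_def)
    hence "filterlim (\<lambda>x::real. a * x + b) at_top at_top" by real_asymp
    thus ?thesis by (simp add: a_b_def)
  qed
  from filterlim_compose[OF E_err_tendsto_1 this]
  have "((\<lambda>x. E_entire (of_real (Re (?z x)))) \<longlongrightarrow> of_real 1) at_top"
    unfolding E_entire_of_real by (rule tendsto_of_real)
  from tendsto_add[OF l1 this] show ?thesis by simp
qed

lemma E_entire_tendsto_minus_1:
  assumes \<alpha>: "Re \<alpha> > 0" "Re (\<alpha> ^ 2) > 0"
  shows "((\<lambda>x::real. E_entire (- \<alpha> * of_real x + \<beta>)) \<longlongrightarrow> -1) at_top"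
proof -
  have "E_entire (- \<alpha> * of_real x + \<beta>) = - E_entire (\<alpha> * of_real x + (- \<beta>))" for x
    using E_entire_minus[of "\<alpha> * of_real x + (- \<beta>)"] by (simp add: algebra_simps)
  thus ?thesis using tendsto_minus[OF E_entire_tendsto_1[OF \<alpha>, of "- \<beta>"]] by simp
qed

subsection \<open>Theta functions\<close>

lemma exp_2pi_int: "exp (2 * of_real pi * \<i> * of_int k) = 1"
  by (auto simp: exp_eq_1 intro!: exI[of _ k])

lemma exp_eq_int_shift: "a = b + 2 * of_real pi * \<i> * of_int k \<Longrightarrow> exp a = exp b"
  by (simp add: exp_add exp_2pi_int)

lemma dominated_on_mult_continuous:
  fixes f :: "'i \<Rightarrow> 'a::metric_space \<Rightarrow> complex"
  assumes dom: "dominated_on S A f" and g: "continuous_on S g"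
  shows "dominated_on S A (\<lambda>n x. f n x * g x)"
  unfolding dominated_on_def
proof (intro allI impI, elim conjE)
  fix K assume K: "compact K" "K \<subseteq> S"
  then obtain N M where NM: "finite N" "M summable_on A" "\<And>n x. n \<in> A - N \<Longrightarrow> x \<in> K \<Longrightarrow> norm (f n x) \<le> M n"
    using dom unfolding dominated_on_def by metis
  have "compact (g ` K)" by (intro compact_continuous_image K continuous_on_subset[OF g])
  then obtain B where "\<forall>x\<in>g ` K. norm x \<le> B" using compact_imp_bounded bounded_iff by metis
  hence B: "norm (g x) \<le> max B 0" if "x \<in> K" for x using that by (simp add: le_max_iff_disj)
  have "norm (f n x * g x) \<le> M n * max B 0" if "n \<in> A - N" "x \<in> K" for n x
  proof -
    from that have "norm (f n x) \<le> M n" "norm (g x) \<le> max B 0" using NM B by auto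
    thus ?thesis unfolding norm_mult by (intro mult_mono') auto
  qed
  moreover have "(\<lambda>n. M n * max B 0) summable_on A" by (intro summable_on_cmult_left NM)
  ultimately show "\<exists>N M. finite N \<and> M summable_on A \<and> (\<forall>n\<in>A - N. \<forall>x\<in>K. norm (f n x * g x) \<le> M n)"
    using NM(1) by (intro exI[of _ N] exI[of _ "\<lambda>n. M n * max B 0"]) auto
qed

lemma compact_imp_bound_Im:
  fixes g :: "'a::metric_space \<Rightarrow> complex"
  assumes "compact K" "continuous_on K g"
  shows "\<exists>B\<ge>0. \<forall>x\<in>K. \<bar>Im (g x)\<bar> \<le> B \<and> norm (g x) \<le> B"
proof -
  have "compact (g ` K)" by (intro compact_continuous_image assms)
  then obtain B where B: "\<forall>x\<in>g ` K. norm x \<le> B" using compact_imp_bounded bounded_iff by metis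
  have "norm (g x) \<le> max B 0 \<and> \<bar>Im (g x)\<bar> \<le> max B 0" if "x \<in> K" for x
    using B that abs_Im_le_cmod[of "g x"] by fastforce
  thus ?thesis by (intro exI[of _ "max B 0"]) auto
qed

abbreviation rclass :: "nat \<Rightarrow> int \<Rightarrow> int set" where
  "rclass m l \<equiv> {n::int. n mod (2 * int m) = l mod (2 * int m)}"

lemma rclass_iff: "n \<in> rclass m l \<longleftrightarrow> (\<exists>k. n = 2 * int m * k + l)"
proof
  assume "n \<in> rclass m l"
  hence "2 * int m dvd n - l" by (simp add: mod_eq_dvd_iff)
  thus "\<exists>k. n = 2 * int m * k + l" by (metis dvd_def diff_eq_eq)
qed auto

lemma bij_betw_rclass:
  assumes "m > 0"
  shows "bij_betw (\<lambda>k. 2 * int m * k + l) UNIV (rclass m l)"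
  unfolding bij_betw_def
proof
  show "inj (\<lambda>k. 2 * int m * k + l)" using assms by (auto simp: inj_on_def)
  show "range (\<lambda>k. 2 * int m * k + l) = rclass m l" using rclass_iff[of _ m l] by blast
qed

lemma bij_betw_rclass_shift: "bij_betw (\<lambda>n. n + 2 * int m) (rclass m l) (rclass m l)"
  by (rule bij_betwI[where g = "\<lambda>n. n - 2 * int m"]) (auto simp: mod_add_right_eq)

text \<open>Kept general in \<tau>: evaluated at (- \<tau>, - v) it is also the exponential in R,
  where it grows with n, and at (- cnj \<tau>, - w) it appears in the w-derivative of R.\<close>

definition theta_term :: "nat \<Rightarrow> complex \<Rightarrow> int \<Rightarrow> complex \<Rightarrow> complex" where
  "theta_term m \<tau> n z = exp (pi * \<i> * of_int n ^ 2 * \<tau> / (2 * of_nat m) + 2 * pi * \<i> * of_int n * z)"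

lemma theta_ml_eq: "theta_ml m l z \<tau> = (\<Sum>\<^sub>\<infinity>n\<in>rclass m l. theta_term m \<tau> n z)"
  unfolding theta_ml_def theta_term_def ..

lemma norm_theta_term:
  "norm (theta_term m \<tau> n z) = exp (- (pi * Im \<tau> / (2 * real m)) * real_of_int n ^ 2 - 2 * pi * real_of_int n * Im z)"
proof -
  have "pi * \<i> * of_int n ^ 2 * \<tau> / (2 * of_nat m) + 2 * pi * \<i> * of_int n * z
      = of_real (pi * real_of_int n ^ 2 / (2 * real m)) * (\<i> * \<tau>) + of_real (2 * pi * real_of_int n) * (\<i> * z)"
    by (simp add: field_simps)
  hence "Re (pi * \<i> * of_int n ^ 2 * \<tau> / (2 * of_nat m) + 2 * pi * \<i> * of_int n * z)
      = (pi * real_of_int n ^ 2 / (2 * real m)) * Re (\<i> * \<tau>) + (2 * pi * real_of_int n) * Re (\<i> * z)"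
    by (simp only: plus_complex.sel Re_complex_of_real Im_complex_of_real times_complex.sel[of "of_real _"] mult_zero_left diff_zero)
  thus ?thesis unfolding theta_term_def norm_exp_eq_Re by (simp add: algebra_simps)
qed

lemma theta_term_dominated:
  assumes "m > 0" "Im \<tau> > 0"
  shows "dominated_on S A (theta_term m \<tau>)"
proof (rule dominated_on_gauss)
  show "pi * Im \<tau> / (2 * real m) > 0" using assms by simp
  fix K :: "complex set" assume "compact K"
  then obtain B where B: "B \<ge> 0" "\<And>z. z \<in> K \<Longrightarrow> \<bar>Im z\<bar> \<le> B"
    using compact_imp_bound_Im[OF \<open>compact K\<close> continuous_on_id] by blast
  have "norm (theta_term m \<tau> n z) \<le> 1 * exp (- (pi * Im \<tau> / (2 * real m)) * real_of_int n ^ 2 + 2 * pi * B * \<bar>real_of_int n\<bar>)"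
    if "z \<in> K" for n z
  proof -
    have "- (real_of_int n * Im z) \<le> \<bar>real_of_int n * Im z\<bar>" by simp
    also have "\<dots> \<le> \<bar>real_of_int n\<bar> * B" unfolding abs_mult using B that by (intro mult_left_mono) auto
    finally have "2 * pi * (- (real_of_int n * Im z)) \<le> 2 * pi * (\<bar>real_of_int n\<bar> * B)"
      by (intro mult_left_mono) auto
    thus ?thesis unfolding norm_theta_term by (simp add: algebra_simps)
  qed
  thus "\<exists>b c N. finite N \<and> (\<forall>n\<in>A - N. \<forall>x\<in>K. norm (theta_term m \<tau> n x)
          \<le> c * exp (- (pi * Im \<tau> / (2 * real m)) * (real_of_int n)\<^sup>2 + b * \<bar>real_of_int n\<bar>))"
    by (intro exI[of _ "2 * pi * B"] exI[of _ 1] exI[of _ "{}"]) blast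
qed

lemma theta_term_holomorphic: "theta_term m \<tau> n holomorphic_on S"
  unfolding theta_term_def by (intro holomorphic_intros)

lemma theta_term_continuous: "continuous_on S (theta_term m \<tau> n)"
  using theta_term_holomorphic holomorphic_on_imp_continuous_on by blast

lemma theta_term_summable: "m > 0 \<Longrightarrow> Im \<tau> > 0 \<Longrightarrow> (\<lambda>n. theta_term m \<tau> n z) summable_on A"
  by (rule dominated_on_summable[OF theta_term_dominated, where S = UNIV]) (auto intro: theta_term_continuous)

lemma theta_ml_holomorphic:
  assumes "m > 0" "Im \<tau> > 0"
  shows "(\<lambda>z. theta_ml m l z \<tau>) holomorphic_on S"
  using dominated_on_holomorphic[OF theta_term_dominated[OF assms, of UNIV] theta_term_holomorphic open_UNIV]
  unfolding theta_ml_eq by (rule holomorphic_on_subset) auto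

lemma theta_ml_holomorphic' [holomorphic_intros]:
  assumes "m > 0" "Im \<tau> > 0" "f holomorphic_on S"
  shows "(\<lambda>z. theta_ml m l (f z) \<tau>) holomorphic_on S"
  using holomorphic_on_compose_gen[OF assms(3) theta_ml_holomorphic[OF assms(1,2), of l UNIV]] by (simp add: o_def)

lemma theta_ml_plus_1: "theta_ml m l (z + 1) \<tau> = theta_ml m l z \<tau>"
  unfolding theta_ml_eq theta_term_def
  by (intro infsum_cong exp_eq_int_shift) (simp add: algebra_simps)

text \<open>Completing the square turns the shift of z by \<tau> into the index shift n to n + 2m,
  which permutes the residue class.\<close>

lemma theta_ml_plus_tau:
  assumes "m > 0"
  shows "theta_ml m l (z + \<tau>) \<tau> = exp (- 2 * pi * \<i> * of_nat m * (\<tau> + 2 * z)) * theta_ml m l z \<tau>"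
proof -
  have *: "theta_term m \<tau> n (z + \<tau>) = exp (- 2 * pi * \<i> * of_nat m * (\<tau> + 2 * z)) * theta_term m \<tau> (n + 2 * int m) z" for n
    unfolding theta_term_def exp_add[symmetric] using assms
    by (intro arg_cong[of _ _ exp]) (simp add: field_simps power2_eq_square)
  have "theta_ml m l (z + \<tau>) \<tau> = exp (- 2 * pi * \<i> * of_nat m * (\<tau> + 2 * z)) * (\<Sum>\<^sub>\<infinity>n\<in>rclass m l. theta_term m \<tau> (n + 2 * int m) z)"
    unfolding theta_ml_eq * by (rule infsum_cmult_right')
  also have "(\<Sum>\<^sub>\<infinity>n\<in>rclass m l. theta_term m \<tau> (n + 2 * int m) z) = theta_ml m l z \<tau>"
    unfolding theta_ml_eq by (rule infsum_reindex_bij_betw[OF bij_betw_rclass_shift])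
  finally show ?thesis .
qed

text \<open>With n = 2mk + l the two exponents differ by 2 pi \<i> times the integer m k^2 + k l, up
  to the sign c. The value c = 1 serves theta, c = -1 serves R.\<close>

lemma exp_rclass_square:
  assumes "m > 0" "n \<in> rclass m l" and that: "c = 1 \<or> c = -1"
  shows "exp (c * (pi * \<i> * of_int n ^ 2 / (2 * of_nat m))) = exp (c * (pi * \<i> * of_int l ^ 2 / (2 * of_nat m)))"
proof -
  obtain k where k: "n = 2 * int m * k + l" using assms rclass_iff by blast
  show ?thesis
  proof (rule exp_eq_int_shift[where k = "(if c = 1 then 1 else - 1) * (int m * k ^ 2 + k * l)"])
    show "c * (pi * \<i> * of_int n ^ 2 / (2 * of_nat m)) = c * (pi * \<i> * of_int l ^ 2 / (2 * of_nat m))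
       + 2 * of_real pi * \<i> * of_int ((if c = 1 then 1 else - 1) * (int m * k ^ 2 + k * l))"
      using that assms unfolding k by (auto simp: field_simps power2_eq_square)
  qed
qed

lemma theta_ml_tau_plus_1:
  assumes "m > 0"
  shows "theta_ml m l z (\<tau> + 1) = exp (pi * \<i> * of_int l ^ 2 / (2 * of_nat m)) * theta_ml m l z \<tau>"
proof -
  have "theta_term m (\<tau> + 1) n z = exp (pi * \<i> * of_int l ^ 2 / (2 * of_nat m)) * theta_term m \<tau> n z"
    if "n \<in> rclass m l" for n
  proof -
    have "theta_term m (\<tau> + 1) n z = exp (pi * \<i> * of_int n ^ 2 / (2 * of_nat m)) * theta_term m \<tau> n z"
      unfolding theta_term_def exp_add[symmetric] by (simp add: add_divide_distrib algebra_simps)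
    thus ?thesis using exp_rclass_square[OF assms that, of 1] by simp
  qed
  hence "theta_ml m l z (\<tau> + 1) = (\<Sum>\<^sub>\<infinity>n\<in>rclass m l. exp (pi * \<i> * of_int l ^ 2 / (2 * of_nat m)) * theta_term m \<tau> n z)"
    unfolding theta_ml_eq by (rule infsum_cong)
  thus ?thesis unfolding theta_ml_eq by (simp add: infsum_cmult_right')
qed

lemma theta_ml_minus: "theta_ml m l (- z) \<tau> = theta_ml m (- l) z \<tau>"
proof -
  have "bij_betw uminus (rclass m l) (rclass m (- l))"
    by (rule bij_betwI[where g = uminus]) (auto, (metis mod_minus_cong minus_minus)+)
  hence "(\<Sum>\<^sub>\<infinity>n\<in>rclass m (- l). theta_term m \<tau> n z) = (\<Sum>\<^sub>\<infinity>n\<in>rclass m l. theta_term m \<tau> (- n) z)"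
    by (rule infsum_reindex_bij_betw[symmetric])
  thus ?thesis unfolding theta_ml_eq theta_term_def by simp
qed

lemma contour_integral_exp_unit:
  "contour_integral (linepath p (p + 1)) (\<lambda>z. exp (2 * pi * \<i> * of_int k * z)) = (if k = 0 then 1 else 0)"
proof (cases "k = 0")
  case False
  define c :: complex where "c = 2 * pi * \<i> * of_int k"
  have c: "c \<noteq> 0" using False by (simp add: c_def)
  have "((\<lambda>z. exp (c * z) / c) has_field_derivative exp (c * z)) (at z within UNIV)" for z
    using c by (auto intro!: derivative_eq_intros)
  hence "((\<lambda>z. exp (c * z)) has_contour_integral exp (c * (p + 1)) / c - exp (c * p) / c) (linepath p (p + 1))"
    using contour_integral_primitive[of UNIV "\<lambda>z. exp (c * z) / c" "\<lambda>z. exp (c * z)" "linepath p (p + 1)"] by simp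
  moreover have "exp (c * (p + 1)) = exp (c * p)"
    by (rule exp_eq_int_shift[of _ _ k]) (simp add: c_def algebra_simps)
  ultimately show ?thesis using False contour_integral_unique unfolding c_def by fastforce
qed auto

text \<open>Integrating termwise over a period keeps only the index n = \<nu>; as l and \<nu> are
  both reduced, this index lies in the class of l only if l = \<nu>.\<close>

lemma theta_ml_fourier:
  assumes m: "m > 0" "Im \<tau> > 0" and l: "0 \<le> l" "l < 2 * int m" "0 \<le> \<nu>" "\<nu> < 2 * int m"
  shows "contour_integral (linepath p (p + 1)) (\<lambda>z. theta_ml m l z \<tau> * exp (- 2 * pi * \<i> * of_int \<nu> * z))
          = (if l = \<nu> then exp (pi * \<i> * of_int \<nu> ^ 2 * \<tau> / (2 * of_nat m)) else 0)"
proof -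
  let ?e = "\<lambda>z. exp (- 2 * pi * \<i> * of_int \<nu> * z)"
  let ?c = "exp (pi * \<i> * of_int \<nu> ^ 2 * \<tau> / (2 * of_nat m))"
  have "((\<lambda>n. contour_integral (linepath p (p + 1)) (\<lambda>z. theta_term m \<tau> n z * ?e z)) has_sum
      contour_integral (linepath p (p + 1)) (\<lambda>z. \<Sum>\<^sub>\<infinity>n\<in>rclass m l. theta_term m \<tau> n z * ?e z)) (rclass m l)"
    by (rule dominated_on_contour_integral[of UNIV])
       (auto intro!: dominated_on_mult_continuous theta_term_dominated m continuous_intros theta_term_continuous)
  also have "(\<lambda>n. contour_integral (linepath p (p + 1)) (\<lambda>z. theta_term m \<tau> n z * ?e z)) = (\<lambda>n. if n = \<nu> then ?c else 0)"
  proof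
    fix n
    have "(\<lambda>z. theta_term m \<tau> n z * ?e z) = (\<lambda>z. exp (pi * \<i> * of_int n ^ 2 * \<tau> / (2 * of_nat m)) * exp (2 * pi * \<i> * of_int (n - \<nu>) * z))"
      unfolding theta_term_def exp_add[symmetric] by (intro ext arg_cong[of _ _ exp]) (simp add: algebra_simps)
    moreover have "(\<lambda>z. exp (2 * pi * \<i> * of_int (n - \<nu>) * z)) contour_integrable_on linepath p (p + 1)"
      by (intro contour_integrable_continuous_linepath continuous_intros)
    ultimately show "contour_integral (linepath p (p + 1)) (\<lambda>z. theta_term m \<tau> n z * ?e z) = (if n = \<nu> then ?c else 0)"
      using contour_integral_exp_unit[of p "n - \<nu>"] by (simp add: contour_integral_lmul)
  qed
  also have "(\<lambda>z. \<Sum>\<^sub>\<infinity>n\<in>rclass m l. theta_term m \<tau> n z * ?e z) = (\<lambda>z. theta_ml m l z \<tau> * ?e z)"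
    unfolding theta_ml_eq by (simp add: infsum_cmult_left')
  finally have "((\<lambda>n. if n = \<nu> then ?c else 0) has_sum
      contour_integral (linepath p (p + 1)) (\<lambda>z. theta_ml m l z \<tau> * ?e z)) (rclass m l)" .
  moreover have "((\<lambda>n. if n = \<nu> then ?c else 0) has_sum (if l = \<nu> then ?c else 0)) (rclass m l)"
  proof -
    have "\<nu> \<in> rclass m l \<longleftrightarrow> l = \<nu>" using l by auto
    moreover have "((\<lambda>n. if n = \<nu> then ?c else 0) has_sum (\<Sum>n\<in>{\<nu>} \<inter> rclass m l. if n = \<nu> then ?c else 0)) (rclass m l)"
      by (rule has_sum_finite_neutralI[of "{\<nu>} \<inter> rclass m l"]) auto
    moreover have "{\<nu>} \<inter> rclass m l = (if \<nu> \<in> rclass m l then {\<nu>} else {})" by auto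
    ultimately show ?thesis by (cases "l = \<nu>") simp_all
  qed
  ultimately show ?thesis by (rule has_sum_unique)
qed

lemma theta_ml_independent:
  assumes m: "m > 0" "Im \<tau> > 0"
    and eq: "\<And>z. (\<Sum>l\<in>{0..<2 * int m}. c l * theta_ml m l z \<tau>) = 0"
    and \<nu>: "0 \<le> \<nu>" "\<nu> < 2 * int m"
  shows "c \<nu> = 0"
proof -
  have int: "(\<lambda>z. theta_ml m l z \<tau> * exp (- 2 * pi * \<i> * of_int \<nu> * z)) contour_integrable_on linepath 0 (0 + 1)" for l
    by (intro contour_integrable_holomorphic_simple[of _ UNIV] holomorphic_intros m) auto
  have "0 = contour_integral (linepath 0 (0 + 1)) (\<lambda>z. \<Sum>l\<in>{0..<2 * int m}. c l * (theta_ml m l z \<tau> * exp (- 2 * pi * \<i> * of_int \<nu> * z)))"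
    using eq by (simp add: mult.assoc[symmetric] sum_distrib_right[symmetric] del: mult_minus_left)
  also have "\<dots> = (\<Sum>l\<in>{0..<2 * int m}. c l * contour_integral (linepath 0 (0 + 1)) (\<lambda>z. theta_ml m l z \<tau> * exp (- 2 * pi * \<i> * of_int \<nu> * z)))"
  proof -
    have "contour_integral (linepath 0 (0 + 1)) (\<lambda>z. \<Sum>l\<in>{0..<2 * int m}. c l * (theta_ml m l z \<tau> * exp (- 2 * pi * \<i> * of_int \<nu> * z)))
      = (\<Sum>l\<in>{0..<2 * int m}. contour_integral (linepath 0 (0 + 1)) (\<lambda>z. c l * (theta_ml m l z \<tau> * exp (- 2 * pi * \<i> * of_int \<nu> * z))))"
      by (intro contour_integral_sum contour_integrable_lmul int) simp
    thus ?thesis by (simp only: contour_integral_lmul[OF int])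
  qed
  also have "\<dots> = (\<Sum>l\<in>{0..<2 * int m}. if l = \<nu> then c l * exp (pi * \<i> * of_int \<nu> ^ 2 * \<tau> / (2 * of_nat m)) else 0)"
    by (intro sum.cong refl) (subst theta_ml_fourier[OF m], use \<nu> in auto)
  also have "\<dots> = c \<nu> * exp (pi * \<i> * of_int \<nu> ^ 2 * \<tau> / (2 * of_nat m))"
    using \<nu> by (subst sum.delta) auto
  finally show ?thesis by simp
qed

subsection \<open>The Appell function\<close>

definition f_term :: "nat \<Rightarrow> complex \<Rightarrow> complex \<Rightarrow> int \<Rightarrow> complex \<Rightarrow> complex" where
  "f_term m z \<tau> n u = exp (2 * pi * \<i> * of_nat m * of_int n ^ 2 * \<tau> + 4 * pi * \<i> * of_nat m * of_int n * z)
        / (1 - exp (2 * pi * \<i> * of_int n * \<tau> + 2 * pi * \<i> * (z - u)))"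

lemma f_u_eq: "f_u m u z \<tau> = (\<Sum>\<^sub>\<infinity>n\<in>UNIV. f_term m z \<tau> n u)"
  unfolding f_u_def f_term_def ..

lemma f_term_denom_0_iff:
  "exp (2 * pi * \<i> * of_int n * \<tau> + 2 * pi * \<i> * (z - u)) = 1 \<longleftrightarrow> (\<exists>k::int. u = z + of_int n * \<tau> + of_int k)"
proof -
  have "exp (2 * pi * \<i> * of_int n * \<tau> + 2 * pi * \<i> * (z - u)) = exp (2 * of_real pi * \<i> * (of_int n * \<tau> + z - u))"
    by (simp add: algebra_simps)
  also have "\<dots> = 1 \<longleftrightarrow> (\<exists>k::int. 2 * of_real pi * \<i> * (of_int n * \<tau> + z - u) = of_int (2 * k) * of_real pi * \<i>)"
    using exp_eq[of "2 * of_real pi * \<i> * (of_int n * \<tau> + z - u)" 0] by simp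
  also have "\<dots> \<longleftrightarrow> (\<exists>k::int. of_int n * \<tau> + z - u = of_int k)"
  proof (intro ex_cong1)
    fix k :: int
    have "of_int (2 * k) * of_real pi * \<i> = 2 * of_real pi * \<i> * (of_int k :: complex)" by simp
    thus "2 * of_real pi * \<i> * (of_int n * \<tau> + z - u) = of_int (2 * k) * of_real pi * \<i> \<longleftrightarrow> of_int n * \<tau> + z - u = of_int k"
      by (metis (no_types, opaque_lifting) complex_i_not_zero mult_cancel_left mult_eq_0_iff of_real_eq_0_iff pi_neq_zero zero_neq_numeral)
  qed
  also have "\<dots> \<longleftrightarrow> (\<exists>k::int. u = z + of_int n * \<tau> + of_int k)"
  proof
    assume "\<exists>k::int. of_int n * \<tau> + z - u = of_int k"
    then obtain k :: int where "of_int n * \<tau> + z - u = of_int k" by blast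
    hence "u = z + of_int n * \<tau> + of_int (- k)" by (simp add: algebra_simps)
    thus "\<exists>k::int. u = z + of_int n * \<tau> + of_int k" by blast
  next
    assume "\<exists>k::int. u = z + of_int n * \<tau> + of_int k"
    then obtain k :: int where "u = z + of_int n * \<tau> + of_int k" by blast
    hence "of_int n * \<tau> + z - u = of_int (- k)" by (simp add: algebra_simps)
    thus "\<exists>k::int. of_int n * \<tau> + z - u = of_int k" by blast
  qed
  finally show ?thesis .
qed

text \<open>S may contain poles: once |n| is large, the exponential in the denominator has modulus
  at most exp(-1) or at least exp 1 on K, so the denominator has modulus at least 1/2, and the
  finitely many other n go into the exceptional set.\<close>

lemma f_term_dominated:
  assumes m: "m > 0" "Im \<tau> > 0"
  shows "dominated_on S A (f_term m z \<tau>)"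
proof (rule dominated_on_gauss)
  define y where "y = Im \<tau>"
  show "2 * pi * real m * y > 0" using assms by (simp add: y_def)
  fix K :: "complex set" assume "compact K"
  then obtain B where B: "B \<ge> 0" "\<And>u. u \<in> K \<Longrightarrow> \<bar>Im (z - u)\<bar> \<le> B"
    using compact_imp_bound_Im[OF \<open>compact K\<close> continuous_on_diff[OF continuous_on_const continuous_on_id]] by blast
  \<comment> \<open>Chosen so that for n outside \<open>{-L..L}\<close> the imaginary part of n
    \<tau> + z - u has modulus at least 1 for all u in K.\<close>
  define L where "L = \<lceil>(B + 1) / y\<rceil>"
  have L: "(B + 1) \<le> real_of_int L * y"
    using assms mult_right_mono[OF le_of_int_ceiling[of "(B + 1) / y"], of y] unfolding L_def y_def[symmetric] by simp
  have e1: "exp (1::real) \<ge> 2" using exp_ge_add_one_self[of 1] by simp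
  have e2: "exp (-1::real) \<le> 1/2" using e1 by (simp add: exp_minus field_simps)
  have "norm (f_term m z \<tau> n u) \<le> 2 * exp (- (2 * pi * real m * y) * real_of_int n ^ 2 + (4 * pi * real m * \<bar>Im z\<bar>) * \<bar>real_of_int n\<bar>)"
    if u: "u \<in> K" and n: "n \<notin> {-L..L}" for n u
  proof -
    let ?X = "exp (2 * pi * \<i> * of_int n * \<tau> + 2 * pi * \<i> * (z - u))"
    have nX: "norm ?X = exp (- (2 * pi * (real_of_int n * y + Im (z - u))))"
      unfolding norm_exp_eq_Re y_def by (simp add: algebra_simps)
    have d: "norm (1 - ?X) \<ge> 1/2"
    proof (cases "n > L")
      case True
      hence "real_of_int L * y \<le> real_of_int n * y" using m by (intro mult_right_mono) (auto simp: y_def)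
      hence "1 \<le> real_of_int n * y + Im (z - u)" using L B(2)[OF u] by linarith
      hence "1 * 1 \<le> (2 * pi) * (real_of_int n * y + Im (z - u))" using pi_gt3 by (intro mult_mono) auto
      hence "norm ?X \<le> exp (-1)" unfolding nX by simp
      moreover have "norm (1::complex) - norm ?X \<le> norm (1 - ?X)" by (rule norm_triangle_ineq2)
      ultimately show ?thesis using e2 unfolding norm_one by linarith
    next
      case False
      hence "n < - L" using n by auto
      hence "real_of_int n * y \<le> real_of_int (- L) * y" using m by (intro mult_right_mono) (auto simp: y_def)
      hence "1 \<le> - (real_of_int n * y + Im (z - u))" using L B(2)[OF u] by auto
      hence "1 * 1 \<le> (2 * pi) * - (real_of_int n * y + Im (z - u))" using pi_gt3 by (intro mult_mono) auto
      hence "norm ?X \<ge> exp 1" unfolding nX exp_le_cancel_iff by linarith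
      moreover have "norm ?X - norm (1::complex) \<le> norm (?X - 1)" by (rule norm_triangle_ineq2)
      ultimately show ?thesis using e1 unfolding norm_one norm_minus_commute[of ?X] by linarith
    qed
    have "norm (exp (2 * pi * \<i> * of_nat m * of_int n ^ 2 * \<tau> + 4 * pi * \<i> * of_nat m * of_int n * z))
        = exp (- (2 * pi * real m * y) * real_of_int n ^ 2 - 4 * pi * real m * (real_of_int n * Im z))"
      unfolding norm_exp_eq_Re y_def by (simp add: power2_eq_square algebra_simps)
    also have "\<dots> \<le> exp (- (2 * pi * real m * y) * real_of_int n ^ 2 + (4 * pi * real m * \<bar>Im z\<bar>) * \<bar>real_of_int n\<bar>)"
    proof -
      have "- (real_of_int n * Im z) \<le> \<bar>Im z\<bar> * \<bar>real_of_int n\<bar>"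
        using abs_ge_minus_self[of "real_of_int n * Im z"] by (simp add: abs_mult mult.commute)
      hence "(4 * pi * real m) * - (real_of_int n * Im z) \<le> (4 * pi * real m) * (\<bar>Im z\<bar> * \<bar>real_of_int n\<bar>)"
        by (intro mult_left_mono) auto
      thus ?thesis by (simp add: mult.assoc)
    qed
    finally have "norm (f_term m z \<tau> n u) \<le> \<dots> / (1/2)"
      unfolding f_term_def norm_divide using d by (intro frac_le) auto
    thus ?thesis by simp
  qed
  thus "\<exists>b c N. finite N \<and> (\<forall>n\<in>A - N. \<forall>u\<in>K. norm (f_term m z \<tau> n u)
          \<le> c * exp (- (2 * pi * real m * y) * (real_of_int n)\<^sup>2 + b * \<bar>real_of_int n\<bar>))"
  by (intro exI[of _ "4 * pi * real m * \<bar>Im z\<bar>"] exI[of _ 2] exI[of _ "{-L..L}"] conjI ballI) simp_all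
qed

text \<open>The translate of the lattice by z; it contains the poles of u \<mapsto> f_u(z).\<close>

definition coset :: "complex \<Rightarrow> complex \<Rightarrow> complex set" where
  "coset z \<tau> = {u. u - z \<in> lattice \<tau>}"

lemma coset_iff: "u \<in> coset z \<tau> \<longleftrightarrow> (\<exists>n k::int. u = z + of_int n * \<tau> + of_int k)"
  unfolding coset_def lattice_def by (auto simp: algebra_simps)

lemma f_term_holomorphic:
  assumes "\<And>u k. u \<in> S \<Longrightarrow> u \<noteq> z + of_int n * \<tau> + of_int (k::int)"
  shows "f_term m z \<tau> n holomorphic_on S"
  unfolding f_term_def
  by (intro holomorphic_intros) (use f_term_denom_0_iff assms in \<open>metis right_minus_eq\<close>)

lemma f_term_holomorphic': "f_term m z \<tau> n holomorphic_on (- coset z \<tau>)"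
  by (rule f_term_holomorphic) (auto simp: coset_iff)

text \<open>The real coordinates s, t of w = s \<tau> + t.\<close>
definition tau_coord :: "complex \<Rightarrow> complex \<Rightarrow> real" where "tau_coord \<tau> w = Im w / Im \<tau>"
definition one_coord :: "complex \<Rightarrow> complex \<Rightarrow> real" where "one_coord \<tau> w = Re w - tau_coord \<tau> w * Re \<tau>"

lemma coord_eq: "Im \<tau> > 0 \<Longrightarrow> of_real (tau_coord \<tau> w) * \<tau> + of_real (one_coord \<tau> w) = w"
  by (simp add: complex_eq_iff tau_coord_def one_coord_def)

lemma coord_add_scaled:
  assumes "Im \<tau> > 0"
  shows "tau_coord \<tau> (w + of_real a * \<tau> + of_real b) = tau_coord \<tau> w + a"
    and "one_coord \<tau> (w + of_real a * \<tau> + of_real b) = one_coord \<tau> w + b"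
  using assms by (auto simp: tau_coord_def one_coord_def field_simps)

lemma continuous_on_coord [continuous_intros]:
  "continuous_on S f \<Longrightarrow> continuous_on S (\<lambda>w. tau_coord \<tau> (f w))"
  "continuous_on S f \<Longrightarrow> continuous_on S (\<lambda>w. one_coord \<tau> (f w))"
  unfolding one_coord_def tau_coord_def divide_inverse by (auto intro!: continuous_intros)

lemma lattice_iff_coord:
  assumes "Im \<tau> > 0"
  shows "w \<in> lattice \<tau> \<longleftrightarrow> tau_coord \<tau> w \<in> \<int> \<and> one_coord \<tau> w \<in> \<int>"
proof
  assume "w \<in> lattice \<tau>"
  then obtain a b :: int where "w = of_int a * \<tau> + of_int b" by (auto simp: lattice_def)
  hence "w = 0 + of_real (of_int a) * \<tau> + of_real (of_int b)" by simp
  thus "tau_coord \<tau> w \<in> \<int> \<and> one_coord \<tau> w \<in> \<int>"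
    using coord_add_scaled[OF assms, of 0 "of_int a" "of_int b"] by (simp add: tau_coord_def one_coord_def)
next
  assume "tau_coord \<tau> w \<in> \<int> \<and> one_coord \<tau> w \<in> \<int>"
  then obtain a b :: int where "tau_coord \<tau> w = of_int a" "one_coord \<tau> w = of_int b" by (auto elim!: Ints_cases)
  hence "w = of_int a * \<tau> + of_int b" using coord_eq[OF assms, of w] by simp
  thus "w \<in> lattice \<tau>" by (auto simp: lattice_def)
qed

lemma closed_coset: assumes "Im \<tau> > 0" shows "closed (coset z \<tau>)"
proof -
  have "coset z \<tau> = (\<lambda>u. tau_coord \<tau> (u - z)) -` \<int> \<inter> (\<lambda>u. one_coord \<tau> (u - z)) -` \<int>"
    using assms by (auto simp: coset_def lattice_iff_coord)
  thus ?thesis by (simp add: closed_Int closed_vimage continuous_intros closed_Ints)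
qed

lemma open_Compl_coset: "Im \<tau> > 0 \<Longrightarrow> open (- coset z \<tau>)"
  using closed_coset by (simp add: open_Compl)

lemma f_u_holomorphic:
  assumes "m > 0" "Im \<tau> > 0"
  shows "(\<lambda>u. f_u m u z \<tau>) holomorphic_on (- coset z \<tau>)"
  unfolding f_u_eq
  by (rule dominated_on_holomorphic[OF f_term_dominated[OF assms] f_term_holomorphic' open_Compl_coset[OF assms(2)]])

lemma f_term_summable:
  assumes "m > 0" "Im \<tau> > 0"
  shows "(\<lambda>n. f_term m z \<tau> n u) summable_on A"
  by (rule dominated_on_summable[OF f_term_dominated[OF assms, of "{u}"]]) auto

lemma f_u_plus_1: "f_u m (u + 1) z \<tau> = f_u m u z \<tau>"
proof -
  have "exp (2 * pi * \<i> * of_int n * \<tau> + 2 * pi * \<i> * (z - (u + 1))) = exp (2 * pi * \<i> * of_int n * \<tau> + 2 * pi * \<i> * (z - u))" for n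
    by (rule exp_eq_int_shift[where k = "-1"]) (simp add: algebra_simps)
  thus ?thesis unfolding f_u_def by simp
qed

lemma f_u_tau_plus_1: "f_u m u z (\<tau> + 1) = f_u m u z \<tau>"
proof -
  have "exp (2 * pi * \<i> * of_int n * (\<tau> + 1) + 2 * pi * \<i> * (z - u)) = exp (2 * pi * \<i> * of_int n * \<tau> + 2 * pi * \<i> * (z - u))" for n
    by (rule exp_eq_int_shift[where k = "n"]) (simp add: algebra_simps)
  moreover have "exp (2 * pi * \<i> * of_nat m * of_int n ^ 2 * (\<tau> + 1) + 4 * pi * \<i> * of_nat m * of_int n * z)
     = exp (2 * pi * \<i> * of_nat m * of_int n ^ 2 * \<tau> + 4 * pi * \<i> * of_nat m * of_int n * z)" for n
    by (rule exp_eq_int_shift[where k = "int m * n ^ 2"]) (simp add: algebra_simps)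
  ultimately show ?thesis unfolding f_u_def by (simp only:)
qed

lemma has_sum_complex_diff:
  fixes f g :: "'i \<Rightarrow> complex"
  assumes "(f has_sum a) A" "(g has_sum b) A"
  shows "((\<lambda>x. f x - g x) has_sum (a - b)) A"
  using has_sum_add[OF assms(1), of "\<lambda>x. - g x" "- b"] assms(2) by (simp add: has_sum_uminus)

lemma has_sum_finite_sum:
  fixes f :: "'j \<Rightarrow> 'i \<Rightarrow> complex"
  assumes "\<And>j. j \<in> J \<Longrightarrow> (f j has_sum a j) A"
  shows "((\<lambda>x. \<Sum>j\<in>J. f j x) has_sum (\<Sum>j\<in>J. a j)) A"
  using assms by (induction J rule: infinite_finite_induct) (auto intro!: has_sum_add)

lemma sum_exp_geometric:
  fixes w :: complex
  assumes "exp w \<noteq> 1"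
  shows "(\<Sum>l\<in>{0..<2 * int m}. exp (of_int l * w)) = (1 - exp (2 * of_nat m * w)) / (1 - exp w)"
proof -
  have "(\<Sum>l\<in>{0..<2 * int m}. exp (of_int l * w)) = (\<Sum>l\<in>int ` {0..<2 * m}. exp (of_int l * w))"
    by (simp add: image_int_atLeastLessThan)
  also have "\<dots> = (\<Sum>l<2 * m. exp w ^ l)"
    by (subst sum.reindex) (auto simp: exp_of_nat_mult lessThan_atLeast0)
  also have "\<dots> = (1 - exp w ^ (2 * m)) / (1 - exp w)"
    unfolding geometric_sum[OF assms, of "2 * m"]
    by (subst frac_eq_eq) (use assms in \<open>auto simp: algebra_simps\<close>)
  also have "exp w ^ (2 * m) = exp (2 * of_nat m * w)"
    by (simp flip: exp_of_nat_mult)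
  finally show ?thesis .
qed

text \<open>Passing to index n + 1 leaves the denominator 1 - exp w unchanged and, up to the common
  factor, multiplies the numerator by exp (2 m w). The quotient (1 - exp (2 m w)) / (1 - exp w) is a
  geometric sum of 2m powers, and these are terms of the 2m theta functions.\<close>

lemma f_u_plus_tau:
  fixes u z \<tau> :: complex
  assumes m: "m > 0" "Im \<tau> > 0" and u: "u \<notin> coset z \<tau>"
  shows "f_u m (u + \<tau>) z \<tau> = exp (2 * pi * \<i> * of_nat m * (\<tau> + 2 * u)) *
     (f_u m u z \<tau> - (\<Sum>l\<in>{0..<2 * int m}. exp (- pi * \<i> * of_int l ^ 2 * \<tau> / (2 * of_nat m) - 2 * pi * \<i> * of_int l * u) * theta_ml m l z \<tau>))"
    (is "_ = ?C * (_ - (\<Sum>l\<in>?L. ?a l * _))")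
proof -
  have 1: "f_term m z \<tau> (n + 1) (u + \<tau>) = ?C * (f_term m z \<tau> n u - (\<Sum>l\<in>?L. ?a l * theta_term m \<tau> (2 * int m * n + l) z))" for n
  proof -
    define w where "w = 2 * pi * \<i> * of_int n * \<tau> + 2 * pi * \<i> * (z - u)"
    define P where "P = exp (2 * pi * \<i> * of_nat m * of_int n ^ 2 * \<tau> + 4 * pi * \<i> * of_nat m * of_int n * z)"
    have w: "exp w \<noteq> 1" unfolding w_def f_term_denom_0_iff using u by (auto simp: coset_iff)
    have f: "f_term m z \<tau> n u = P / (1 - exp w)" by (simp add: f_term_def w_def P_def)
    have "exp (2 * pi * \<i> * of_nat m * of_int (n + 1) ^ 2 * \<tau> + 4 * pi * \<i> * of_nat m * of_int (n + 1) * z) = ?C * (P * exp (2 * of_nat m * w))"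
      unfolding P_def w_def exp_add[symmetric] by (intro arg_cong[of _ _ exp]) (simp add: algebra_simps power2_eq_square)
    moreover have "2 * pi * \<i> * of_int (n + 1) * \<tau> + 2 * pi * \<i> * (z - (u + \<tau>)) = w"
      by (simp add: w_def algebra_simps)
    ultimately have f': "f_term m z \<tau> (n + 1) (u + \<tau>) = ?C * (P * exp (2 * of_nat m * w)) / (1 - exp w)"
      unfolding f_term_def by (simp only:)
    have "?a l * theta_term m \<tau> (2 * int m * n + l) z = P * exp (of_int l * w)" for l
      unfolding theta_term_def P_def w_def exp_add[symmetric] using m
      by (intro arg_cong[of _ _ exp]) (simp add: field_simps power2_eq_square)
    hence S: "(\<Sum>l\<in>?L. ?a l * theta_term m \<tau> (2 * int m * n + l) z) = P * ((1 - exp (2 * of_nat m * w)) / (1 - exp w))"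
      using sum_exp_geometric[OF w, of m] by (simp add: sum_distrib_left[symmetric])
    show ?thesis unfolding f f' S by (simp add: divide_inverse algebra_simps)
  qed
  have 2: "((\<lambda>n. f_term m z \<tau> n u) has_sum f_u m u z \<tau>) UNIV"
    unfolding f_u_eq by (rule has_sum_infsum[OF f_term_summable[OF m]])
  have 3: "((\<lambda>n. theta_term m \<tau> (2 * int m * n + l) z) has_sum theta_ml m l z \<tau>) UNIV" for l
    unfolding has_sum_reindex_bij_betw[OF bij_betw_rclass[OF m(1)], of "\<lambda>n. theta_term m \<tau> n z"] theta_ml_eq
    by (rule has_sum_infsum[OF theta_term_summable[OF m]])
  have "((\<lambda>n. f_term m z \<tau> (n + 1) (u + \<tau>)) has_sum ?C * (f_u m u z \<tau> - (\<Sum>l\<in>?L. ?a l * theta_ml m l z \<tau>))) UNIV"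
    unfolding 1 by (intro has_sum_cmult_right has_sum_complex_diff 2 has_sum_finite_sum 3)
  moreover have "bij_betw (\<lambda>n::int. n + 1) UNIV UNIV" by (rule bij_betwI[where g = "\<lambda>n. n - 1"]) auto
  ultimately have "((\<lambda>n. f_term m z \<tau> n (u + \<tau>)) has_sum ?C * (f_u m u z \<tau> - (\<Sum>l\<in>?L. ?a l * theta_ml m l z \<tau>))) UNIV"
    using has_sum_reindex_bij_betw by fastforce
  thus ?thesis unfolding f_u_eq[of m "u + \<tau>"] by (rule infsumI)
qed

text \<open>Only the term n = 0 is singular at z. Its residue 1 / (2 pi \<i>) is the normalisation
  by which the pole at z contributes exactly \<phi>(z) to the contour integral.\<close>

lemma f_u_residue_limit:
  assumes m: "m > 0" "Im \<tau> > 0"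
  shows "((\<lambda>u. (u - z) * f_u m u z \<tau>) \<longlongrightarrow> 1 / (2 * pi * \<i>)) (at z)"
proof -
  \<comment> \<open>In this strip no term with n \<noteq> 0 has a pole, since its poles lie at
    height n Im \<tau> relative to z.\<close>
  define S where "S = {u. \<bar>Im (u - z)\<bar> < Im \<tau>}"
  have oS: "open S" unfolding S_def by (intro open_Collect_less continuous_intros)
  have zS: "z \<in> S" using m by (simp add: S_def)
  let ?g = "\<lambda>u. \<Sum>\<^sub>\<infinity>n\<in>UNIV - {0}. f_term m z \<tau> n u"
  have "?g holomorphic_on S"
  proof (rule dominated_on_holomorphic[OF f_term_dominated[OF m] _ oS])
    fix n :: int assume "n \<in> UNIV - {0}"
    hence "1 \<le> \<bar>n\<bar>" by auto
    hence n: "\<bar>real_of_int n\<bar> \<ge> 1" by linarith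
    show "f_term m z \<tau> n holomorphic_on S"
    proof (rule f_term_holomorphic, rule notI)
      fix u k assume u: "u \<in> S" "u = z + of_int n * \<tau> + of_int k"
      hence "\<bar>Im (u - z)\<bar> = \<bar>real_of_int n\<bar> * Im \<tau>" using m by (simp add: abs_mult)
      also have "\<dots> \<ge> 1 * Im \<tau>" using n m by (intro mult_right_mono) auto
      finally show False using u by (simp add: S_def)
    qed
  qed
  hence "isCont ?g z"
    using holomorphic_on_imp_continuous_on oS zS continuous_on_eq_continuous_at by blast
  hence "((\<lambda>u. (u - z) * ?g u) \<longlongrightarrow> (z - z) * ?g z) (at z)"
    by (intro tendsto_intros) (simp add: isCont_def)
  moreover have "((\<lambda>u. (u - z) * f_term m z \<tau> 0 u) \<longlongrightarrow> 1 / (2 * pi * \<i>)) (at z)"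
  proof -
    have "((\<lambda>u. 1 - exp (2 * pi * \<i> * (z - u))) has_field_derivative 2 * pi * \<i>) (at z)"
      by (auto intro!: derivative_eq_intros)
    hence "((\<lambda>u. (1 - exp (2 * pi * \<i> * (z - u))) / (u - z)) \<longlongrightarrow> 2 * pi * \<i>) (at z)"
      by (simp add: has_field_derivative_iff)
    hence "((\<lambda>u. inverse ((1 - exp (2 * pi * \<i> * (z - u))) / (u - z))) \<longlongrightarrow> inverse (2 * pi * \<i>)) (at z)"
      by (rule tendsto_inverse) auto
    moreover have "inverse ((1 - exp (2 * pi * \<i> * (z - u))) / (u - z)) = (u - z) * f_term m z \<tau> 0 u" for u
      unfolding f_term_def inverse_divide by simp
    ultimately show ?thesis by (simp only: inverse_eq_divide[symmetric])
  qed
  ultimately have "((\<lambda>u. (u - z) * f_term m z \<tau> 0 u + (u - z) * ?g u) \<longlongrightarrow> 1 / (2 * pi * \<i>) + (z - z) * ?g z) (at z)"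
    by (intro tendsto_add)
  moreover have "f_u m u z \<tau> = f_term m z \<tau> 0 u + ?g u" for u
    unfolding f_u_eq using infsum_Un_disjoint[of "\<lambda>n. f_term m z \<tau> n u" "{0}" "UNIV - {0}"] f_term_summable[OF m] by simp
  ultimately show ?thesis by (simp add: algebra_simps)
qed

subsection \<open>The polarised correction term\<close>

text \<open>The argument of E in R, with 2 Im u replaced by (v - w) / i.\<close>
definition R_arg :: "nat \<Rightarrow> complex \<Rightarrow> int \<Rightarrow> complex \<Rightarrow> complex \<Rightarrow> complex" where
  "R_arg m \<tau> n v w = (of_int n - \<i> * of_nat m * (v - w) / of_real (Im \<tau>)) * of_real (sqrt (Im \<tau> / real m))"

definition R_term :: "nat \<Rightarrow> complex \<Rightarrow> int \<Rightarrow> complex \<Rightarrow> complex \<Rightarrow> complex" where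
  "R_term m \<tau> n v w = (of_real (sgn (real_of_int n + 1/2)) - E_entire (R_arg m \<tau> n v w)) * theta_term m (- \<tau>) n (- v)"

definition R_pol :: "nat \<Rightarrow> int \<Rightarrow> complex \<Rightarrow> complex \<Rightarrow> complex \<Rightarrow> complex" where
  "R_pol m l v w \<tau> = (\<Sum>\<^sub>\<infinity>n\<in>rclass m l. R_term m \<tau> n v w)"

lemma R_ml_eq_R_pol: "R_ml m l v \<tau> = R_pol m l v (cnj v) \<tau>"
proof -
  have "R_arg m \<tau> n v (cnj v) = of_real ((real_of_int n + 2 * real m * Im v / Im \<tau>) * sqrt (Im \<tau> / real m))" for n
    unfolding R_arg_def complex_diff_cnj by (simp add: algebra_simps)
  note arg = this
  show ?thesis unfolding R_ml_def R_pol_def R_term_def theta_term_def arg E_entire_of_real by simp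
qed

text \<open>With y = Im \<tau>, the factor sgn - E decays like exp(- pi y n^2 / m), while the
  exponential grows only like exp(pi y n^2 / (2 m)); half of the Gaussian decay remains. The
  deviation of the argument of E from n s is bounded by b and costs a factor exponential in
  |n|.\<close>

lemma R_term_bound:
  assumes m: "m > 0" "Im \<tau> > 0" and B: "norm (v - w) \<le> B" "\<bar>Im v\<bar> \<le> B'"
  defines "s \<equiv> sqrt (Im \<tau> / real m)"
  defines "b \<equiv> real m * B / Im \<tau> * s"
  shows "norm (R_term m \<tau> n v w) \<le> (exp pi + 2 * b * exp (pi * b ^ 2)) *
     exp (- (pi * Im \<tau> / (2 * real m)) * real_of_int n ^ 2 + (2 * pi * b * s + 2 * pi * B') * \<bar>real_of_int n\<bar>)"
proof -
  define \<zeta> where "\<zeta> = (- \<i> * of_nat m * (v - w) / of_real (Im \<tau>)) * of_real s"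
  have s: "s \<ge> 0" "s ^ 2 = Im \<tau> / real m" using m by (auto simp: s_def)
  have "norm \<zeta> = real m * norm (v - w) / Im \<tau> * s" using m s by (simp add: \<zeta>_def norm_mult norm_divide)
  also have "\<dots> \<le> b" unfolding b_def using m s B by (intro mult_right_mono divide_right_mono mult_left_mono) auto
  finally have \<zeta>: "norm \<zeta> \<le> b" .
  have arg: "R_arg m \<tau> n v w = of_real (real_of_int n * s) + \<zeta>"
    by (simp add: R_arg_def \<zeta>_def s_def ring_distribs add_divide_distrib diff_divide_distrib)
  have "norm (of_real (sgn (real_of_int n + 1/2)) - E_entire (R_arg m \<tau> n v w)) \<le>
      (exp pi + 2 * b * exp (pi * b ^ 2)) * exp (- pi * (real_of_int n * s) ^ 2 + 2 * pi * b * \<bar>real_of_int n * s\<bar>)"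
    unfolding arg
  proof (rule E_entire_bound[OF _ \<zeta>])
    show "sgn (real_of_int n + 1 / 2) = 1 \<and> 0 \<le> real_of_int n * s \<or> sgn (real_of_int n + 1 / 2) = - 1 \<and> real_of_int n * s \<le> 0"
    proof (cases "n \<ge> 0")
      case False
      hence "real_of_int n \<le> -1" by linarith
      thus ?thesis using s by (auto simp: mult_nonpos_nonneg)
    qed (use s in auto)
  qed
  moreover have "norm (theta_term m (- \<tau>) n (- v)) = exp (pi * Im \<tau> / (2 * real m) * real_of_int n ^ 2 + 2 * pi * (real_of_int n * Im v))"
    unfolding norm_theta_term by simp
  moreover have "\<dots> \<le> exp (pi * Im \<tau> / (2 * real m) * real_of_int n ^ 2 + 2 * pi * (\<bar>real_of_int n\<bar> * B'))"
  proof -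
    have "real_of_int n * Im v \<le> \<bar>real_of_int n\<bar> * B'"
      using mult_left_mono[OF B(2), of "\<bar>real_of_int n\<bar>"] abs_ge_self[of "real_of_int n * Im v"] by (simp add: abs_mult)
    thus ?thesis by simp
  qed
  ultimately have "norm (R_term m \<tau> n v w) \<le> ((exp pi + 2 * b * exp (pi * b ^ 2)) * exp (- pi * (real_of_int n * s) ^ 2 + 2 * pi * b * \<bar>real_of_int n * s\<bar>))
     * exp (pi * Im \<tau> / (2 * real m) * real_of_int n ^ 2 + 2 * pi * (\<bar>real_of_int n\<bar> * B'))"
    unfolding R_term_def norm_mult by (intro mult_mono') auto
  also have "\<dots> = (exp pi + 2 * b * exp (pi * b ^ 2)) * exp (- (pi * Im \<tau> / (2 * real m)) * real_of_int n ^ 2 + (2 * pi * b * s + 2 * pi * B') * \<bar>real_of_int n\<bar>)"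
  proof -
    have "- pi * (real_of_int n * s) ^ 2 + 2 * pi * b * \<bar>real_of_int n * s\<bar> + (pi * Im \<tau> / (2 * real m) * real_of_int n ^ 2 + 2 * pi * (\<bar>real_of_int n\<bar> * B'))
      = - (pi * Im \<tau> / (2 * real m)) * real_of_int n ^ 2 + (2 * pi * b * s + 2 * pi * B') * \<bar>real_of_int n\<bar>"
      unfolding power_mult_distrib s(2) abs_mult abs_of_nonneg[OF s(1)] using m by (simp add: field_simps)
    thus ?thesis unfolding mult.assoc[of "exp pi + _"] exp_add[symmetric] by simp
  qed
  finally show ?thesis .
qed

lemma R_term_dominated:
  assumes "m > 0" "Im \<tau> > 0"
  shows "dominated_on S A (\<lambda>n (v, w). R_term m \<tau> n v w)"
proof (rule dominated_on_gauss)
  show "pi * Im \<tau> / (2 * real m) > 0" using assms by simp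
  fix K :: "(complex \<times> complex) set" assume K: "compact K"
  have "continuous_on K (\<lambda>p. fst p - snd p)" "continuous_on K fst" by (auto intro!: continuous_intros)
  with K obtain B B' where B: "\<And>p. p \<in> K \<Longrightarrow> norm (fst p - snd p) \<le> B" "\<And>p. p \<in> K \<Longrightarrow> \<bar>Im (fst p)\<bar> \<le> B'"
    by (metis compact_imp_bound_Im)
  define s where "s = sqrt (Im \<tau> / real m)"
  define b where "b = real m * B / Im \<tau> * s"
  show "\<exists>b c N. finite N \<and> (\<forall>n\<in>A - N. \<forall>x\<in>K. norm (case x of (v, w) \<Rightarrow> R_term m \<tau> n v w)
          \<le> c * exp (- (pi * Im \<tau> / (2 * real m)) * (real_of_int n)\<^sup>2 + b * \<bar>real_of_int n\<bar>))"
  proof (intro exI conjI ballI)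
    fix n x assume x: "x \<in> K"
    show "norm (case x of (v, w) \<Rightarrow> R_term m \<tau> n v w) \<le> (exp pi + 2 * b * exp (pi * b ^ 2)) *
     exp (- (pi * Im \<tau> / (2 * real m)) * real_of_int n ^ 2 + (2 * pi * b * s + 2 * pi * B') * \<bar>real_of_int n\<bar>)"
      using R_term_bound[OF assms B(1)[OF x] B(2)[OF x]] unfolding b_def s_def case_prod_unfold .
  qed (rule finite.emptyI)
qed

lemma dominated_on_slice:
  fixes f :: "'i \<Rightarrow> 'a::metric_space \<Rightarrow> complex" and g :: "'b::metric_space \<Rightarrow> 'a"
  assumes "dominated_on UNIV A f" "continuous_on UNIV g"
  shows "dominated_on UNIV A (\<lambda>n x. f n (g x))"
  unfolding dominated_on_def
proof (intro allI impI, elim conjE)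
  fix K :: "'b set" assume "compact K"
  hence "compact (g ` K)" using assms(2) by (intro compact_continuous_image) (auto intro: continuous_on_subset)
  then obtain N M where "finite N" "M summable_on A" "\<forall>n\<in>A - N. \<forall>x\<in>g ` K. norm (f n x) \<le> M n"
    using assms(1) unfolding dominated_on_def by (metis subset_UNIV)
  thus "\<exists>N M. finite N \<and> M summable_on A \<and> (\<forall>n\<in>A - N. \<forall>x\<in>K. norm (f n (g x)) \<le> M n)" by blast
qed

lemma R_term_dominated_slices:
  assumes "m > 0" "Im \<tau> > 0"
  shows "dominated_on UNIV A (\<lambda>n v. R_term m \<tau> n v w)" "dominated_on UNIV A (\<lambda>n. R_term m \<tau> n v)"
proof -
  have "continuous_on UNIV (\<lambda>v. (v, w))" "continuous_on UNIV (\<lambda>w. (v, w))"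
    by (intro continuous_on_Pair continuous_on_const continuous_on_id)+
  thus "dominated_on UNIV A (\<lambda>n v. R_term m \<tau> n v w)" "dominated_on UNIV A (\<lambda>n. R_term m \<tau> n v)"
    using dominated_on_slice[OF R_term_dominated[OF assms], of "\<lambda>v. (v, w)" A]
    dominated_on_slice[OF R_term_dominated[OF assms], of "\<lambda>w. (v, w)" A] by simp_all
qed

lemma R_term_continuous: "continuous_on S (\<lambda>(v, w). R_term m \<tau> n v w)"
  unfolding R_term_def R_arg_def case_prod_unfold divide_inverse
  by (intro continuous_intros continuous_on_compose2[OF theta_term_continuous[of UNIV]]) auto

lemma R_term_holomorphic: "(\<lambda>v. R_term m \<tau> n v w) holomorphic_on S" "R_term m \<tau> n v holomorphic_on S"
  unfolding R_term_def R_arg_def theta_term_def divide_inverse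
  by (intro holomorphic_intros)+

lemma R_term_summable:
  assumes "m > 0" "Im \<tau> > 0"
  shows "(\<lambda>n. R_term m \<tau> n v w) summable_on A"
  using dominated_on_summable[OF R_term_dominated[OF assms, of UNIV A] R_term_continuous, of "(v, w)"] by simp

lemma sep_holo_R_pol:
  assumes m: "m > 0" "Im \<tau> > 0"
  shows "sep_holo (\<lambda>v w. R_pol m l v w \<tau>) UNIV UNIV"
  unfolding sep_holo_def R_pol_def
proof (intro conjI ballI open_UNIV)
  show "continuous_on (UNIV \<times> UNIV) (\<lambda>(v, w). \<Sum>\<^sub>\<infinity>n\<in>rclass m l. R_term m \<tau> n v w)"
    using dominated_on_continuous[OF R_term_dominated[OF m, of UNIV "rclass m l"] R_term_continuous open_UNIV]
    by (simp add: case_prod_unfold)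
  show "(\<lambda>v. \<Sum>\<^sub>\<infinity>n\<in>rclass m l. R_term m \<tau> n v w) holomorphic_on UNIV" for w
    by (rule dominated_on_holomorphic[OF R_term_dominated_slices(1)[OF m] R_term_holomorphic(1) open_UNIV])
  show "(\<lambda>w. \<Sum>\<^sub>\<infinity>n\<in>rclass m l. R_term m \<tau> n v w) holomorphic_on UNIV" for v
    by (rule dominated_on_holomorphic[OF R_term_dominated_slices(2)[OF m] R_term_holomorphic(2) open_UNIV])
qed

lemma R_pol_holomorphic:
  assumes "m > 0" "Im \<tau> > 0"
  shows "(\<lambda>v. R_pol m l v w \<tau>) holomorphic_on S" "(\<lambda>w. R_pol m l v w \<tau>) holomorphic_on S"
  using sep_holo_R_pol[OF assms, of l] unfolding sep_holo_def by (auto intro: holomorphic_on_subset)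

lemma R_pol_plus_1: "R_pol m l (v + 1) (w + 1) \<tau> = R_pol m l v w \<tau>"
proof -
  have "theta_term m (- \<tau>) n (- (v + 1)) = theta_term m (- \<tau>) n (- v)" for n
    unfolding theta_term_def by (rule exp_eq_int_shift[where k = "- n"]) (simp add: algebra_simps)
  thus ?thesis unfolding R_pol_def R_term_def R_arg_def by simp
qed

lemma R_pol_tau_plus_1:
  assumes "m > 0"
  shows "R_pol m l v w (\<tau> + 1) = exp (- pi * \<i> * of_int l ^ 2 / (2 * of_nat m)) * R_pol m l v w \<tau>"
proof -
  have "R_term m (\<tau> + 1) n v w = exp (- pi * \<i> * of_int l ^ 2 / (2 * of_nat m)) * R_term m \<tau> n v w"
    if "n \<in> rclass m l" for n
  proof -
    have "theta_term m (- (\<tau> + 1)) n (- v) = exp (- 1 * (pi * \<i> * of_int n ^ 2 / (2 * of_nat m))) * theta_term m (- \<tau>) n (- v)"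
      unfolding theta_term_def exp_add[symmetric] by (intro arg_cong[of _ _ exp]) (simp add: diff_divide_distrib algebra_simps)
    also have "exp (- 1 * (pi * \<i> * of_int n ^ 2 / (2 * of_nat m))) = exp (- 1 * (pi * \<i> * of_int l ^ 2 / (2 * of_nat m)))"
      by (rule exp_rclass_square[OF assms that]) auto
    finally show ?thesis unfolding R_term_def R_arg_def by simp
  qed
  hence "R_pol m l v w (\<tau> + 1) = (\<Sum>\<^sub>\<infinity>n\<in>rclass m l. exp (- pi * \<i> * of_int l ^ 2 / (2 * of_nat m)) * R_term m \<tau> n v w)"
    unfolding R_pol_def by (rule infsum_cong)
  thus ?thesis unfolding R_pol_def by (simp add: infsum_cmult_right')
qed

text \<open>The shift of v - w by 2 \<i> Im \<tau> turns the argument of E for n into that for n +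
  2m, and the exponential follows by completing the square. The sign differs between n and n + 2m
  only when n < 0 \<le> n + 2m; in the class of l, with l reduced, this is the single index n + 2m =
  l, which produces the extra term.\<close>

lemma R_pol_plus_tau:
  fixes v w \<tau> :: complex
  assumes m: "m > 0" "Im \<tau> > 0" and l: "0 \<le> l" "l < 2 * int m"
  shows "R_pol m l (v + \<tau>) (w + cnj \<tau>) \<tau> = exp (2 * pi * \<i> * of_nat m * (\<tau> + 2 * v)) *
     (R_pol m l v w \<tau> - 2 * exp (- pi * \<i> * of_int l ^ 2 * \<tau> / (2 * of_nat m) - 2 * pi * \<i> * of_int l * v))"
    (is "_ = ?C * (_ - 2 * ?a)")
proof -
  have 1: "R_term m \<tau> n (v + \<tau>) (w + cnj \<tau>) = ?C * (R_term m \<tau> (n + 2 * int m) v w - (if n + 2 * int m = l then 2 * ?a else 0))"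
    if n: "n \<in> rclass m l" for n
  proof -
    have d: "v + \<tau> - (w + cnj \<tau>) = (v - w) + 2 * \<i> * of_real (Im \<tau>)"
      using complex_diff_cnj[of \<tau>] by (simp add: algebra_simps)
    have aux: "\<i> * of_nat m * ((v - w) + 2 * \<i> * of_real (Im \<tau>)) / of_real (Im \<tau>) = \<i> * of_nat m * (v - w) / of_real (Im \<tau>) - 2 * of_nat m"
      using m by (simp add: field_simps)
    have arg: "R_arg m \<tau> n (v + \<tau>) (w + cnj \<tau>) = R_arg m \<tau> (n + 2 * int m) v w"
      unfolding R_arg_def d aux by (simp add: algebra_simps)
    have th: "theta_term m (- \<tau>) n (- (v + \<tau>)) = ?C * theta_term m (- \<tau>) (n + 2 * int m) (- v)"
      unfolding theta_term_def exp_add[symmetric] using m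
      by (intro arg_cong[of _ _ exp]) (simp add: field_simps power2_eq_square)
    have sg: "sgn (real_of_int n + 1/2) = sgn (real_of_int (n + 2 * int m) + 1/2) - (if n + 2 * int m = l then 2 else 0)"
    proof -
      have sgn_int: "sgn (real_of_int j + 1/2) = (if j \<ge> 0 then 1 else - 1)" for j
      proof (cases "j \<ge> 0")
        case False
        hence "real_of_int j \<le> -1" by linarith
        thus ?thesis using False by simp
      qed auto
      have "n + 2 * int m = l" if "n < 0" "n + 2 * int m \<ge> 0"
      proof -
        have "n + 2 * int m = (n + 2 * int m) mod (2 * int m)"
          by (rule mod_pos_pos_trivial[symmetric]) (use that in auto)
        also have "\<dots> = l mod (2 * int m)" using n by simp
        also have "\<dots> = l" by (rule mod_pos_pos_trivial) (use l in auto)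
        finally show ?thesis .
      qed
      moreover have "n + 2 * int m \<noteq> l" if "n \<ge> 0 \<or> n + 2 * int m < 0" using that l by linarith
      ultimately show ?thesis unfolding sgn_int by (cases "n \<ge> 0"; cases "n + 2 * int m \<ge> 0") simp_all
    qed
    have a: "theta_term m (- \<tau>) l (- v) = ?a"
      unfolding theta_term_def by (intro arg_cong[of _ _ exp]) simp
    show ?thesis
      unfolding R_term_def arg th sg using a by (auto simp: algebra_simps)
  qed
  have lin: "l \<in> rclass m l" by simp
  have "((\<lambda>n. R_term m \<tau> n v w) has_sum R_pol m l v w \<tau>) (rclass m l)"
    unfolding R_pol_def by (rule has_sum_infsum[OF R_term_summable[OF m]])
  moreover have "((\<lambda>n. if n = l then 2 * ?a else 0) has_sum (\<Sum>n\<in>{l}. if n = l then 2 * ?a else 0)) (rclass m l)"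
    by (rule has_sum_finite_neutralI[of "{l}"]) auto
  ultimately have "((\<lambda>n. R_term m \<tau> n v w - (if n = l then 2 * ?a else 0)) has_sum (R_pol m l v w \<tau> - 2 * ?a)) (rclass m l)"
    using has_sum_complex_diff by fastforce
  hence "((\<lambda>n. R_term m \<tau> (n + 2 * int m) v w - (if n + 2 * int m = l then 2 * ?a else 0)) has_sum (R_pol m l v w \<tau> - 2 * ?a)) (rclass m l)"
    unfolding has_sum_reindex_bij_betw[OF bij_betw_rclass_shift, of "\<lambda>n. R_term m \<tau> n v w - (if n = l then 2 * ?a else 0)"] .
  hence "((\<lambda>n. ?C * (R_term m \<tau> (n + 2 * int m) v w - (if n + 2 * int m = l then 2 * ?a else 0))) has_sum ?C * (R_pol m l v w \<tau> - 2 * ?a)) (rclass m l)"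
    by (rule has_sum_cmult_right)
  hence "((\<lambda>n. R_term m \<tau> n (v + \<tau>) (w + cnj \<tau>)) has_sum ?C * (R_pol m l v w \<tau> - 2 * ?a)) (rclass m l)"
    by (rule has_sum_cong[THEN iffD1, rotated]) (use 1 in auto)
  thus ?thesis unfolding R_pol_def[of m l "v + \<tau>"] by (rule infsumI)
qed

text \<open>The sign is constant in w and the derivative of E is a Gaussian. The part - pi y n^2 / m
  of its exponent turns \<tau> into cnj \<tau> in the exponential, and the part linear in n turns v
  into w. The sum is therefore a theta function at - cnj \<tau>, again a point of the upper
  half-plane.\<close>

lemma R_pol_deriv_snd:
  fixes v w \<tau> :: complex
  assumes m: "m > 0" "Im \<tau> > 0"
  shows "((\<lambda>w. R_pol m l v w \<tau>) has_field_derivative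
     (- 2 * \<i> * of_real (sqrt (real m / Im \<tau>)) * exp (pi * of_nat m * (v - w) ^ 2 / of_real (Im \<tau>)) * theta_ml m l (- w) (- cnj \<tau>))) (at w)"
    (is "(_ has_field_derivative ?c * _) _")
proof -
  define y where "y = Im \<tau>"
  have y: "y > 0" using m by (simp add: y_def)
  have D: "deriv (R_term m \<tau> n v) w = ?c * theta_term m (- cnj \<tau>) n (- w)" for n
  proof (rule DERIV_imp_deriv)
    define s where "s = complex_of_real (sqrt (y / real m))"
    have s2: "s ^ 2 = of_real y / of_nat m" unfolding s_def of_real_power[symmetric] using y m by simp
    have s1: "of_nat m / of_real y * s = complex_of_real (sqrt (real m / y))"
    proof -
      have "real m / y * sqrt (y / real m) = sqrt (real m / y)"
      proof -
        have "real m / y = (real m / y) ^ 2 * (y / real m)" using y m by (simp add: power2_eq_square field_simps)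
        hence "sqrt (real m / y) = sqrt ((real m / y) ^ 2) * sqrt (y / real m)" by (metis real_sqrt_mult)
        thus ?thesis using y by simp
      qed
      thus ?thesis unfolding s_def by (metis of_real_divide of_real_mult of_real_of_nat_eq)
    qed
    have \<tau>: "cnj \<tau> = \<tau> - 2 * \<i> * of_real y" using complex_diff_cnj[of \<tau>] unfolding y_def by (simp add: algebra_simps)
    have arg: "((\<lambda>w. R_arg m \<tau> n v w) has_field_derivative \<i> * (of_nat m / of_real y * s)) (at w)"
      unfolding R_arg_def y_def[symmetric] s_def[symmetric] using y by (auto intro!: derivative_eq_intros simp: field_simps)
    have "(R_term m \<tau> n v has_field_derivative (- (2 * exp (- pi * (R_arg m \<tau> n v w) ^ 2) * (\<i> * (of_nat m / of_real y * s)))) * theta_term m (- \<tau>) n (- v)) (at w)"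
      unfolding R_term_def[abs_def]
      by (auto intro!: derivative_eq_intros DERIV_chain2[OF E_entire_deriv arg])
    also have "exp (- pi * (R_arg m \<tau> n v w) ^ 2) = exp (pi * of_nat m * (v - w) ^ 2 / of_real y) * exp (- pi * (of_int n ^ 2 * of_real y / of_nat m - 2 * \<i> * of_int n * (v - w)))"
    proof -
      have "(R_arg m \<tau> n v w) ^ 2 = (of_int n - \<i> * of_nat m * (v - w) / of_real y) ^ 2 * (of_real y / of_nat m)"
        unfolding R_arg_def power_mult_distrib y_def[symmetric] s_def[symmetric] s2 ..
      also have "\<dots> = of_int n ^ 2 * of_real y / of_nat m - 2 * \<i> * of_int n * (v - w) - of_nat m * (v - w) ^ 2 / of_real y"
        using y m by (simp add: power2_eq_square field_simps)
      finally have R2: "(R_arg m \<tau> n v w) ^ 2 = \<dots>" .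
      show ?thesis unfolding R2 exp_add[symmetric] by (intro arg_cong[of _ _ exp]) (simp add: algebra_simps)
    qed
    also have "(- (2 * (exp (pi * of_nat m * (v - w) ^ 2 / of_real y) * exp (- pi * (of_int n ^ 2 * of_real y / of_nat m - 2 * \<i> * of_int n * (v - w))))
          * (\<i> * (of_nat m / of_real y * s)))) * theta_term m (- \<tau>) n (- v) =
       - 2 * \<i> * (of_nat m / of_real y * s) * exp (pi * of_nat m * (v - w) ^ 2 / of_real y) *
         (exp (- pi * (of_int n ^ 2 * of_real y / of_nat m - 2 * \<i> * of_int n * (v - w))) * theta_term m (- \<tau>) n (- v))"
      by (simp add: algebra_simps)
    also have "exp (- pi * (of_int n ^ 2 * of_real y / of_nat m - 2 * \<i> * of_int n * (v - w))) * theta_term m (- \<tau>) n (- v) = theta_term m (- cnj \<tau>) n (- w)"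
      unfolding theta_term_def exp_add[symmetric] \<tau> using m y by (intro arg_cong[of _ _ exp]) (simp add: field_simps)
    finally show "(R_term m \<tau> n v has_field_derivative ?c * theta_term m (- cnj \<tau>) n (- w)) (at w)"
      unfolding s1 unfolding y_def .
  qed
  obtain D where D1: "((\<lambda>w. R_pol m l v w \<tau>) has_field_derivative D) (at w)" and D2: "((\<lambda>n. deriv (R_term m \<tau> n v) w) has_sum D) (rclass m l)"
    using dominated_on_has_sum_deriv[OF R_term_dominated_slices(2)[OF m, of "rclass m l" v] R_term_holomorphic(2) open_UNIV UNIV_I, of w]
    unfolding R_pol_def by auto
  have "((\<lambda>n. ?c * theta_term m (- cnj \<tau>) n (- w)) has_sum ?c * theta_ml m l (- w) (- cnj \<tau>)) (rclass m l)"
    unfolding theta_ml_eq by (intro has_sum_cmult_right has_sum_infsum theta_term_summable) (use m in auto)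
  hence "D = ?c * theta_ml m l (- w) (- cnj \<tau>)" using D2 unfolding D by (rule has_sum_unique[rotated])
  thus ?thesis using D1 by simp
qed

subsection \<open>The residue theorem on a period parallelogram\<close>

lemma coord_diff:
  "tau_coord \<tau> (a - b) = tau_coord \<tau> a - tau_coord \<tau> b" "one_coord \<tau> (a - b) = one_coord \<tau> a - one_coord \<tau> b"
  by (auto simp: tau_coord_def one_coord_def diff_divide_distrib algebra_simps)

lemma coord_param:
  assumes "Im \<tau> > 0"
  shows "w = p + of_real s * \<tau> + of_real t \<longleftrightarrow> s = tau_coord \<tau> (w - p) \<and> t = one_coord \<tau> (w - p)"
proof
  assume "w = p + of_real s * \<tau> + of_real t"
  thus "s = tau_coord \<tau> (w - p) \<and> t = one_coord \<tau> (w - p)"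
    by (simp only: coord_diff coord_add_scaled[OF assms]) simp
next
  assume "s = tau_coord \<tau> (w - p) \<and> t = one_coord \<tau> (w - p)"
  thus "w = p + of_real s * \<tau> + of_real t" using coord_eq[OF assms, of "w - p"] by (simp add: algebra_simps)
qed

lemma par_open_iff:
  assumes "Im \<tau> > 0"
  shows "w \<in> par_open p \<tau> \<longleftrightarrow> 0 < tau_coord \<tau> (w - p) \<and> tau_coord \<tau> (w - p) < 1 \<and> 0 < one_coord \<tau> (w - p) \<and> one_coord \<tau> (w - p) < 1"
  unfolding par_open_def using coord_param[OF assms] by auto

lemma par_boundary_iff:
  assumes "Im \<tau> > 0"
  shows "w \<in> par_boundary p \<tau> \<longleftrightarrow> 0 \<le> tau_coord \<tau> (w - p) \<and> tau_coord \<tau> (w - p) \<le> 1 \<and> 0 \<le> one_coord \<tau> (w - p) \<and> one_coord \<tau> (w - p) \<le> 1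
     \<and> (tau_coord \<tau> (w - p) = 0 \<or> tau_coord \<tau> (w - p) = 1 \<or> one_coord \<tau> (w - p) = 0 \<or> one_coord \<tau> (w - p) = 1)"
  unfolding par_boundary_def using coord_param[OF assms] by auto

definition par_closed :: "complex \<Rightarrow> complex \<Rightarrow> complex set" where
  "par_closed p \<tau> = {w. tau_coord \<tau> (w - p) \<in> {0..1} \<and> one_coord \<tau> (w - p) \<in> {0..1}}"

lemma par_closed_eq: "Im \<tau> > 0 \<Longrightarrow> par_closed p \<tau> = par_open p \<tau> \<union> par_boundary p \<tau>"
  by (auto simp: par_closed_def par_open_iff par_boundary_iff)

lemma par_open_boundary_disjoint: "Im \<tau> > 0 \<Longrightarrow> par_open p \<tau> \<inter> par_boundary p \<tau> = {}"
  by (auto simp: par_open_iff par_boundary_iff)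

lemma bounded_par_closed:
  assumes "Im \<tau> > 0"
  shows "bounded (par_closed p \<tau>)"
proof -
  have "norm (w - p) \<le> norm \<tau> + 1" if "w \<in> par_closed p \<tau>" for w
  proof -
    let ?s = "tau_coord \<tau> (w - p)" and ?t = "one_coord \<tau> (w - p)"
    have st: "0 \<le> ?s" "?s \<le> 1" "0 \<le> ?t" "?t \<le> 1" using that by (auto simp: par_closed_def)
    have "norm (w - p) = norm (of_real ?s * \<tau> + of_real ?t)" using coord_eq[OF assms] by simp
    also have "\<dots> \<le> \<bar>?s\<bar> * norm \<tau> + \<bar>?t\<bar>" by (rule norm_triangle_le) (simp add: norm_mult)
    also have "\<dots> \<le> 1 * norm \<tau> + 1" using st by (intro add_mono mult_right_mono) auto
    finally show ?thesis by simp
  qed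
  thus ?thesis by (intro bounded_subset[OF bounded_cball[of p "norm \<tau> + 1"]]) (auto simp: dist_norm norm_minus_commute)
qed

lemma coord_affine:
  assumes "u + v = 1"
  shows "tau_coord \<tau> (u *\<^sub>R x + v *\<^sub>R y - p) = u * tau_coord \<tau> (x - p) + v * tau_coord \<tau> (y - p)"
    and "one_coord \<tau> (u *\<^sub>R x + v *\<^sub>R y - p) = u * one_coord \<tau> (x - p) + v * one_coord \<tau> (y - p)"
proof -
  have v: "v = 1 - u" using assms by simp
  show "tau_coord \<tau> (u *\<^sub>R x + v *\<^sub>R y - p) = u * tau_coord \<tau> (x - p) + v * tau_coord \<tau> (y - p)"
    "one_coord \<tau> (u *\<^sub>R x + v *\<^sub>R y - p) = u * one_coord \<tau> (x - p) + v * one_coord \<tau> (y - p)"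
    unfolding v one_coord_def tau_coord_def divide_inverse by (auto simp: algebra_simps)
qed

lemma convex_par_closed: "convex (par_closed p \<tau>)"
proof (rule convexI)
  fix x y and u v :: real assume *: "x \<in> par_closed p \<tau>" "y \<in> par_closed p \<tau>" "0 \<le> u" "0 \<le> v" "u + v = 1"
  have "u * a + v * b \<in> {0..1}" if "a \<in> {0..1}" "b \<in> {0..1}" for a b :: real
    using that * convex_bound_le[of a 1 b u v] by auto
  thus "u *\<^sub>R x + v *\<^sub>R y \<in> par_closed p \<tau>"
    using * unfolding par_closed_def mem_Collect_eq coord_affine[OF *(5)] by blast
qed

section \<open>The boundary contour, its winding numbers and integrals along it\<close>

definition par_path :: "complex \<Rightarrow> complex \<Rightarrow> real \<Rightarrow> complex" where
  "par_path p \<tau> = linepath p (p + 1) +++ linepath (p + 1) (p + 1 + \<tau>) +++ linepath (p + 1 + \<tau>) (p + \<tau>) +++ linepath (p + \<tau>) p"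

lemma valid_path_par_path [simp]: "valid_path (par_path p \<tau>)"
  and pathfinish_par_path [simp]: "pathfinish (par_path p \<tau>) = p"
  and pathstart_par_path [simp]: "pathstart (par_path p \<tau>) = p"
  by (auto simp: par_path_def)

lemma closed_segment_par_boundary:
  assumes \<tau>: "Im \<tau> > 0"
  shows "closed_segment p (p + 1) \<subseteq> par_boundary p \<tau>" "closed_segment (p + 1) (p + 1 + \<tau>) \<subseteq> par_boundary p \<tau>"
    "closed_segment (p + 1 + \<tau>) (p + \<tau>) \<subseteq> par_boundary p \<tau>" "closed_segment (p + \<tau>) p \<subseteq> par_boundary p \<tau>"
proof -
  have c: "tau_coord \<tau> (p - p) = 0" "one_coord \<tau> (p - p) = 0" "tau_coord \<tau> (p + 1 - p) = 0" "one_coord \<tau> (p + 1 - p) = 1"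
    "tau_coord \<tau> (p + \<tau> - p) = 1" "one_coord \<tau> (p + \<tau> - p) = 0" "tau_coord \<tau> (p + 1 + \<tau> - p) = 1" "one_coord \<tau> (p + 1 + \<tau> - p) = 1"
    using \<tau> by (auto simp: tau_coord_def one_coord_def)
  have *: "closed_segment a b \<subseteq> par_boundary p \<tau>"
    if "\<And>u. 0 \<le> u \<Longrightarrow> u \<le> 1 \<Longrightarrow> (1 - u) *\<^sub>R a + u *\<^sub>R b \<in> par_boundary p \<tau>" for a b
    using that by (auto simp: in_segment)
  have 1: "1 - u + u = 1" for u :: real by simp
  show "closed_segment p (p + 1) \<subseteq> par_boundary p \<tau>" "closed_segment (p + 1) (p + 1 + \<tau>) \<subseteq> par_boundary p \<tau>"
    "closed_segment (p + 1 + \<tau>) (p + \<tau>) \<subseteq> par_boundary p \<tau>" "closed_segment (p + \<tau>) p \<subseteq> par_boundary p \<tau>"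
    by (rule *, simp only: par_boundary_iff[OF \<tau>] coord_affine[OF 1] c, simp)+
qed

lemma path_image_par_path: "Im \<tau> > 0 \<Longrightarrow> path_image (par_path p \<tau>) \<subseteq> par_boundary p \<tau>"
  using closed_segment_par_boundary by (simp add: par_path_def path_image_join)

text \<open>The point lies to the left of each edge, so each edge contributes a real part strictly
  between 0 and 1/2. The total is an integer strictly between 0 and 2.\<close>

lemma winding_number_par_path_inside:
  assumes \<tau>: "Im \<tau> > 0" and z: "z \<in> par_open p \<tau>"
  shows "winding_number (par_path p \<tau>) z = 1"
proof -
  let ?a = "p" and ?b = "p + 1" and ?c = "p + 1 + \<tau>" and ?d = "p + \<tau>"
  have nb: "z \<notin> par_boundary p \<tau>" using z par_open_boundary_disjoint[OF \<tau>] by blast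
  hence out: "z \<notin> closed_segment ?a ?b" "z \<notin> closed_segment ?b ?c" "z \<notin> closed_segment ?c ?d" "z \<notin> closed_segment ?d ?a"
    using closed_segment_par_boundary[OF \<tau>] by blast+
  define s t where "s = tau_coord \<tau> (z - p)" and "t = one_coord \<tau> (z - p)"
  have st: "0 < s" "s < 1" "0 < t" "t < 1" using z par_open_iff[OF \<tau>] by (auto simp: s_def t_def)
  have zeq: "z = p + of_real s * \<tau> + of_real t" using coord_param[OF \<tau>] by (simp add: s_def t_def)
  have pos: "0 < Re (winding_number (linepath ?a ?b) z)" "0 < Re (winding_number (linepath ?b ?c) z)"
     "0 < Re (winding_number (linepath ?c ?d) z)" "0 < Re (winding_number (linepath ?d ?a) z)"
  proof -
    \<comment> \<open>These are twice the signed areas of the triangles spanned by z and the edges;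
      positivity says that z is on the left.\<close>
    have "Im ((?b - ?a) * cnj (?b - z)) = s * Im \<tau>" "Im ((?c - ?b) * cnj (?c - z)) = (1 - t) * Im \<tau>"
      "Im ((?d - ?c) * cnj (?d - z)) = (1 - s) * Im \<tau>" "Im ((?a - ?d) * cnj (?a - z)) = t * Im \<tau>"
      unfolding zeq by (auto simp: algebra_simps)
    thus "0 < Re (winding_number (linepath ?a ?b) z)" "0 < Re (winding_number (linepath ?b ?c) z)"
     "0 < Re (winding_number (linepath ?c ?d) z)" "0 < Re (winding_number (linepath ?d ?a) z)"
      using st \<tau> by (auto intro!: winding_number_linepath_pos_lt)
  qed
  note lt = winding_number_lt_half_linepath[OF out(1)] winding_number_lt_half_linepath[OF out(2)]
    winding_number_lt_half_linepath[OF out(3)] winding_number_lt_half_linepath[OF out(4)]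
  have "winding_number (par_path p \<tau>) z = winding_number (linepath ?a ?b) z + (winding_number (linepath ?b ?c) z
     + (winding_number (linepath ?c ?d) z + winding_number (linepath ?d ?a) z))"
    unfolding par_path_def using out by (simp add: winding_number_join path_image_join not_in_path_image_join)
  hence R: "0 < Re (winding_number (par_path p \<tau>) z)" "Re (winding_number (par_path p \<tau>) z) < 2"
    using pos lt by auto
  have "winding_number (par_path p \<tau>) z \<in> \<int>"
    using nb path_image_par_path[OF \<tau>] by (intro integer_winding_number) (auto simp: valid_path_imp_path)
  then obtain k where k: "winding_number (par_path p \<tau>) z = of_int k" by (auto elim: Ints_cases)
  with R have "k = 1" by simp
  thus ?thesis using k by simp
qed

lemma winding_number_par_path_outside:
  assumes \<tau>: "Im \<tau> > 0" and z: "z \<notin> par_closed p \<tau>"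
  shows "winding_number (par_path p \<tau>) z = 0"
  by (rule winding_number_zero_outside[OF _ convex_par_closed _ z])
     (use path_image_par_path[OF \<tau>] par_closed_eq[OF \<tau>] in \<open>auto simp: valid_path_imp_path\<close>)

lemma residue_theorem_par_path:
  assumes \<tau>: "Im \<tau> > 0" and Q: "Q sparse_in UNIV" and hol: "f holomorphic_on - Q" and bd: "Q \<inter> par_boundary p \<tau> = {}"
  shows "contour_integral (par_path p \<tau>) f = 2 * pi * \<i> * (\<Sum>u\<in>Q \<inter> par_open p \<tau>. residue f u)"
    and "finite (Q \<inter> par_open p \<tau>)"
proof -
  obtain R where R: "par_closed p \<tau> \<subseteq> ball p R"
    using bounded_par_closed[OF \<tau>] bounded_subset_ballD by blast
  have fin: "finite (Q \<inter> cball p R)"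
    using sparse_in_compact_finite[OF sparse_in_subset[OF Q], of "cball p R"] by (simp add: Int_commute)
  have sub: "par_open p \<tau> \<subseteq> cball p R" using R par_closed_eq[OF \<tau>] by force
  show "finite (Q \<inter> par_open p \<tau>)" by (rule finite_subset[OF _ fin]) (use sub in auto)
  have "contour_integral (par_path p \<tau>) f = 2 * pi * \<i> * (\<Sum>u\<in>Q \<inter> cball p R. winding_number (par_path p \<tau>) u * residue f u)"
  proof (rule Residue_theorem[of "ball p R"])
    show "f holomorphic_on ball p R - Q \<inter> cball p R" by (rule holomorphic_on_subset[OF hol]) auto
    show "path_image (par_path p \<tau>) \<subseteq> ball p R - Q \<inter> cball p R"
      using path_image_par_path[OF \<tau>, of p] bd R par_closed_eq[OF \<tau>] by blast
    show "\<forall>z. z \<notin> ball p R \<longrightarrow> winding_number (par_path p \<tau>) z = 0"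
      using winding_number_par_path_outside[OF \<tau>] R by blast
  qed (use fin in auto)
  also have "(\<Sum>u\<in>Q \<inter> cball p R. winding_number (par_path p \<tau>) u * residue f u) = (\<Sum>u\<in>Q \<inter> par_open p \<tau>. residue f u)"
  proof (rule sum.mono_neutral_cong_right[OF fin])
    show "Q \<inter> par_open p \<tau> \<subseteq> Q \<inter> cball p R" using sub by blast
    show "\<forall>u\<in>Q \<inter> cball p R - Q \<inter> par_open p \<tau>. winding_number (par_path p \<tau>) u * residue f u = 0"
    proof
      fix u assume "u \<in> Q \<inter> cball p R - Q \<inter> par_open p \<tau>"
      hence "u \<notin> par_closed p \<tau>" using par_closed_eq[OF \<tau>, of p] bd by blast
      thus "winding_number (par_path p \<tau>) u * residue f u = 0" by (simp add: winding_number_par_path_outside[OF \<tau>])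
    qed
  qed (use winding_number_par_path_inside[OF \<tau>] in auto)
  finally show "contour_integral (par_path p \<tau>) f = 2 * pi * \<i> * (\<Sum>u\<in>Q \<inter> par_open p \<tau>. residue f u)" .
qed

lemma contour_integral_linepath_shift:
  "contour_integral (linepath (a + c) (b + c)) f = contour_integral (linepath a b) (\<lambda>z. f (z + c))"
proof -
  have "linepath (a + c) (b + c) x = linepath a b x + c" for x
    by (simp add: linepath_def algebra_simps)
  thus ?thesis unfolding contour_integral_integral by simp
qed

text \<open>The two edges in direction \<tau> cancel by periodicity under 1, and the other two
  combine after a shift by \<tau>. Periodicity is asked for on the contour only, because the
  integrands satisfy their laws only off the poles.\<close>

lemma contour_integral_par_path:
  assumes \<tau>: "Im \<tau> > 0" and cont: "continuous_on (par_boundary p \<tau>) f"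
    and per: "\<And>v. v \<in> par_boundary p \<tau> \<Longrightarrow> v + 1 \<in> par_boundary p \<tau> \<Longrightarrow> f (v + 1) = f v"
  shows "contour_integral (par_path p \<tau>) f = contour_integral (linepath p (p + 1)) (\<lambda>v. f v - f (v + \<tau>))"
proof -
  let ?a = "p" and ?b = "p + 1" and ?c = "p + 1 + \<tau>" and ?d = "p + \<tau>"
  note seg = closed_segment_par_boundary[OF \<tau>, of p]
  have int: "f contour_integrable_on linepath ?a ?b" "f contour_integrable_on linepath ?b ?c"
     "f contour_integrable_on linepath ?c ?d" "f contour_integrable_on linepath ?d ?a" "f contour_integrable_on linepath ?d ?c"
    using contour_integrable_continuous_linepath[OF continuous_on_subset[OF cont]] seg closed_segment_commute by metis+
  have "contour_integral (par_path p \<tau>) f = contour_integral (linepath ?a ?b) f + (contour_integral (linepath ?b ?c) f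
     + (contour_integral (linepath ?c ?d) f + contour_integral (linepath ?d ?a) f))"
    unfolding par_path_def using int by (simp add: contour_integrable_join)
  also have "contour_integral (linepath ?b ?c) f = contour_integral (linepath (?a + 1) (?d + 1)) f"
    by (simp add: algebra_simps)
  also have "\<dots> = contour_integral (linepath ?a ?d) (\<lambda>v. f (v + 1))"
    by (rule contour_integral_linepath_shift)
  also have "\<dots> = contour_integral (linepath ?a ?d) f"
  proof (rule contour_integral_eq)
    fix v assume "v \<in> path_image (linepath ?a ?d)"
    then obtain x where x: "0 \<le> x" "x \<le> 1" "v = (1 - x) *\<^sub>R ?a + x *\<^sub>R ?d" by (auto simp: in_segment)
    have "v \<in> closed_segment ?d ?a" using x by (auto simp: in_segment intro!: exI[of _ "1 - x"])
    moreover have "v + 1 \<in> closed_segment ?b ?c" using x by (auto simp: in_segment algebra_simps scaleR_conv_of_real intro!: exI[of _ x])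
    ultimately show "f (v + 1) = f v" using per seg by blast
  qed
  also have "\<dots> = - contour_integral (linepath ?d ?a) f"
    by (rule contour_integral_reverse_linepath) (use seg(4) cont closed_segment_commute[of ?a ?d] continuous_on_subset in metis)
  also have "contour_integral (linepath ?c ?d) f = - contour_integral (linepath ?d ?c) f"
    by (rule contour_integral_reverse_linepath) (use seg(3) cont continuous_on_subset in metis)
  also have "contour_integral (linepath ?d ?c) f = contour_integral (linepath ?a ?b) (\<lambda>v. f (v + \<tau>))"
    using contour_integral_linepath_shift[of ?a \<tau> ?b f] by (simp add: algebra_simps)
  also have "contour_integral (linepath ?a ?b) f + (- contour_integral (linepath ?d ?a) f + (- contour_integral (linepath ?a ?b) (\<lambda>v. f (v + \<tau>)) + contour_integral (linepath ?d ?a) f))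
     = contour_integral (linepath ?a ?b) f - contour_integral (linepath ?a ?b) (\<lambda>v. f (v + \<tau>))" by simp
  also have "\<dots> = contour_integral (linepath ?a ?b) (\<lambda>v. f v - f (v + \<tau>))"
  proof (rule contour_integral_diff[symmetric, OF int(1)])
    have "continuous_on (closed_segment ?a ?b) (\<lambda>v. f (v + \<tau>))"
    proof (rule continuous_on_compose2[OF cont])
      show "(\<lambda>v. v + \<tau>) ` closed_segment ?a ?b \<subseteq> par_boundary p \<tau>"
      proof safe
        fix v assume "v \<in> closed_segment ?a ?b"
        then obtain x where x: "0 \<le> x" "x \<le> 1" "v = (1 - x) *\<^sub>R ?a + x *\<^sub>R ?b" by (auto simp: in_segment)
        have "v + \<tau> = (1 - (1 - x)) *\<^sub>R ?c + (1 - x) *\<^sub>R ?d" unfolding x(3) by (simp add: algebra_simps scaleR_conv_of_real)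
        hence "v + \<tau> \<in> closed_segment ?c ?d" using x unfolding in_segment by (intro exI[of _ "1 - x"]) auto
        thus "v + \<tau> \<in> par_boundary p \<tau>" using seg(3) by blast
      qed
    qed (auto intro!: continuous_intros)
    thus "(\<lambda>v. f (v + \<tau>)) contour_integrable_on linepath ?a ?b" by (rule contour_integrable_continuous_linepath)
  qed
  finally show ?thesis .
qed

text \<open>Write g as h(v) / (v - a)^(n + 1) with h holomorphic near a = c u + d. The residue is
  the n-th Taylor coefficient of h, which the substitution multiplies by c^n, while the denominator
  contributes c^(- n - 1).\<close>

lemma residue_affine:
  fixes g :: "complex \<Rightarrow> complex"
  assumes iso: "isolated_singularity_at g (c * u + d)" and ne: "not_essential g (c * u + d)" and c: "c \<noteq> 0"
  shows "residue (\<lambda>v. g (c * v + d)) u = residue g (c * u + d) / c"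
proof -
  define a where "a = c * u + d"
  obtain n h r where r: "r > 0" "h holomorphic_on ball a r" and g: "\<And>v. v \<in> ball a r - {a} \<Longrightarrow> g v = h v / (v - a) ^ Suc n"
  proof (cases "\<exists>\<^sub>F w in at a. g w \<noteq> 0")
    case True
    obtain P k r where r: "r > 0" "P holomorphic_on cball a r" "\<And>w. w \<in> cball a r - {a} \<Longrightarrow> g w = P w * (w - a) powi k"
      using zorder_exist[OF iso[folded a_def] ne[folded a_def] True] by metis
    \<comment> \<open>\<open>Suc n\<close> exceeds the order of a possible pole, so zeros, regular
      points and poles are covered by one form; j is the surplus power.\<close>
    define n where "n = nat (- k)"
    define j where "j = nat (k + int (Suc n))"
    have j: "k = int j - int (Suc n)" unfolding j_def n_def by auto
    show ?thesis
    proof (rule that[of r "\<lambda>w. P w * (w - a) ^ j" n])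
      show "(\<lambda>w. P w * (w - a) ^ j) holomorphic_on ball a r"
        by (intro holomorphic_intros holomorphic_on_subset[OF r(2)]) auto
      show "g v = P v * (v - a) ^ j / (v - a) ^ Suc n" if "v \<in> ball a r - {a}" for v
      proof -
        have "(v - a) powi k = (v - a) ^ j / (v - a) ^ Suc n"
          unfolding j using that by (subst power_int_diff) (auto simp del: of_nat_Suc power_Suc)
        thus ?thesis using r(3)[of v] that by auto
      qed
    qed (use r in auto)
  next
    \<comment> \<open>Here g vanishes near a, so it has no finite order; h = 0 represents
      it.\<close>
    case False
    hence "\<forall>\<^sub>F w in at a. g w = 0" by (simp add: frequently_def)
    then obtain r where "r > 0" "\<And>w. w \<in> ball a r - {a} \<Longrightarrow> g w = 0"
      unfolding eventually_at_filter eventually_nhds_metric by (auto simp: dist_commute)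
    thus ?thesis by (intro that[of r "\<lambda>_. 0" 0]) auto
  qed
  have ev: "\<forall>\<^sub>F v in at a. v \<in> ball a r - {a}"
    using r eventually_at_ball'[of r a UNIV] by (auto elim: eventually_mono)
  have "residue g a = residue (\<lambda>v. h v / (v - a) ^ Suc n) a"
    by (rule residue_cong[OF eventually_mono[OF ev]]) (use g in auto)
  also have "\<dots> = (deriv ^^ n) h a / fact n"
    by (rule residue_holomorphic_over_power[OF open_ball]) (use r in auto)
  finally have 1: "residue g a = (deriv ^^ n) h a / fact n" .
  define S where "S = (\<lambda>v. c * v + d) -` ball a r"
  have S: "open S" "u \<in> S" using r unfolding S_def a_def by (auto intro!: open_vimage continuous_intros)
  have "\<forall>\<^sub>F v in at u. v \<in> S - {u}"
    using eventually_at_in_open[OF S] .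
  hence "residue (\<lambda>v. g (c * v + d)) u = residue (\<lambda>v. (h (c * v + d) / c ^ Suc n) / (v - u) ^ Suc n) u"
  proof (intro residue_cong refl, elim eventually_mono)
    fix v assume v: "v \<in> S - {u}"
    hence "c * v + d \<in> ball a r - {a}" using c by (auto simp: S_def a_def)
    hence "g (c * v + d) = h (c * v + d) / (c * v + d - a) ^ Suc n" by (rule g)
    also have "c * v + d - a = c * (v - u)" by (simp add: a_def algebra_simps)
    finally show "g (c * v + d) = (h (c * v + d) / c ^ Suc n) / (v - u) ^ Suc n" by (simp add: power_mult_distrib)
  qed
  also have hol: "(\<lambda>v. h (c * v + d)) holomorphic_on S"
    by (rule holomorphic_on_compose_gen[OF _ r(2), unfolded o_def]) (auto simp: S_def intro!: holomorphic_intros)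
  have "residue (\<lambda>v. (h (c * v + d) / c ^ Suc n) / (v - u) ^ Suc n) u = (deriv ^^ n) (\<lambda>v. h (c * v + d) / c ^ Suc n) u / fact n"
    by (rule residue_holomorphic_over_power[OF S]) (intro holomorphic_intros hol, use c in auto)
  also have "(deriv ^^ n) (\<lambda>v. h (c * v + d) / c ^ Suc n) u = (deriv ^^ n) (\<lambda>v. inverse (c ^ Suc n) * h (c * v + d)) u"
    by (simp add: divide_inverse mult.commute)
  also have "\<dots> = inverse (c ^ Suc n) * (deriv ^^ n) (\<lambda>v. h (c * v + d)) u"
    by (rule higher_deriv_cmult[OF hol S(2) S(1)])
  also have "(deriv ^^ n) (\<lambda>v. h (c * v + d)) u = c ^ n * (deriv ^^ n) h a"
    unfolding a_def by (rule higher_deriv_compose_linear'[OF r(2) S(1) open_ball S(2)]) (auto simp: S_def)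
  finally have "residue (\<lambda>v. g (c * v + d)) u = (inverse (c ^ Suc n) * c ^ n) * (deriv ^^ n) h a / fact n" by simp
  also have "inverse (c ^ Suc n) * c ^ n = inverse c" using c by (simp add: field_simps)
  finally show ?thesis using 1 unfolding a_def by (simp add: divide_inverse mult_ac)
qed

lemma coset_sparse:
  assumes \<tau>: "Im \<tau> > 0"
  shows "coset z \<tau> sparse_in UNIV"
  unfolding sparse_in_eventually_iff[OF open_UNIV]
proof
  fix x :: complex
  \<comment> \<open>Two distinct points of a coset differ in height by at least Im \<tau>, or have
    the same height and a distance of at least 1.\<close>
  define \<delta> where "\<delta> = min 1 (Im \<tau>)"
  have \<delta>: "\<delta> > 0" using \<tau> by (simp add: \<delta>_def)
  have sep: "norm (u - u') \<ge> \<delta>" if "u \<in> coset z \<tau>" "u' \<in> coset z \<tau>" "u \<noteq> u'" for u u'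
  proof -
    obtain a b a' b' :: int where "u = z + of_int a * \<tau> + of_int b" "u' = z + of_int a' * \<tau> + of_int b'"
      using \<open>u \<in> coset z \<tau>\<close> \<open>u' \<in> coset z \<tau>\<close> unfolding coset_iff by blast
    hence d: "u - u' = of_int (a - a') * \<tau> + of_int (b - b')" by (simp add: algebra_simps)
    show ?thesis
    proof (cases "a = a'")
      case True
      hence "b \<noteq> b'" using d that by auto
      hence "1 \<le> \<bar>b - b'\<bar>" by auto
      hence "1 \<le> \<bar>real_of_int (b - b')\<bar>" by linarith
      also have "\<dots> = norm (u - u')" unfolding d True by (simp only: diff_self of_int_0 mult_zero_left add_0_left norm_of_int)
      finally show ?thesis by (simp add: \<delta>_def)
    next
      case False
      hence "1 \<le> \<bar>a - a'\<bar>" by auto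
      hence "1 * Im \<tau> \<le> \<bar>real_of_int (a - a')\<bar> * Im \<tau>" using \<tau> by (intro mult_right_mono) linarith+
      also have "\<dots> = \<bar>Im (u - u')\<bar>" using \<tau> by (simp add: d abs_mult)
      also have "\<dots> \<le> norm (u - u')" by (rule abs_Im_le_cmod)
      finally show ?thesis by (simp add: \<delta>_def)
    qed
  qed
  have "\<exists>\<epsilon>>0. \<forall>y\<in>ball x \<epsilon>. y \<in> coset z \<tau> \<longrightarrow> y = x"
  proof (cases "\<exists>u\<in>coset z \<tau>. u \<noteq> x \<and> dist u x < \<delta> / 2")
    case False
    thus ?thesis using \<delta> by (intro exI[of _ "\<delta> / 2"]) (auto simp: dist_commute)
  next
    case True
    then obtain u where u: "u \<in> coset z \<tau>" "u \<noteq> x" "dist u x < \<delta> / 2" by blast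
    have "y = x" if "y \<in> ball x (dist u x)" "y \<in> coset z \<tau>" for y
    proof (rule ccontr)
      assume "y \<noteq> x"
      have "y \<noteq> u" using that by (auto simp: dist_commute)
      hence "\<delta> \<le> dist u y" using sep[OF u(1) that(2)] by (simp add: dist_norm)
      also have "\<dots> \<le> dist u x + dist x y" by (rule dist_triangle)
      finally show False using u(3) that(1) by (simp add: dist_commute)
    qed
    thus ?thesis using u by (intro exI[of _ "dist u x"]) auto
  qed
  thus "\<forall>\<^sub>F v in at x. v \<notin> coset z \<tau>"
    unfolding eventually_at_filter eventually_nhds_metric by (auto simp: dist_commute)
qed

lemma sparse_imp_eventually_not_in:
  assumes "Q sparse_in UNIV"
  shows "\<forall>\<^sub>F v in at u. v \<notin> Q"
  using assms sparse_in_eventually_iff[OF open_UNIV] by auto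

subsection \<open>Meromorphic functions satisfying the elliptic law\<close>

definition F_pol :: "nat \<Rightarrow> complex \<Rightarrow> complex \<Rightarrow> complex \<Rightarrow> complex \<Rightarrow> complex" where
  "F_pol m v w z \<tau> = f_u m v z \<tau> - 1/2 * (\<Sum>l\<in>{0..<2 * int m}. R_pol m l v w \<tau> * theta_ml m l z \<tau>)"

lemma f_tilde_eq_F_pol: "f_tilde m v z \<tau> = F_pol m v (cnj v) z \<tau>"
  unfolding f_tilde_def F_pol_def R_ml_eq_R_pol ..

lemma F_pol_plus_1: "F_pol m (v + 1) (w + 1) z \<tau> = F_pol m v w z \<tau>"
  unfolding F_pol_def f_u_plus_1 R_pol_plus_1 ..

text \<open>The theta sums in \<open>f_u_plus_tau\<close> and \<open>R_pol_plus_tau\<close> cancel;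
  the factor 1/2 and the sign term of R are made for this. The law holds off w = cnj v too, provided
  that w moves by cnj \<tau>.\<close>

lemma F_pol_plus_tau:
  fixes v w z \<tau> :: complex
  assumes m: "m > 0" "Im \<tau> > 0" and v: "v \<notin> coset z \<tau>"
  shows "F_pol m (v + \<tau>) (w + cnj \<tau>) z \<tau> = exp (2 * pi * \<i> * of_nat m * (\<tau> + 2 * v)) * F_pol m v w z \<tau>"
proof -
  define C where "C = exp (2 * pi * \<i> * of_nat m * (\<tau> + 2 * v))"
  define a where "a l = exp (- pi * \<i> * of_int l ^ 2 * \<tau> / (2 * of_nat m) - 2 * pi * \<i> * of_int l * v)" for l
  let ?L = "{0..<2 * int m}"
  have "(\<Sum>l\<in>?L. R_pol m l (v + \<tau>) (w + cnj \<tau>) \<tau> * theta_ml m l z \<tau>) = (\<Sum>l\<in>?L. C * (R_pol m l v w \<tau> - 2 * a l) * theta_ml m l z \<tau>)"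
    by (intro sum.cong refl) (simp add: R_pol_plus_tau[OF m] C_def a_def)
  also have "\<dots> = C * ((\<Sum>l\<in>?L. R_pol m l v w \<tau> * theta_ml m l z \<tau>) - 2 * (\<Sum>l\<in>?L. a l * theta_ml m l z \<tau>))"
    by (simp add: sum_distrib_left sum_subtractf algebra_simps)
  finally have R: "(\<Sum>l\<in>?L. R_pol m l (v + \<tau>) (w + cnj \<tau>) \<tau> * theta_ml m l z \<tau>) = \<dots>" .
  have f: "f_u m (v + \<tau>) z \<tau> = C * (f_u m v z \<tau> - (\<Sum>l\<in>?L. a l * theta_ml m l z \<tau>))"
    unfolding C_def a_def by (rule f_u_plus_tau[OF m v])
  show ?thesis unfolding F_pol_def R f C_def[symmetric] by (simp add: algebra_simps)
qed

lemma F_pol_tau_plus_1: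
  assumes m: "m > 0"
  shows "F_pol m v w z (\<tau> + 1) = F_pol m v w z \<tau>"
proof -
  have "R_pol m l v w (\<tau> + 1) * theta_ml m l z (\<tau> + 1) = R_pol m l v w \<tau> * theta_ml m l z \<tau>" for l
    unfolding R_pol_tau_plus_1[OF m] theta_ml_tau_plus_1[OF m] by (simp add: exp_minus field_simps)
  thus ?thesis unfolding F_pol_def f_u_tau_plus_1 by simp
qed

lemma sep_holo_F_pol:
  assumes m: "m > 0" "Im \<tau> > 0"
  shows "sep_holo (\<lambda>v w. F_pol m v w z \<tau>) (- coset z \<tau>) UNIV"
  unfolding sep_holo_def
proof (intro conjI ballI open_UNIV open_Compl_coset m)
  have R: "continuous_on X (\<lambda>p. R_pol m l (fst p) (snd p) \<tau>)" for X l
    using sep_holo_R_pol[OF m, of l] by (auto simp: sep_holo_def case_prod_unfold intro: continuous_on_subset)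
  have f: "continuous_on ((- coset z \<tau>) \<times> UNIV) (\<lambda>p. f_u m (fst p) z \<tau>)"
    by (rule continuous_on_compose2[OF holomorphic_on_imp_continuous_on[OF f_u_holomorphic[OF m]]]) (auto intro!: continuous_intros)
  show "continuous_on ((- coset z \<tau>) \<times> UNIV) (\<lambda>(v, w). F_pol m v w z \<tau>)"
    unfolding F_pol_def case_prod_unfold by (intro continuous_intros R f)
  show "(\<lambda>v. F_pol m v w z \<tau>) holomorphic_on - coset z \<tau>" for w
    unfolding F_pol_def by (intro holomorphic_intros f_u_holomorphic R_pol_holomorphic m)
  show "(\<lambda>w. F_pol m v w z \<tau>) holomorphic_on UNIV" for v
    unfolding F_pol_def by (intro holomorphic_intros R_pol_holomorphic m)
qed

lemma F_pol_holomorphic: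
  assumes "m > 0" "Im \<tau> > 0"
  shows "(\<lambda>v. F_pol m v w z \<tau>) holomorphic_on - coset z \<tau>"
  using sep_holo_F_pol[OF assms] by (simp add: sep_holo_def)

lemma F_pol_residue_limit:
  assumes m: "m > 0" "Im \<tau> > 0"
  shows "((\<lambda>v. (v - z) * F_pol m v w z \<tau>) \<longlongrightarrow> 1 / (2 * pi * \<i>)) (at z)"
proof -
  define S where "S v = (\<Sum>l\<in>{0..<2 * int m}. R_pol m l v w \<tau> * theta_ml m l z \<tau>)" for v
  have "S holomorphic_on UNIV" unfolding S_def by (intro holomorphic_intros R_pol_holomorphic m)
  hence "isCont S z" using holomorphic_on_imp_continuous_on continuous_on_eq_continuous_at by blast
  hence "((\<lambda>v. (v - z) * f_u m v z \<tau> - 1/2 * ((v - z) * S v)) \<longlongrightarrow> 1 / (2 * pi * \<i>) - 1/2 * ((z - z) * S z)) (at z)"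
    by (intro tendsto_intros f_u_residue_limit m) (simp add: isCont_def)
  moreover have "(v - z) * F_pol m v w z \<tau> = (v - z) * f_u m v z \<tau> - 1/2 * ((v - z) * S v)" for v
    unfolding F_pol_def S_def[symmetric] by (simp only: right_diff_distrib mult.left_commute)
  ultimately show ?thesis by simp
qed

text \<open>The codomain is arbitrary because the lemma is applied to residues, to a weighted norm,
  and to the truth value of the statement that a limit exists.\<close>

lemma lattice_invariant:
  fixes g :: "complex \<Rightarrow> 'a"
  assumes 1: "\<And>u. g (u + 1) = g u" and 2: "\<And>u. g (u + \<tau>) = g u" and d: "u - s \<in> lattice \<tau>"
  shows "g u = g s"
proof -
  have step: "g (u + of_int n * c) = g u" if "\<And>u. g (u + c) = g u" for u c and n :: int
  proof -
    have nat: "g (u + of_nat k * c) = g u" for u k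
    proof (induction k)
      case (Suc k)
      have "u + of_nat (Suc k) * c = (u + of_nat k * c) + c" by (simp add: algebra_simps)
      thus ?case using Suc that by metis
    qed auto
    show ?thesis
    proof (cases n)
      case (nonneg k)
      thus ?thesis using nat[of u k] by simp
    next
      case (neg k)
      hence "n = - 1 - int k" by simp
      hence "complex_of_int n = - 1 - of_nat k" by simp
      hence "u + of_int n * c + of_nat (Suc k) * c = u" by (simp only:) (simp add: algebra_simps)
      thus ?thesis using nat[of "u + of_int n * c" "Suc k"] by (simp only:)
    qed
  qed
  obtain a b :: int where "u - s = of_int a * \<tau> + of_int b" using d by (auto simp: lattice_def)
  hence u: "u = s + of_int a * \<tau> + of_int b * 1" by (simp add: algebra_simps)
  show ?thesis unfolding u using step[OF 1] step[OF 2] by metis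
qed

lemma residue_shift: "residue f (u + c) = residue (\<lambda>v. f (v + c)) u"
  by (subst (1 2) residue_shift_0) (simp add: add_ac)

lemma residue_sum:
  assumes "open A" "u \<in> A" "\<And>i. i \<in> I \<Longrightarrow> f i holomorphic_on A - {u}"
  shows "residue (\<lambda>x. \<Sum>i\<in>I. f i x) u = (\<Sum>i\<in>I. residue (f i) u)"
  using assms(3)
proof (induction I rule: infinite_finite_induct)
  case (insert i I)
  thus ?case using residue_add[OF assms(1,2), of "f i" "\<lambda>x. \<Sum>i\<in>I. f i x"] by (auto intro!: holomorphic_on_sum)
qed (auto simp: residue_const)

lemma is_pole_affine_iff:
  fixes f :: "complex \<Rightarrow> complex"
  assumes "c \<noteq> 0"
  shows "is_pole (\<lambda>v. f (c * v + d)) u \<longleftrightarrow> is_pole f (c * u + d)"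
proof
  assume "is_pole f (c * u + d)"
  moreover have "((\<lambda>v. c * v + d) \<longlongrightarrow> c * u + d) (at u)" by (intro tendsto_intros)
  moreover have "\<forall>\<^sub>F v in at u. c * v + d \<noteq> c * u + d"
    using assms by (auto simp: eventually_at_filter)
  ultimately show "is_pole (\<lambda>v. f (c * v + d)) u" by (rule is_pole_compose)
next
  assume "is_pole (\<lambda>v. f (c * v + d)) u"
  moreover have "((\<lambda>v. (v - d) / c) \<longlongrightarrow> (c * u + d - d) / c) (at (c * u + d))" using assms by (intro tendsto_intros)
  hence "((\<lambda>v. (v - d) / c) \<longlongrightarrow> u) (at (c * u + d))" using assms by simp
  moreover have "\<forall>\<^sub>F v in at (c * u + d). (v - d) / c \<noteq> u"
    using assms by (auto simp: eventually_at_filter field_simps)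
  ultimately have "is_pole (\<lambda>v. f (c * ((v - d) / c) + d)) (c * u + d)" by (rule is_pole_compose)
  thus "is_pole f (c * u + d)" using assms by simp
qed

section \<open>Base points and lattice representatives\<close>

lemma countable_avoid:
  fixes A :: "real set"
  assumes "countable A"
  obtains a where "a \<notin> A"
  using assms uncountable_UNIV_real by (metis UNIV_eq_I)

lemma countable_image_shift_Ints: "countable ((\<lambda>x::real. x + c) ` \<int>)"
  unfolding Ints_def by auto

text \<open>A point of the boundary has a coordinate that equals that of p or exceeds it by 1. So it
  suffices that each coordinate of p avoids countably many values.\<close>

lemma par_boundary_avoid:
  assumes \<tau>: "Im \<tau> > 0" and Q: "countable Q"
  obtains p where "Q \<inter> par_boundary p \<tau> = {}"
proof -
  obtain a where a: "a \<notin> tau_coord \<tau> ` Q \<union> (\<lambda>x. tau_coord \<tau> x - 1) ` Q"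
    using countable_avoid Q by (metis countable_Un countable_image)
  obtain b where b: "b \<notin> one_coord \<tau> ` Q \<union> (\<lambda>x. one_coord \<tau> x - 1) ` Q"
    using countable_avoid Q by (metis countable_Un countable_image)
  define p where "p = 0 + of_real a * \<tau> + of_real b"
  have p: "tau_coord \<tau> p = a" "one_coord \<tau> p = b"
    unfolding p_def coord_add_scaled[OF \<tau>] by (auto simp: tau_coord_def one_coord_def)
  have "w \<notin> par_boundary p \<tau>" if "w \<in> Q" for w
    using a b that unfolding par_boundary_iff[OF \<tau>] coord_diff p by (auto simp: image_iff algebra_simps)
  thus ?thesis using that by blast
qed

text \<open>Subtracting the integer parts of the coordinates relative to p gives a representative in
  the half-open parallelogram, and the hypothesis excludes the edges. Two representatives have
  coordinates that differ by integers of modulus less than 1.\<close>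

lemma coset_par_open_unique:
  assumes \<tau>: "Im \<tau> > 0" and u: "coset u \<tau> \<inter> par_boundary p \<tau> = {}"
  shows "\<exists>!s. s \<in> coset u \<tau> \<inter> par_open p \<tau>"
proof (rule ex_ex1I)
  define a b where "a = \<lfloor>tau_coord \<tau> (u - p)\<rfloor>" and "b = \<lfloor>one_coord \<tau> (u - p)\<rfloor>"
  define s where "s = u + of_real (- of_int a) * \<tau> + of_real (- of_int b)"
  have "s = u + of_int (- a) * \<tau> + of_int (- b)" by (simp add: s_def)
  hence s: "s \<in> coset u \<tau>" unfolding coset_iff by blast
  have "tau_coord \<tau> (s - p) = tau_coord \<tau> (u - p) - of_int a" "one_coord \<tau> (s - p) = one_coord \<tau> (u - p) - of_int b"
    unfolding coord_diff s_def coord_add_scaled[OF \<tau>] by auto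
  hence "0 \<le> tau_coord \<tau> (s - p)" "tau_coord \<tau> (s - p) < 1" "0 \<le> one_coord \<tau> (s - p)" "one_coord \<tau> (s - p) < 1"
    unfolding a_def b_def by linarith+
  moreover have "s \<notin> par_boundary p \<tau>" using s u by blast
  ultimately have "s \<in> par_open p \<tau>" unfolding par_open_iff[OF \<tau>] par_boundary_iff[OF \<tau>] by linarith
  thus "\<exists>s. s \<in> coset u \<tau> \<inter> par_open p \<tau>" using s by blast
next
  fix s s' assume *: "s \<in> coset u \<tau> \<inter> par_open p \<tau>" "s' \<in> coset u \<tau> \<inter> par_open p \<tau>"
  hence "s \<in> coset u \<tau>" "s' \<in> coset u \<tau>" by auto
  then obtain a b a' b' :: int where ss': "s = u + of_int a * \<tau> + of_int b" "s' = u + of_int a' * \<tau> + of_int b'"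
    unfolding coset_iff by blast
  hence "s = s' + of_real (of_int (a - a')) * \<tau> + of_real (of_int (b - b'))" by (simp add: algebra_simps)
  hence c: "tau_coord \<tau> (s - p) = tau_coord \<tau> (s' - p) + of_int (a - a')" "one_coord \<tau> (s - p) = one_coord \<tau> (s' - p) + of_int (b - b')"
    unfolding coord_diff by (simp_all only: coord_add_scaled[OF \<tau>])
  have "\<bar>real_of_int (a - a')\<bar> < 1" "\<bar>real_of_int (b - b')\<bar> < 1" using * c unfolding IntD2 Int_iff par_open_iff[OF \<tau>] by linarith+
  hence "a = a'" "b = b'" by linarith+
  thus "s = s'" using ss' by simp
qed

lemma coset_refl: "u \<in> coset u \<tau>"
  unfolding coset_iff by (intro exI[of _ 0]) simp

lemma coset_sym: "u \<in> coset s \<tau> \<Longrightarrow> s \<in> coset u \<tau>"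
proof -
  assume "u \<in> coset s \<tau>"
  then obtain a b :: int where "u = s + of_int a * \<tau> + of_int b" unfolding coset_iff by blast
  hence "s = u + of_int (- a) * \<tau> + of_int (- b)" by simp
  thus ?thesis unfolding coset_iff by blast
qed

lemma coset_trans: "u \<in> coset s \<tau> \<Longrightarrow> s \<in> coset r \<tau> \<Longrightarrow> u \<in> coset r \<tau>"
proof -
  assume "u \<in> coset s \<tau>" "s \<in> coset r \<tau>"
  then obtain a b a' b' :: int where "u = s + of_int a * \<tau> + of_int b" "s = r + of_int a' * \<tau> + of_int b'" unfolding coset_iff by blast
  hence "u = r + of_int (a + a') * \<tau> + of_int (b + b')" by (simp add: algebra_simps)
  thus ?thesis unfolding coset_iff by blast
qed

text \<open>A single \<tau> is fixed, so that the results can be used at \<tau>, \<tau> + 1 and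
  -1/\<tau> alike. The continuity assumption excludes arbitrary values at removable singularities;
  with it \<phi> is holomorphic off its poles. The elliptic law is asked for off the poles, since
  the value at a pole carries no meaning.\<close>

locale elliptic_meromorphic =
  fixes m :: nat and \<tau> :: complex and \<phi> :: "complex \<Rightarrow> complex"
  assumes m_pos: "m > 0" and tau: "Im \<tau> > 0" and mero: "\<phi> meromorphic_on UNIV"
    and cont: "\<not> is_pole \<phi> z \<Longrightarrow> isCont \<phi> z"
    and elliptic: "\<not> is_pole \<phi> z \<Longrightarrow> \<phi> (z + of_int n * \<tau> + of_int \<mu>)
        = exp (- 2 * pi * \<i> * of_nat m * (of_int n ^ 2 * \<tau> + 2 * of_int n * z)) * \<phi> z"
begin

abbreviation "poles \<equiv> {z. is_pole \<phi> z}"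

lemma poles_sparse: "poles sparse_in UNIV"
  using meromorphic_on_imp_not_pole_cosparse[OF mero] by (simp add: eventually_cosparse)

lemma eventually_not_pole: "\<forall>\<^sub>F v in at u. \<not> is_pole \<phi> v"
  using sparse_imp_eventually_not_in[OF poles_sparse] by simp

lemma countable_poles: "countable poles"
  using sparse_imp_countable[OF open_UNIV poles_sparse] by simp

lemma countable_coset: "countable (coset z \<tau>)"
  using sparse_imp_countable[OF open_UNIV coset_sparse[OF tau]] by simp

lemma open_Compl_poles: "open (- poles)"
  using sparse_in_UNIV_imp_closed[OF poles_sparse] by (simp add: open_Compl)

lemma holomorphic: "\<phi> holomorphic_on - poles"
proof -
  have "\<phi> analytic_on {z}" if "z \<notin> poles" for z
    using meromorphic_at_isCont_imp_analytic meromorphic_on_subset[OF mero, of "{z}"] cont that by simp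
  thus ?thesis using analytic_on_analytic_at analytic_imp_holomorphic by (metis ComplD)
qed

lemma isolated: "isolated_singularity_at \<phi> u" and not_ess: "not_essential \<phi> u"
  using mero meromorphic_on_subset[of \<phi> UNIV "{u}"] by (auto simp: meromorphic_at_iff)

text \<open>The factor in the elliptic law is holomorphic without zeros, so it neither creates nor
  removes a pole.\<close>

lemma is_pole_lattice:
  assumes "u \<in> coset s \<tau>"
  shows "is_pole \<phi> u \<longleftrightarrow> is_pole \<phi> s"
proof -
  obtain n \<mu> :: int where u: "u = s + of_int n * \<tau> + of_int \<mu>" using assms unfolding coset_iff by blast
  let ?e = "\<lambda>v. exp (- 2 * pi * \<i> * of_nat m * (of_int n ^ 2 * \<tau> + 2 * of_int n * v))"
  have "is_pole \<phi> s \<longleftrightarrow> is_pole (\<lambda>v. ?e v * \<phi> v) s"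
    by (rule is_pole_mult_analytic_nonzero1_iff[symmetric]) (auto intro!: analytic_intros)
  also have "\<dots> \<longleftrightarrow> is_pole (\<lambda>v. \<phi> (1 * v + (of_int n * \<tau> + of_int \<mu>))) s"
  proof (rule is_pole_cong[OF _ refl])
    show "\<forall>\<^sub>F v in at s. ?e v * \<phi> v = \<phi> (1 * v + (of_int n * \<tau> + of_int \<mu>))"
      using eventually_not_pole[of s]
    proof eventually_elim
      case (elim v)
      thus ?case using elliptic[of v n \<mu>] by (simp add: add.assoc)
    qed
  qed
  also have "\<dots> \<longleftrightarrow> is_pole \<phi> u" by (subst is_pole_affine_iff) (auto simp: u add.assoc)
  finally show ?thesis ..
qed

definition pole_res :: "complex \<Rightarrow> complex \<Rightarrow> complex" where
  "pole_res z u = residue (\<lambda>v. F_pol m v (cnj u) z \<tau> * \<phi> v) u"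

definition R_res :: "int \<Rightarrow> complex \<Rightarrow> complex" where
  "R_res l u = residue (\<lambda>v. R_pol m l v (cnj u) \<tau> * \<phi> v) u"

lemma pole_res_lattice:
  assumes "u \<in> coset s \<tau>"
  shows "pole_res z u = pole_res z s"
proof (rule lattice_invariant[where g = "pole_res z" and \<tau> = \<tau>])
  fix u
  show "pole_res z (u + 1) = pole_res z u"
    unfolding pole_res_def residue_shift
  proof (rule residue_cong[OF _ refl])
    show "\<forall>\<^sub>F v in at u. F_pol m (v + 1) (cnj (u + 1)) z \<tau> * \<phi> (v + 1) = F_pol m v (cnj u) z \<tau> * \<phi> v"
      using eventually_not_pole[of u]
    proof eventually_elim
      case (elim v)
      thus ?case using elliptic[of v 0 1] F_pol_plus_1[of m v "cnj u"] by simp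
    qed
  qed
  show "pole_res z (u + \<tau>) = pole_res z u"
    unfolding pole_res_def residue_shift
  proof (rule residue_cong[OF _ refl])
    show "\<forall>\<^sub>F v in at u. F_pol m (v + \<tau>) (cnj (u + \<tau>)) z \<tau> * \<phi> (v + \<tau>) = F_pol m v (cnj u) z \<tau> * \<phi> v"
      using eventually_not_pole[of u] sparse_imp_eventually_not_in[OF coset_sparse[OF tau], of z u]
    proof eventually_elim
      case (elim v)
      define C where "C = exp (2 * pi * \<i> * of_nat m * (\<tau> + 2 * v))"
      have "\<phi> (v + \<tau>) = exp (- (2 * pi * \<i> * of_nat m * (\<tau> + 2 * v))) * \<phi> v"
        using elliptic[of v 1 0] elim(1) by simp
      hence "\<phi> (v + \<tau>) = inverse C * \<phi> v" unfolding exp_minus C_def .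
      moreover have "F_pol m (v + \<tau>) (cnj (u + \<tau>)) z \<tau> = C * F_pol m v (cnj u) z \<tau>"
        using F_pol_plus_tau[OF m_pos tau elim(2), of "cnj u"] by (simp add: C_def)
      moreover have "C \<noteq> 0" by (simp add: C_def)
      ultimately show ?case by simp
    qed
  qed
qed (use assms in \<open>simp add: coset_def\<close>)

abbreviation sing :: "complex \<Rightarrow> complex set" where "sing z \<equiv> poles \<union> coset z \<tau>"

lemma sing_sparse: "sing z sparse_in UNIV"
  by (intro sparse_in_union' poles_sparse coset_sparse tau)

lemma open_punctured: "open (- (sing z - {u}))"
  by (rule open_Compl, rule sparse_in_UNIV_imp_closed, rule sparse_in_subset2[OF sing_sparse[of z]]) auto

lemma R_phi_holomorphic: "(\<lambda>v. R_pol m l v w \<tau> * \<phi> v) holomorphic_on - poles"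
  by (intro holomorphic_intros R_pol_holomorphic holomorphic m_pos tau)

lemma F_phi_holomorphic: "(\<lambda>v. F_pol m v w z \<tau> * \<phi> v) holomorphic_on - sing z"
  by (intro holomorphic_intros holomorphic_on_subset[OF F_pol_holomorphic[OF m_pos tau, of w z]] holomorphic_on_subset[OF holomorphic]) auto

lemma f_phi_holomorphic: "(\<lambda>v. f_u m v z \<tau> * \<phi> v) holomorphic_on - sing z"
  by (intro holomorphic_intros holomorphic_on_subset[OF f_u_holomorphic[OF m_pos tau, of z]] holomorphic_on_subset[OF holomorphic]) auto

lemma pole_res_self:
  assumes z: "z \<notin> poles"
  shows "pole_res z z = \<phi> z / (2 * pi * \<i>)"
  unfolding pole_res_def
proof (rule residue_simple'[OF open_punctured[of z z]])
  show "(\<lambda>v. F_pol m v (cnj z) z \<tau> * \<phi> v) holomorphic_on - (sing z - {z}) - {z}"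
    by (rule holomorphic_on_subset[OF F_phi_holomorphic]) auto
  have "((\<lambda>v. (v - z) * F_pol m v (cnj z) z \<tau> * \<phi> v) \<longlongrightarrow> 1 / (2 * pi * \<i>) * \<phi> z) (at z)"
    using cont[of z] z by (intro tendsto_mult F_pol_residue_limit m_pos tau) (simp add: isCont_def)
  thus "((\<lambda>v. F_pol m v (cnj z) z \<tau> * \<phi> v * (v - z)) \<longlongrightarrow> \<phi> z / (2 * pi * \<i>)) (at z)"
    by (simp add: mult_ac)
qed auto

lemma R_res_0: "u \<notin> poles \<Longrightarrow> R_res l u = 0"
  unfolding R_res_def by (rule residue_holo[OF open_Compl_poles _ R_phi_holomorphic]) auto

text \<open>This separates what the residue theorem produces into a part that depends on u only
  modulo the lattice and a combination of theta functions of z. The latter do not involve v and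
  leave the residue as constants.\<close>

lemma residue_f_phi:
  "residue (\<lambda>v. f_u m v z \<tau> * \<phi> v) u = pole_res z u + 1/2 * (\<Sum>l\<in>{0..<2 * int m}. R_res l u * theta_ml m l z \<tau>)"
proof -
  let ?A = "- (sing z - {u})" and ?L = "{0..<2 * int m}"
  have sub: "?A - {u} \<subseteq> - poles" "?A - {u} \<subseteq> - sing z" by auto
  have A: "open ?A" "u \<in> ?A" using open_punctured by auto
  have hR: "(\<lambda>v. (R_pol m l v (cnj u) \<tau> * \<phi> v)) holomorphic_on ?A - {u}" for l
    by (rule holomorphic_on_subset[OF R_phi_holomorphic sub(1)])
  have hR': "(\<lambda>v. (R_pol m l v (cnj u) \<tau> * \<phi> v) * theta_ml m l z \<tau>) holomorphic_on ?A - {u}" for l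
    by (intro holomorphic_intros hR)
  have hF: "(\<lambda>v. F_pol m v (cnj u) z \<tau> * \<phi> v) holomorphic_on ?A - {u}"
    by (rule holomorphic_on_subset[OF F_phi_holomorphic sub(2)])
  have "residue (\<lambda>v. f_u m v z \<tau> * \<phi> v) u = residue (\<lambda>v. F_pol m v (cnj u) z \<tau> * \<phi> v + 1/2 * (\<Sum>l\<in>?L. (R_pol m l v (cnj u) \<tau> * \<phi> v) * theta_ml m l z \<tau>)) u"
    unfolding F_pol_def by (simp add: algebra_simps sum_distrib_left sum_distrib_right)
  also have "\<dots> = pole_res z u + residue (\<lambda>v. 1/2 * (\<Sum>l\<in>?L. (R_pol m l v (cnj u) \<tau> * \<phi> v) * theta_ml m l z \<tau>)) u"
    unfolding pole_res_def by (rule residue_add[OF A hF]) (intro holomorphic_intros hR')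
  also have "residue (\<lambda>v. 1/2 * (\<Sum>l\<in>?L. (R_pol m l v (cnj u) \<tau> * \<phi> v) * theta_ml m l z \<tau>)) u = 1/2 * residue (\<lambda>v. \<Sum>l\<in>?L. (R_pol m l v (cnj u) \<tau> * \<phi> v) * theta_ml m l z \<tau>) u"
    by (rule residue_lmul[OF A]) (intro holomorphic_intros hR')
  also have "residue (\<lambda>v. \<Sum>l\<in>?L. (R_pol m l v (cnj u) \<tau> * \<phi> v) * theta_ml m l z \<tau>) u = (\<Sum>l\<in>?L. R_res l u * theta_ml m l z \<tau>)"
    unfolding residue_sum[OF A hR'] R_res_def by (intro sum.cong refl residue_rmul[OF A hR])
  finally show ?thesis .
qed

section \<open>The expansion for a given base point\<close>

definition h_par :: "int \<Rightarrow> complex \<Rightarrow> complex" where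
  "h_par l p = exp (- pi * \<i> * of_int l ^ 2 * \<tau> / (2 * of_nat m))
       * contour_integral (linepath p (p + 1)) (\<lambda>v. \<phi> v * exp (- 2 * pi * \<i> * of_int l * v))
     - pi * \<i> * (\<Sum>u\<in>poles \<inter> par_open p \<tau>. R_res l u)"

lemma finite_poles_par: "finite (poles \<inter> par_open p \<tau>)"
proof -
  have "bounded (par_open p \<tau>)" using bounded_par_closed[OF tau, of p] par_closed_eq[OF tau, of p] by (simp add: bounded_Un)
  then obtain R where "par_open p \<tau> \<subseteq> ball 0 R" using bounded_subset_ballD by blast
  hence "par_open p \<tau> \<subseteq> cball 0 R" using ball_subset_cball by blast
  moreover have "finite (cball 0 R \<inter> poles)"
    by (rule sparse_in_compact_finite[OF sparse_in_subset[OF poles_sparse]]) auto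
  ultimately show ?thesis by (auto elim: rev_finite_subset)
qed

lemma formula_par:
  assumes z: "z \<notin> poles" and p: "sing z \<inter> par_boundary p \<tau> = {}"
  shows "\<phi> z = (\<Sum>l\<in>{0..<2 * int m}. h_par l p * theta_ml m l z \<tau>) - 2 * pi * \<i> * (\<Sum>u\<in>poles \<inter> par_open p \<tau>. pole_res z u)"
proof -
  let ?L = "{0..<2 * int m}"
  define g where "g v = f_u m v z \<tau> * \<phi> v" for v
  define a where "a l v = exp (- pi * \<i> * of_int l ^ 2 * \<tau> / (2 * of_nat m)) * exp (- 2 * pi * \<i> * of_int l * v)" for l :: int and v :: complex
  have gh: "g holomorphic_on - sing z" unfolding g_def by (rule f_phi_holomorphic)
  have seg: "closed_segment p (p + 1) \<subseteq> par_boundary p \<tau>" by (rule closed_segment_par_boundary[OF tau])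
  have "contour_integral (par_path p \<tau>) g = contour_integral (linepath p (p + 1)) (\<lambda>v. g v - g (v + \<tau>))"
  proof (rule contour_integral_par_path[OF tau])
    show "continuous_on (par_boundary p \<tau>) g"
      by (rule continuous_on_subset[OF holomorphic_on_imp_continuous_on[OF gh]]) (use p in auto)
    show "g (v + 1) = g v" if "v \<in> par_boundary p \<tau>" for v
      using elliptic[of v 0 1] that p f_u_plus_1[of m v] unfolding g_def by auto
  qed
  also have "\<dots> = contour_integral (linepath p (p + 1)) (\<lambda>v. \<Sum>l\<in>?L. (exp (- pi * \<i> * of_int l ^ 2 * \<tau> / (2 * of_nat m)) * theta_ml m l z \<tau>) * (\<phi> v * exp (- 2 * pi * \<i> * of_int l * v)))"
  \<comment> \<open>The factor C of f_v under v to v + \<tau> is inverse to that of \<phi>, so g(v +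
    \<tau>) differs from g(v) by the theta sum alone, and its exponentials in v produce the Fourier
    integrals of \<phi>.\<close>
  proof (rule contour_integral_eq)
    fix v assume "v \<in> path_image (linepath p (p + 1))"
    hence v: "\<not> is_pole \<phi> v" "v \<notin> coset z \<tau>" using p seg by auto
    define C where "C = exp (2 * pi * \<i> * of_nat m * (\<tau> + 2 * v))"
    have "\<phi> (v + \<tau>) = exp (- (2 * pi * \<i> * of_nat m * (\<tau> + 2 * v))) * \<phi> v"
      using elliptic[of v 1 0] v(1) by simp
    hence 1: "\<phi> (v + \<tau>) = inverse C * \<phi> v" unfolding exp_minus C_def .
    have "a l v = exp (- pi * \<i> * of_int l ^ 2 * \<tau> / (2 * of_nat m) - 2 * pi * \<i> * of_int l * v)" for l
      unfolding a_def exp_add[symmetric] by simp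
    hence 2: "f_u m (v + \<tau>) z \<tau> = C * (f_u m v z \<tau> - (\<Sum>l\<in>?L. a l v * theta_ml m l z \<tau>))"
      unfolding C_def f_u_plus_tau[OF m_pos tau v(2)] by simp
    have "C \<noteq> 0" by (simp add: C_def)
    hence "g (v + \<tau>) = \<phi> v * (f_u m v z \<tau> - (\<Sum>l\<in>?L. a l v * theta_ml m l z \<tau>))"
      unfolding g_def 1 2 by simp
    thus "g v - g (v + \<tau>) = (\<Sum>l\<in>?L. (exp (- pi * \<i> * of_int l ^ 2 * \<tau> / (2 * of_nat m)) * theta_ml m l z \<tau>) * (\<phi> v * exp (- 2 * pi * \<i> * of_int l * v)))"
      unfolding g_def by (simp add: a_def algebra_simps sum_distrib_left)
  qed
  also have "\<dots> = (\<Sum>l\<in>?L. exp (- pi * \<i> * of_int l ^ 2 * \<tau> / (2 * of_nat m)) * theta_ml m l z \<tau> * contour_integral (linepath p (p + 1)) (\<lambda>v. \<phi> v * exp (- 2 * pi * \<i> * of_int l * v)))"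
  proof -
    have "continuous_on (closed_segment p (p + 1)) \<phi>"
      by (rule continuous_on_subset[OF holomorphic_on_imp_continuous_on[OF holomorphic]]) (use p seg in auto)
    hence int: "(\<lambda>v. \<phi> v * exp (- 2 * pi * \<i> * of_int l * v)) contour_integrable_on linepath p (p + 1)" for l
      by (intro contour_integrable_continuous_linepath continuous_intros)
    show ?thesis
      by (subst contour_integral_sum) (simp_all only: contour_integral_lmul[OF int] contour_integrable_lmul[OF int] finite_atLeastLessThan_int)
  qed
  finally have lhs: "contour_integral (par_path p \<tau>) g = \<dots>" .
  \<comment> \<open>z itself need not lie in the parallelogram. Exactly one translate z' does, and
    the invariance of \<open>pole_res\<close> carries the contribution \<phi>(z) over to it; R
    contributes nothing there because z' is not a pole of \<phi>.\<close>
  obtain z' where z': "coset z \<tau> \<inter> par_open p \<tau> = {z'}"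
    using coset_par_open_unique[OF tau, of z p] p by (metis (no_types, lifting) Int_Un_distrib2 Un_empty is_singletonE is_singletonI' ex1E empty_iff)
  have z'_pole: "z' \<notin> poles" using is_pole_lattice[of z' z] z z' by auto
  have "contour_integral (par_path p \<tau>) g = 2 * pi * \<i> * (\<Sum>u\<in>sing z \<inter> par_open p \<tau>. residue g u)"
    by (rule residue_theorem_par_path[OF tau sing_sparse gh p])
  also have "sing z \<inter> par_open p \<tau> = insert z' (poles \<inter> par_open p \<tau>)" using z' by auto
  also have "(\<Sum>u\<in>insert z' (poles \<inter> par_open p \<tau>). residue g u) = residue g z' + (\<Sum>u\<in>poles \<inter> par_open p \<tau>. residue g u)"
    using finite_poles_par z'_pole by (subst sum.insert) auto
  also have "residue g z' = \<phi> z / (2 * pi * \<i>)"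
    unfolding g_def residue_f_phi using R_res_0[OF z'_pole] pole_res_lattice[of z' z z] pole_res_self[OF z] z' by auto
  also have "(\<Sum>u\<in>poles \<inter> par_open p \<tau>. residue g u) = (\<Sum>u\<in>poles \<inter> par_open p \<tau>. pole_res z u) + 1/2 * (\<Sum>l\<in>?L. (\<Sum>u\<in>poles \<inter> par_open p \<tau>. R_res l u) * theta_ml m l z \<tau>)"
    unfolding g_def residue_f_phi sum.distrib sum_distrib_left[symmetric] sum_distrib_right
    by (subst sum.swap) simp
  finally have "2 * pi * \<i> * (\<phi> z / (2 * pi * \<i>) + ((\<Sum>u\<in>poles \<inter> par_open p \<tau>. pole_res z u) + 1/2 * (\<Sum>l\<in>?L. (\<Sum>u\<in>poles \<inter> par_open p \<tau>. R_res l u) * theta_ml m l z \<tau>)))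
     = (\<Sum>l\<in>?L. exp (- pi * \<i> * of_int l ^ 2 * \<tau> / (2 * of_nat m)) * theta_ml m l z \<tau> * contour_integral (linepath p (p + 1)) (\<lambda>v. \<phi> v * exp (- 2 * pi * \<i> * of_int l * v)))"
    using lhs by simp
  thus ?thesis
    unfolding h_par_def left_diff_distrib sum_subtractf by (simp add: algebra_simps sum_distrib_left)
qed

definition good :: "complex \<Rightarrow> bool" where "good p \<longleftrightarrow> poles \<inter> par_boundary p \<tau> = {}"

text \<open>Sending a pole in the parallelogram to its representative in S is a bijection along
  which the residues agree. The pole sum thus depends neither on S nor on p.\<close>

lemma pole_sum_representatives:
  assumes p: "good p" and S: "S \<subseteq> poles" "\<forall>u\<in>poles. \<exists>!s\<in>S. u - s \<in> lattice \<tau>"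
  shows "(\<Sum>u\<in>S. pole_res z u) = (\<Sum>u\<in>poles \<inter> par_open p \<tau>. pole_res z u)"
proof -
  have S': "\<exists>!s. s \<in> S \<and> u \<in> coset s \<tau>" if "u \<in> poles" for u
    using S(2) that unfolding coset_def by blast
  define \<rho> where "\<rho> u = (THE s. s \<in> S \<and> u \<in> coset s \<tau>)" for u
  have \<rho>: "\<rho> u \<in> S" "u \<in> coset (\<rho> u) \<tau>" if "u \<in> poles" for u
    using theI'[OF S'[OF that]] unfolding \<rho>_def by auto
  have cos: "\<exists>!s. s \<in> coset u \<tau> \<inter> par_open p \<tau>" if "u \<in> poles" for u
  proof (rule coset_par_open_unique[OF tau])
    have "coset u \<tau> \<subseteq> poles" using is_pole_lattice that by auto
    thus "coset u \<tau> \<inter> par_boundary p \<tau> = {}" using p by (auto simp: good_def)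
  qed
  have "bij_betw \<rho> (poles \<inter> par_open p \<tau>) S"
    unfolding bij_betw_def
  proof
    show "inj_on \<rho> (poles \<inter> par_open p \<tau>)"
    proof (rule inj_onI)
      fix u u' assume *: "u \<in> poles \<inter> par_open p \<tau>" "u' \<in> poles \<inter> par_open p \<tau>" "\<rho> u = \<rho> u'"
      have "u' \<in> coset u \<tau>" using \<rho>[of u] \<rho>[of u'] * coset_sym coset_trans by (metis IntD1)
      thus "u = u'" using cos[of u] * coset_refl[of u \<tau>] by blast
    qed
    show "\<rho> ` (poles \<inter> par_open p \<tau>) = S"
    proof
      show "\<rho> ` (poles \<inter> par_open p \<tau>) \<subseteq> S" using \<rho> by blast
      show "S \<subseteq> \<rho> ` (poles \<inter> par_open p \<tau>)"
      proof
        fix s assume s: "s \<in> S"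
        then obtain u where u: "u \<in> coset s \<tau>" "u \<in> par_open p \<tau>" using cos[of s] S(1) by blast
        hence up: "u \<in> poles" using is_pole_lattice s S(1) by auto
        hence "\<rho> u = s" using S'[OF up] \<rho>[OF up] u s by blast
        thus "s \<in> \<rho> ` (poles \<inter> par_open p \<tau>)" using u up by blast
      qed
    qed
  qed
  hence "(\<Sum>u\<in>S. pole_res z u) = (\<Sum>u\<in>poles \<inter> par_open p \<tau>. pole_res z (\<rho> u))"
    by (rule sum.reindex_bij_betw[symmetric])
  also have "\<dots> = (\<Sum>u\<in>poles \<inter> par_open p \<tau>. pole_res z u)"
    using \<rho> pole_res_lattice by (intro sum.cong refl) (metis IntD1)
  finally show ?thesis .
qed

lemma par_open_representatives:
  assumes "good p" "u \<in> poles"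
  shows "\<exists>!s\<in>poles \<inter> par_open p \<tau>. u - s \<in> lattice \<tau>"
proof -
  have sub: "coset u \<tau> \<subseteq> poles" using is_pole_lattice assms by auto
  hence "\<exists>!s. s \<in> coset u \<tau> \<inter> par_open p \<tau>"
    using assms by (intro coset_par_open_unique[OF tau]) (auto simp: good_def)
  moreover have "u - s \<in> lattice \<tau> \<longleftrightarrow> s \<in> coset u \<tau>" for s
    using coset_sym[of u s \<tau>] coset_sym[of s u \<tau>] by (auto simp: coset_def)
  ultimately show ?thesis using sub by blast
qed

section \<open>Independence of the base point\<close>

lemma theta_coefficients_unique:
  assumes U: "open U" "U \<noteq> {}" and eq: "\<And>z. z \<in> U \<Longrightarrow> (\<Sum>l\<in>{0..<2 * int m}. c l * theta_ml m l z \<tau>) = (\<Sum>l\<in>{0..<2 * int m}. d l * theta_ml m l z \<tau>)"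
    and l: "0 \<le> l" "l < 2 * int m"
  shows "c l = d l"
proof -
  have "(\<Sum>l\<in>{0..<2 * int m}. (c l - d l) * theta_ml m l z \<tau>) = 0" for z
  \<comment> \<open>Equality on a nonempty open set suffices because theta functions are entire; the
    Fourier integrals that separate them need the identity along a whole period.\<close>
  proof (rule analytic_continuation_open[OF U(1) open_UNIV U(2) connected_UNIV subset_UNIV,
        where f = "\<lambda>z. \<Sum>l\<in>{0..<2 * int m}. (c l - d l) * theta_ml m l z \<tau>" and g = "\<lambda>_. 0"])
    show "(\<lambda>z. \<Sum>l\<in>{0..<2 * int m}. (c l - d l) * theta_ml m l z \<tau>) holomorphic_on UNIV"
      by (intro holomorphic_intros m_pos tau)
    show "(\<Sum>l\<in>{0..<2 * int m}. (c l - d l) * theta_ml m l z \<tau>) = 0" if "z \<in> U" for z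
      using eq[OF that] by (simp add: left_diff_distrib sum_subtractf)
  qed auto
  from theta_ml_independent[OF m_pos tau this l] show ?thesis by simp
qed

text \<open>A condition on coordinates, open in z, under which no lattice translate of z meets the
  boundary of the parallelogram at p. It makes the expansion at p available for all such z that are
  not poles.\<close>

definition off_grid :: "complex \<Rightarrow> complex set" where
  "off_grid p = {z. tau_coord \<tau> (z - p) \<notin> \<int> \<and> one_coord \<tau> (z - p) \<notin> \<int>}"

lemma open_off_grid: "open (off_grid p)"
proof -
  have "off_grid p = (\<lambda>z. tau_coord \<tau> (z - p)) -` (- \<int>) \<inter> (\<lambda>z. one_coord \<tau> (z - p)) -` (- \<int>)"
    by (auto simp: off_grid_def)
  thus ?thesis by (simp add: open_Int open_vimage open_Compl continuous_intros)
qed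

lemma off_grid_coset:
  assumes "z \<in> off_grid p"
  shows "coset z \<tau> \<inter> par_boundary p \<tau> = {}"
proof -
  have False if w: "w \<in> coset z \<tau>" "w \<in> par_boundary p \<tau>" for w
  proof -
    obtain a b :: int where "w = z + of_int a * \<tau> + of_int b" using w coset_iff by blast
    hence "w = z + of_real (of_int a) * \<tau> + of_real (of_int b)" by simp
    hence c: "tau_coord \<tau> (w - p) = tau_coord \<tau> (z - p) + of_int a" "one_coord \<tau> (w - p) = one_coord \<tau> (z - p) + of_int b"
      unfolding coord_diff by (simp_all only: coord_add_scaled[OF tau])
    have "tau_coord \<tau> (w - p) \<in> \<int> \<or> one_coord \<tau> (w - p) \<in> \<int>"
      using w(2) unfolding par_boundary_iff[OF tau] by auto
    hence "tau_coord \<tau> (w - p) - of_int a \<in> \<int> \<or> one_coord \<tau> (w - p) - of_int b \<in> \<int>"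
      by (auto intro: Ints_diff)
    thus False using assms unfolding c off_grid_def by simp
  qed
  thus ?thesis by blast
qed

text \<open>For z off both grids the expansions at p and at p' both hold, and their pole sums agree
  because the two sets of poles represent the same classes modulo the lattice. What remains is an
  equality of theta combinations on an open set.\<close>

lemma h_par_unique:
  assumes p: "good p" "good p'" and l: "0 \<le> l" "l < 2 * int m"
  shows "h_par l p = h_par l p'"
proof (rule theta_coefficients_unique[OF _ _ _ l, of "(off_grid p \<inter> off_grid p') - poles"])
  show "open ((off_grid p \<inter> off_grid p') - poles)"
    using sparse_in_UNIV_imp_closed[OF poles_sparse] by (intro open_Diff open_Int open_off_grid)
  \<comment> \<open>A witness that the open set is nonempty: each coordinate has only countably many
    forbidden values, and the first coordinate alone already keeps z off the poles.\<close>
  have "countable (tau_coord \<tau> ` poles \<union> ((\<lambda>x. x + tau_coord \<tau> p) ` \<int> \<union> (\<lambda>x. x + tau_coord \<tau> p') ` \<int>))"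
    using countable_poles by (intro countable_Un countable_image_shift_Ints countable_image)
  then obtain a where a: "a \<notin> tau_coord \<tau> ` poles \<union> ((\<lambda>x. x + tau_coord \<tau> p) ` \<int> \<union> (\<lambda>x. x + tau_coord \<tau> p') ` \<int>)"
    by (rule countable_avoid)
  have "countable ((\<lambda>x. x + one_coord \<tau> p) ` \<int> \<union> (\<lambda>x. x + one_coord \<tau> p') ` \<int>)"
    by (intro countable_Un countable_image_shift_Ints)
  then obtain b where b: "b \<notin> (\<lambda>x. x + one_coord \<tau> p) ` \<int> \<union> (\<lambda>x. x + one_coord \<tau> p') ` \<int>"
    by (rule countable_avoid)
  define z where "z = 0 + of_real a * \<tau> + of_real b"
  have z: "tau_coord \<tau> z = a" "one_coord \<tau> z = b"
    unfolding z_def coord_add_scaled[OF tau] by (auto simp: tau_coord_def one_coord_def)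
  have n: "x - y \<notin> \<int>" if "x \<notin> (\<lambda>x. x + y) ` \<int>" for x y :: real
  proof
    assume "x - y \<in> \<int>"
    from imageI[OF this, of "\<lambda>x. x + y"] that show False by simp
  qed
  have "z \<in> (off_grid p \<inter> off_grid p') - poles"
  proof (intro DiffI IntI)
    show "z \<notin> poles" using a z(1) by blast
    show "z \<in> off_grid p" "z \<in> off_grid p'"
      using n[of a "tau_coord \<tau> p"] n[of a "tau_coord \<tau> p'"] n[of b "one_coord \<tau> p"] n[of b "one_coord \<tau> p'"] a b
      unfolding off_grid_def coord_diff by (simp_all add: z)
  qed
  thus "(off_grid p \<inter> off_grid p') - poles \<noteq> {}" by blast
  fix z assume z: "z \<in> (off_grid p \<inter> off_grid p') - poles"
  have "\<phi> z = (\<Sum>l\<in>{0..<2 * int m}. h_par l p * theta_ml m l z \<tau>) - 2 * pi * \<i> * (\<Sum>u\<in>poles \<inter> par_open p \<tau>. pole_res z u)"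
    by (rule formula_par) (use z p off_grid_coset[of z p] in \<open>auto simp: good_def\<close>)
  moreover have "\<phi> z = (\<Sum>l\<in>{0..<2 * int m}. h_par l p' * theta_ml m l z \<tau>) - 2 * pi * \<i> * (\<Sum>u\<in>poles \<inter> par_open p' \<tau>. pole_res z u)"
    by (rule formula_par) (use z p off_grid_coset[of z p'] in \<open>auto simp: good_def\<close>)
  moreover have "(\<Sum>u\<in>poles \<inter> par_open p' \<tau>. pole_res z u) = (\<Sum>u\<in>poles \<inter> par_open p \<tau>. pole_res z u)"
    by (rule pole_sum_representatives[OF p(1)]) (use par_open_representatives[OF p(2)] in auto)
  ultimately show "(\<Sum>l\<in>{0..<2 * int m}. h_par l p * theta_ml m l z \<tau>) = (\<Sum>l\<in>{0..<2 * int m}. h_par l p' * theta_ml m l z \<tau>)"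
    by simp
qed

definition h_val :: "int \<Rightarrow> complex" where
  "h_val l = h_par (l mod (2 * int m)) (SOME p. good p)"

lemma h_val_periodic: "h_val (l + 2 * int m) = h_val l"
  by (simp add: h_val_def)

lemma h_val_eq:
  assumes "good p" "0 \<le> l" "l < 2 * int m"
  shows "h_val l = h_par l p"
proof -
  have "l mod (2 * int m) = l" using assms by simp
  thus ?thesis unfolding h_val_def using h_par_unique[OF someI[of good, OF assms(1)] assms] by simp
qed

lemma formula:
  assumes z: "z \<notin> poles" and S: "S \<subseteq> poles" "\<forall>u\<in>poles. \<exists>!s\<in>S. u - s \<in> lattice \<tau>"
  shows "\<phi> z = (\<Sum>l\<in>{0..<2 * int m}. h_val l * theta_ml m l z \<tau>) - 2 * pi * \<i> * (\<Sum>u\<in>S. pole_res z u)"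
proof -
  obtain p where p: "sing z \<inter> par_boundary p \<tau> = {}"
    using par_boundary_avoid[OF tau] countable_poles countable_coset by (metis countable_Un)
  hence g: "good p" by (auto simp: good_def)
  have "(\<Sum>l\<in>{0..<2 * int m}. h_val l * theta_ml m l z \<tau>) = (\<Sum>l\<in>{0..<2 * int m}. h_par l p * theta_ml m l z \<tau>)"
    using h_val_eq[OF g] by (intro sum.cong) auto
  thus ?thesis using formula_par[OF z p] pole_sum_representatives[OF g S] by simp
qed

lemma exists_representatives:
  obtains S where "S \<subseteq> poles" "\<forall>u\<in>poles. \<exists>!s\<in>S. u - s \<in> lattice \<tau>"
proof -
  obtain p where p: "poles \<inter> par_boundary p \<tau> = {}"
    using par_boundary_avoid[OF tau] countable_poles by blast
  hence "good p" by (auto simp: good_def)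
  thus ?thesis using that[of "poles \<inter> par_open p \<tau>"] par_open_representatives by blast
qed

section \<open>Comparison with the residues of real-analytic products\<close>

lemma R_res_eq_res_ra:
  assumes "u \<in> poles"
  shows "R_res l u = res_ra (\<lambda>v. R_ml m l v \<tau>) \<phi> u"
  unfolding R_res_def
  by (rule res_ra_eq_residue[OF sep_holo_R_pol[OF m_pos tau], symmetric]) (use assms isolated R_ml_eq_R_pol in auto)

lemma pole_res_eq_res_ra:
  assumes u: "u \<in> poles" and z: "z \<notin> poles"
  shows "pole_res z u = res_ra (\<lambda>v. f_tilde m v z \<tau>) \<phi> u"
proof -
  \<comment> \<open>Otherwise z would be a pole together with u. Hence the corrected Appell function
    is regular in v near u.\<close>
  have "u \<notin> coset z \<tau>" using is_pole_lattice[of u z] u z by blast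
  thus ?thesis unfolding pole_res_def
    by (intro res_ra_eq_residue[OF sep_holo_F_pol[OF m_pos tau], symmetric]) (use assms isolated f_tilde_eq_F_pol in auto)
qed

end

subsection \<open>The inversion formula for theta functions\<close>

lemma telescope_int:
  fixes \<Psi> :: "int \<Rightarrow> complex"
  shows "(\<Sum>j\<in>{- int N..<int N}. \<Psi> (j + 1) - \<Psi> j) = \<Psi> (int N) - \<Psi> (- int N)"
proof (induction N)
  case (Suc N)
  have "{- int (Suc N)..<int (Suc N)} = insert (- int (Suc N)) (insert (int N) {- int N..<int N})" by auto
  hence "(\<Sum>j\<in>{- int (Suc N)..<int (Suc N)}. \<Psi> (j + 1) - \<Psi> j) =
     (\<Psi> (- int (Suc N) + 1) - \<Psi> (- int (Suc N))) + ((\<Psi> (int N + 1) - \<Psi> (int N)) + (\<Sum>j\<in>{- int N..<int N}. \<Psi> (j + 1) - \<Psi> j))"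
    by simp
  moreover have "- int (Suc N) + 1 = - int N" "int N + 1 = int (Suc N)" by simp_all
  ultimately show ?case unfolding Suc by simp
qed auto

text \<open>Unconditional summability permits evaluation along symmetric intervals, on which
  \<open>telescope_int\<close> applies.\<close>

lemma has_sum_int_imp_tendsto:
  fixes f :: "int \<Rightarrow> complex"
  assumes "(f has_sum S) UNIV"
  shows "(\<lambda>N. \<Sum>j\<in>{- int N..<int N}. f j) \<longlonglongrightarrow> S"
proof -
  have "filterlim (\<lambda>N. {- int N..<int N}) (finite_subsets_at_top UNIV) sequentially"
    unfolding filterlim_finite_subsets_at_top
  proof safe
    fix X :: "int set" assume "finite X"
    define B where "B = Max (insert 0 (abs ` X))"
    have B: "\<bar>x\<bar> \<le> B" if "x \<in> X" for x using that \<open>finite X\<close> by (auto simp: B_def intro!: Max_ge)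
    show "\<forall>\<^sub>F N in sequentially. finite {- int N..<int N} \<and> X \<subseteq> {- int N..<int N} \<and> {- int N..<int N} \<subseteq> UNIV"
      using eventually_ge_at_top[of "nat (B + 1)"]
    proof eventually_elim
      case (elim N)
      have "x \<in> {- int N..<int N}" if "x \<in> X" for x using B[OF that] elim by auto
      thus ?case by auto
    qed
  qed
  with assms show ?thesis unfolding has_sum_def by (rule filterlim_compose)
qed

lemma periodic_of_int:
  fixes g :: "complex \<Rightarrow> 'a"
  assumes "\<And>u. g (u + 1) = g u"
  shows "g (u + of_int n) = g u"
  by (rule lattice_invariant[of g 1]) (use assms in \<open>auto simp: lattice_def intro: exI[of _ 0]\<close>)

lemma theta_ml_minus_tau:
  fixes x \<tau> :: complex
  assumes "m > 0"
  shows "theta_ml m l (x - \<tau>) \<tau> = exp (2 * pi * \<i> * of_nat m * (2 * x - \<tau>)) * theta_ml m l x \<tau>"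
proof -
  have "theta_ml m l x \<tau> = exp (- 2 * pi * \<i> * of_nat m * (\<tau> + 2 * (x - \<tau>))) * theta_ml m l (x - \<tau>) \<tau>"
    using theta_ml_plus_tau[OF assms, of l "x - \<tau>" \<tau>] by simp
  also have "- 2 * pi * \<i> * of_nat m * (\<tau> + 2 * (x - \<tau>)) = - (2 * pi * \<i> * of_nat m * (2 * x - \<tau>))"
    by (simp add: algebra_simps)
  finally have e: "theta_ml m l x \<tau> = inverse (exp (2 * pi * \<i> * of_nat m * (2 * x - \<tau>))) * theta_ml m l (x - \<tau>) \<tau>"
    unfolding exp_minus .
  show ?thesis unfolding e by simp
qed

lemma Im_S: "Im (- 1 / \<tau>) = Im \<tau> / (cmod \<tau>)\<^sup>2"
  by (simp add: Im_divide cmod_power2)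

lemma Im_S_pos: assumes "Im \<tau> > 0" shows "Im (- 1 / \<tau>) > 0"
proof -
  have "\<tau> \<noteq> 0" using assms by auto
  thus ?thesis unfolding Im_S using assms by simp
qed

lemma csqrt_upper_half:
  assumes "Im \<tau> > 0"
  shows "Re (csqrt (- \<i> * \<tau>)) > 0" "csqrt (- \<i> * \<tau>) \<noteq> 0"
proof -
  define c where "c = csqrt (- \<i> * \<tau>)"
  have c: "c ^ 2 = - \<i> * \<tau>" by (simp add: c_def)
  have "Im \<tau> = Re (c ^ 2)" unfolding c by simp
  also have "\<dots> = (Re c)\<^sup>2 - (Im c)\<^sup>2" by (rule Re_power2)
  finally have "(Re c)\<^sup>2 > 0" using assms zero_le_power2[of "Im c"] by linarith
  hence "Re c \<noteq> 0" by auto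
  moreover have "Re c \<ge> 0" unfolding c_def by (rule Re_csqrt)
  ultimately have "Re c > 0" by linarith
  thus "Re (csqrt (- \<i> * \<tau>)) > 0" "csqrt (- \<i> * \<tau>) \<noteq> 0" unfolding c_def by auto
qed

text \<open>The integral over a period unfolds into a telescoping sum of values of E, whose limits at infinity in the sector are 1 and -1.\<close>
lemma theta_ml_S_fourier:
  fixes \<tau> :: complex
  assumes m: "m > 0" and \<tau>: "Im \<tau> > 0"
  shows "contour_integral (linepath 0 (0 + 1)) (\<lambda>v. (exp (- 2 * pi * \<i> * of_nat m * v ^ 2 / \<tau>) * theta_ml m l (v / \<tau>) (- 1 / \<tau>)) * exp (- 2 * pi * \<i> * of_int \<nu> * v))
    = csqrt (- \<i> * \<tau>) / of_real (sqrt (2 * real m)) * exp (pi * \<i> * of_int \<nu> ^ 2 * \<tau> / (2 * of_nat m) - pi * \<i> * of_int \<nu> * of_int l / of_nat m)"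
    (is "?I = _ / _ * ?K")
proof -
  have t0: "\<tau> \<noteq> 0" using \<tau> by auto
  have \<tau>': "Im (- 1 / \<tau>) > 0" by (rule Im_S_pos[OF \<tau>])
  define q where "q = csqrt (- \<i> * \<tau>)"
  have q: "Re q > 0" "q \<noteq> 0" "q ^ 2 = - \<i> * \<tau>" using csqrt_upper_half[OF \<tau>] by (auto simp: q_def)
  \<comment> \<open>The square root of 2 m \<i> / \<tau> with positive real part. Its square has
    positive real part as well, so E(a x) tends to 1 and -1 at the two ends of the real
    axis.\<close>
  define a where "a = of_real (sqrt (2 * real m)) / q"
  have a2: "a ^ 2 = 2 * \<i> * of_nat m / \<tau>"
  proof -
    have "complex_of_real (sqrt (2 * real m)) ^ 2 = 2 * of_nat m" unfolding of_real_power[symmetric] by simp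
    thus ?thesis unfolding a_def power_divide q(3) using t0 by (simp add: field_simps)
  qed
  have a0: "a \<noteq> 0" using q m by (simp add: a_def)
  have aRe: "Re a > 0"
  proof -
    have "Re a = sqrt (2 * real m) * (Re q / (cmod q)\<^sup>2)"
      unfolding a_def by (simp add: Re_divide cmod_power2)
    thus ?thesis using q m by simp
  qed
  have aRe2: "Re (a ^ 2) > 0"
  proof -
    have "Re (a ^ 2) = 2 * real m * (Im \<tau> / (cmod \<tau>)\<^sup>2)"
      unfolding a2 by (simp add: Re_divide cmod_power2)
    thus ?thesis using \<tau> m t0 by simp
  qed
  \<comment> \<open>Completing the square in v centres the Gaussian of the term n = 2 m k + l at k -
    \<beta>; the leftover cross term is an integer multiple of 2 pi \<i>.\<close>
  define \<beta> where "\<beta> = (of_int \<nu> * \<tau> - of_int l) / (2 * of_nat m)"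
  define \<Psi> where "\<Psi> j = E_entire (a * (of_int j + \<beta>))" for j :: int
  let ?t = "\<lambda>n v. theta_term m (- 1 / \<tau>) n (v / \<tau>) * (exp (- 2 * pi * \<i> * of_nat m * v ^ 2 / \<tau>) * exp (- 2 * pi * \<i> * of_int \<nu> * v))"
  have summand: "?t (2 * int m * k + l) v = ?K * exp (- pi * (a * (v + (\<beta> - of_int k))) ^ 2)" for k v
  proof -
    have e: "pi * \<i> * of_int (2 * int m * k + l) ^ 2 * (- 1 / \<tau>) / (2 * of_nat m) + 2 * pi * \<i> * of_int (2 * int m * k + l) * (v / \<tau>)
      + (- 2 * pi * \<i> * of_nat m * v ^ 2 / \<tau> + - 2 * pi * \<i> * of_int \<nu> * v) =
      (pi * \<i> * of_int \<nu> ^ 2 * \<tau> / (2 * of_nat m) - pi * \<i> * of_int \<nu> * of_int l / of_nat m) + - pi * (a ^ 2 * (v + (\<beta> - of_int k)) ^ 2) + 2 * of_real pi * \<i> * of_int (- \<nu> * k)"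
      unfolding a2 \<beta>_def using m t0 by (simp add: field_simps power2_eq_square)
    show ?thesis unfolding theta_term_def exp_add[symmetric] power_mult_distrib
      by (rule exp_eq_int_shift) (rule e)
  qed
  have int: "contour_integral (linepath 0 (0 + 1)) (?t (2 * int m * k + l)) = ?K / (2 * a) * (\<Psi> (1 - k) - \<Psi> (- k))" for k
  proof -
    let ?P = "\<lambda>v. ?K * (E_entire (a * (v + (\<beta> - of_int k))) / (2 * a))"
    have arg: "((\<lambda>v. a * (v + (\<beta> - of_int k))) has_field_derivative a) (at v)" for v
      by (auto intro!: derivative_eq_intros)
    have "(?P has_field_derivative ?K * (2 * exp (- pi * (a * (v + (\<beta> - of_int k))) ^ 2) * a / (2 * a))) (at v)" for v
      by (intro DERIV_cmult DERIV_cdivide DERIV_chain2[OF E_entire_deriv arg])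
    hence "(?P has_field_derivative ?t (2 * int m * k + l) v) (at v within UNIV)" for v
      unfolding summand using a0 by simp
    hence "(?t (2 * int m * k + l) has_contour_integral (?P (0 + 1) - ?P 0)) (linepath 0 (0 + 1))"
      using contour_integral_primitive[of UNIV ?P "?t (2 * int m * k + l)" "linepath 0 (0 + 1)"] by simp
    from contour_integral_unique[OF this] show ?thesis
      by (simp add: \<Psi>_def algebra_simps diff_divide_distrib)
  qed
  have "((\<lambda>n. contour_integral (linepath 0 (0 + 1)) (?t n)) has_sum contour_integral (linepath 0 (0 + 1)) (\<lambda>v. \<Sum>\<^sub>\<infinity>n\<in>rclass m l. ?t n v)) (rclass m l)"
  proof (rule dominated_on_contour_integral[of UNIV])
    show "dominated_on UNIV (rclass m l) ?t"
      using t0 by (intro dominated_on_mult_continuous dominated_on_slice[OF theta_term_dominated[OF m \<tau>']] continuous_intros) auto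
    show "continuous_on UNIV (?t n)" for n
      using t0 by (intro continuous_intros continuous_on_compose2[OF theta_term_continuous[of UNIV]]) auto
  qed auto
  also have "(\<lambda>v. \<Sum>\<^sub>\<infinity>n\<in>rclass m l. ?t n v) = (\<lambda>v. (exp (- 2 * pi * \<i> * of_nat m * v ^ 2 / \<tau>) * theta_ml m l (v / \<tau>) (- 1 / \<tau>)) * exp (- 2 * pi * \<i> * of_int \<nu> * v))"
    unfolding theta_ml_eq infsum_cmult_left' by (simp add: mult_ac)
  finally have "((\<lambda>n. contour_integral (linepath 0 (0 + 1)) (?t n)) has_sum ?I) (rclass m l)" .
  hence "((\<lambda>k. contour_integral (linepath 0 (0 + 1)) (?t (2 * int m * k + l))) has_sum ?I) UNIV"
    unfolding has_sum_reindex_bij_betw[OF bij_betw_rclass[OF m], of "\<lambda>n. contour_integral (linepath 0 (0 + 1)) (?t n)"] .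
  hence s: "((\<lambda>k. ?K / (2 * a) * (\<Psi> (1 - k) - \<Psi> (- k))) has_sum ?I) UNIV" unfolding int .
  \<comment> \<open>Reversing the index puts the differences of \<Psi> into increasing order, so
    that symmetric partial sums telescope.\<close>
  have bij: "bij_betw (\<lambda>j::int. - j) UNIV UNIV" by (rule bij_betwI[where g = uminus]) auto
  have "((\<lambda>j. ?K / (2 * a) * (\<Psi> (1 - (- j)) - \<Psi> (- (- j)))) has_sum ?I) UNIV"
    using s unfolding has_sum_reindex_bij_betw[OF bij, of "\<lambda>k. ?K / (2 * a) * (\<Psi> (1 - k) - \<Psi> (- k))"] .
  hence "((\<lambda>j. ?K / (2 * a) * (\<Psi> (j + 1) - \<Psi> j)) has_sum ?I) UNIV" by (simp add: add.commute)
  from has_sum_int_imp_tendsto[OF this]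
  have l1: "(\<lambda>N. ?K / (2 * a) * (\<Psi> (int N) - \<Psi> (- int N))) \<longlonglongrightarrow> ?I"
    unfolding sum_distrib_left[symmetric] telescope_int .
  have "(\<lambda>N. E_entire (a * of_real (real N) + a * \<beta>)) \<longlonglongrightarrow> 1"
    using filterlim_compose[OF E_entire_tendsto_1[OF aRe aRe2, of "a * \<beta>"] filterlim_real_sequentially] .
  moreover have "(\<lambda>N. E_entire (- a * of_real (real N) + a * \<beta>)) \<longlonglongrightarrow> - 1"
    using filterlim_compose[OF E_entire_tendsto_minus_1[OF aRe aRe2, of "a * \<beta>"] filterlim_real_sequentially] .
  ultimately have "(\<lambda>N. ?K / (2 * a) * (E_entire (a * of_real (real N) + a * \<beta>) - E_entire (- a * of_real (real N) + a * \<beta>))) \<longlonglongrightarrow> ?K / (2 * a) * (1 - (- 1))"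
    by (intro tendsto_intros)
  hence "(\<lambda>N. ?K / (2 * a) * (\<Psi> (int N) - \<Psi> (- int N))) \<longlonglongrightarrow> ?K / (2 * a) * (1 - (- 1))"
    unfolding \<Psi>_def by (simp add: algebra_simps)
  from LIMSEQ_unique[OF l1 this] show ?thesis unfolding a_def q_def[symmetric] using q m by (simp add: field_simps)
qed

lemma elliptic_meromorphic_entire:
  assumes "m > 0" "Im \<tau> > 0" and hol: "G holomorphic_on UNIV"
    and E: "\<And>z n \<mu>. G (z + of_int n * \<tau> + of_int \<mu>) = exp (- 2 * pi * \<i> * of_nat m * (of_int n ^ 2 * \<tau> + 2 * of_int n * z)) * G z"
  shows "elliptic_meromorphic m \<tau> G" "\<not> is_pole G z"
proof -
  have c: "isCont G z" for z using hol holomorphic_on_imp_continuous_on continuous_on_eq_continuous_at by blast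
  show "\<not> is_pole G z"
    using c[of z] not_tendsto_and_filterlim_at_infinity[OF at_neq_bot, of G "G z" z] by (auto simp: isCont_def is_pole_def)
  have "G meromorphic_on UNIV" using hol by (intro analytic_on_imp_meromorphic_on) (simp add: analytic_on_open)
  thus "elliptic_meromorphic m \<tau> G" using assms c by unfold_locales auto
qed

text \<open>After division by a Gaussian, theta at (z / \<tau>, -1/\<tau>) is an entire function of
  z that satisfies the elliptic law for \<tau>, the two periods having exchanged their roles. Its
  expansion has no pole terms, and the coefficients are the integrals of
  \<open>theta_ml_S_fourier\<close>; the unfolding of that integral takes the place of Poisson
  summation.\<close>

lemma theta_ml_S:
  fixes \<tau> z :: complex
  assumes m: "m > 0" and \<tau>: "Im \<tau> > 0"
  shows "theta_ml m l (z / \<tau>) (- 1 / \<tau>) = csqrt (- \<i> * \<tau>) / of_real (sqrt (2 * real m)) * exp (2 * pi * \<i> * of_nat m * z ^ 2 / \<tau>)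
     * (\<Sum>\<nu>\<in>{0..<2 * int m}. exp (- pi * \<i> * of_int l * of_int \<nu> / of_nat m) * theta_ml m \<nu> z \<tau>)"
proof -
  have t0: "\<tau> \<noteq> 0" using \<tau> by auto
  have \<tau>': "Im (- 1 / \<tau>) > 0" by (rule Im_S_pos[OF \<tau>])
  define G where "G v = exp (- 2 * pi * \<i> * of_nat m * v ^ 2 / \<tau>) * theta_ml m l (v / \<tau>) (- 1 / \<tau>)" for v :: complex
  have hol: "G holomorphic_on UNIV" unfolding G_def[abs_def] using t0 by (intro holomorphic_intros m \<tau>') auto
  have G1: "G (v + 1) = G v" for v
  proof -
    have s: "(v + 1) / \<tau> = v / \<tau> - (- 1 / \<tau>)" by (simp add: add_divide_distrib)
    have "theta_ml m l ((v + 1) / \<tau>) (- 1 / \<tau>) = exp (2 * pi * \<i> * of_nat m * (2 * (v / \<tau>) - (- 1 / \<tau>))) * theta_ml m l (v / \<tau>) (- 1 / \<tau>)"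
      unfolding s by (rule theta_ml_minus_tau[OF m])
    moreover have "exp (- 2 * pi * \<i> * of_nat m * (v + 1) ^ 2 / \<tau>) * exp (2 * pi * \<i> * of_nat m * (2 * (v / \<tau>) - (- 1 / \<tau>))) = exp (- 2 * pi * \<i> * of_nat m * v ^ 2 / \<tau>)"
      unfolding exp_add[symmetric] using t0 by (intro arg_cong[of _ _ exp]) (simp add: field_simps power2_eq_square)
    ultimately show ?thesis unfolding G_def by (simp add: mult.assoc[symmetric])
  qed
  have E: "G (v + of_int n * \<tau> + of_int \<mu>) = exp (- 2 * pi * \<i> * of_nat m * (of_int n ^ 2 * \<tau> + 2 * of_int n * v)) * G v" for v n \<mu>
  proof -
    have "G (v + of_int n * \<tau> + of_int \<mu>) = G (v + of_int n * \<tau>)" by (rule periodic_of_int[where g = G]) (rule G1)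
    also have "theta_ml m l ((v + of_int n * \<tau>) / \<tau>) (- 1 / \<tau>) = theta_ml m l (v / \<tau>) (- 1 / \<tau>)"
      using periodic_of_int[of "\<lambda>x. theta_ml m l x (- 1 / \<tau>)" "v / \<tau>" n] theta_ml_plus_1 t0 by (simp add: add_divide_distrib)
    hence "G (v + of_int n * \<tau>) = exp (- 2 * pi * \<i> * of_nat m * (v + of_int n * \<tau>) ^ 2 / \<tau>) * theta_ml m l (v / \<tau>) (- 1 / \<tau>)"
      unfolding G_def by simp
    also have "exp (- 2 * pi * \<i> * of_nat m * (v + of_int n * \<tau>) ^ 2 / \<tau>) =
       exp (- 2 * pi * \<i> * of_nat m * (of_int n ^ 2 * \<tau> + 2 * of_int n * v)) * exp (- 2 * pi * \<i> * of_nat m * v ^ 2 / \<tau>)"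
      unfolding exp_add[symmetric] using t0 by (intro arg_cong[of _ _ exp]) (simp add: field_simps power2_eq_square)
    finally show ?thesis by (simp add: G_def)
  qed
  interpret elliptic_meromorphic m \<tau> G by (rule elliptic_meromorphic_entire(1)[OF m \<tau> hol E])
  have np: "\<not> is_pole G v" for v by (rule elliptic_meromorphic_entire(2)[OF m \<tau> hol E])
  have "G z = (\<Sum>\<nu>\<in>{0..<2 * int m}. h_val \<nu> * theta_ml m \<nu> z \<tau>)"
    using formula[of z "{}"] np by simp
  also have "\<dots> = (\<Sum>\<nu>\<in>{0..<2 * int m}. csqrt (- \<i> * \<tau>) / of_real (sqrt (2 * real m)) * (exp (- pi * \<i> * of_int l * of_int \<nu> / of_nat m) * theta_ml m \<nu> z \<tau>))"
  proof (intro sum.cong refl)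
    fix \<nu> assume \<nu>: "\<nu> \<in> {0..<2 * int m}"
    have "h_val \<nu> = h_par \<nu> 0" by (rule h_val_eq) (use \<nu> np in \<open>auto simp: good_def\<close>)
    also have "\<dots> = exp (- pi * \<i> * of_int \<nu> ^ 2 * \<tau> / (2 * of_nat m)) * (csqrt (- \<i> * \<tau>) / of_real (sqrt (2 * real m)) * exp (pi * \<i> * of_int \<nu> ^ 2 * \<tau> / (2 * of_nat m) - pi * \<i> * of_int \<nu> * of_int l / of_nat m))"
    proof -
      have p: "poles = {}" using np by auto
      show ?thesis unfolding h_par_def p Int_empty_left sum.empty mult_zero_right diff_zero
        by (simp only: G_def theta_ml_S_fourier[OF m \<tau>, of l \<nu>])
    qed
    also have "\<dots> = csqrt (- \<i> * \<tau>) / of_real (sqrt (2 * real m)) * (exp (- pi * \<i> * of_int \<nu> ^ 2 * \<tau> / (2 * of_nat m)) * exp (pi * \<i> * of_int \<nu> ^ 2 * \<tau> / (2 * of_nat m) - pi * \<i> * of_int \<nu> * of_int l / of_nat m))"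
      by (simp only: mult_ac)
    also have "exp (- pi * \<i> * of_int \<nu> ^ 2 * \<tau> / (2 * of_nat m)) * exp (pi * \<i> * of_int \<nu> ^ 2 * \<tau> / (2 * of_nat m) - pi * \<i> * of_int \<nu> * of_int l / of_nat m) = exp (- pi * \<i> * of_int l * of_int \<nu> / of_nat m)"
      unfolding exp_add[symmetric] by (intro arg_cong[of _ _ exp]) (simp add: mult_ac)
    finally show "h_val \<nu> * theta_ml m \<nu> z \<tau> = csqrt (- \<i> * \<tau>) / of_real (sqrt (2 * real m)) * (exp (- pi * \<i> * of_int l * of_int \<nu> / of_nat m) * theta_ml m \<nu> z \<tau>)"
      by (simp only: mult.assoc)
  qed
  finally have Gz: "G z = csqrt (- \<i> * \<tau>) / of_real (sqrt (2 * real m)) * (\<Sum>\<nu>\<in>{0..<2 * int m}. exp (- pi * \<i> * of_int l * of_int \<nu> / of_nat m) * theta_ml m \<nu> z \<tau>)"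
    by (simp only: sum_distrib_left)
  have "theta_ml m l (z / \<tau>) (- 1 / \<tau>) = exp (2 * pi * \<i> * of_nat m * z ^ 2 / \<tau>) * G z"
    unfolding G_def by (simp add: mult.assoc[symmetric] flip: exp_add)
  thus ?thesis unfolding Gz by (simp only: mult_ac)
qed

section \<open>Finite Fourier inversion and the theta kernel\<close>

lemma sum_exp_orthogonal:
  assumes m: "m > 0"
  shows "(\<Sum>l\<in>{0..<2 * int m}. exp (- pi * \<i> * of_int l * of_int k / of_nat m)) = (if 2 * int m dvd k then 2 * of_nat m else 0)"
proof -
  define w where "w = - pi * \<i> * of_int k / of_nat m"
  have t: "exp (- pi * \<i> * of_int l * of_int k / of_nat m) = exp (of_int l * w)" for l
    by (simp add: w_def mult_ac)
  have e2: "exp (2 * of_nat m * w) = 1"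
  proof -
    have "2 * of_nat m * w = 0 + 2 * of_real pi * \<i> * of_int (- k)" using m by (simp add: w_def)
    from exp_eq_int_shift[OF this] show ?thesis by simp
  qed
  show ?thesis
  proof (cases "2 * int m dvd k")
    case True
    then obtain j where k: "k = 2 * int m * j" by blast
    have "exp (of_int l * w) = 1" for l
    proof -
      have "of_int l * w = 0 + 2 * of_real pi * \<i> * of_int (- l * j)" using m by (simp add: w_def k)
      from exp_eq_int_shift[OF this] show ?thesis by simp
    qed
    thus ?thesis using True unfolding t by simp
  next
    case False
    have "exp w \<noteq> 1"
    proof
      assume "exp w = 1"
      then obtain n :: int where "Im w = of_int (2 * n) * pi" unfolding exp_eq_1 by blast
      moreover have "w = of_real (- pi * real_of_int k / real m) * \<i>" by (simp add: w_def)
      hence "Im w = - pi * real_of_int k / real m" by simp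
      ultimately have "pi * (- real_of_int k) = pi * (2 * real m * real_of_int n)" using m by (simp add: field_simps)
      hence "- real_of_int k = 2 * real m * real_of_int n" using pi_neq_zero mult_cancel_left by blast
      hence "real_of_int k = real_of_int (2 * int m * (- n))" by simp
      hence "k = 2 * int m * (- n)" unfolding of_int_eq_iff .
      thus False using False by simp
    qed
    from sum_exp_geometric[OF this, of m] show ?thesis using False unfolding t e2 by simp
  qed
qed

lemma dft_inverse:
  assumes m: "m > 0" and b: "\<And>\<nu>. 0 \<le> \<nu> \<Longrightarrow> \<nu> < 2 * int m \<Longrightarrow> b \<nu> = (\<Sum>l\<in>{0..<2 * int m}. exp (- pi * \<i> * of_int l * of_int \<nu> / of_nat m) * a l)"
    and l: "0 \<le> l" "l < 2 * int m"
  shows "a l = (\<Sum>\<nu>\<in>{0..<2 * int m}. exp (pi * \<i> * of_int l * of_int \<nu> / of_nat m) * b \<nu>) / (2 * of_nat m)"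
proof -
  let ?L = "{0..<2 * int m}"
  have "(\<Sum>\<nu>\<in>?L. exp (pi * \<i> * of_int l * of_int \<nu> / of_nat m) * b \<nu>)
     = (\<Sum>\<nu>\<in>?L. \<Sum>j\<in>?L. exp (- pi * \<i> * of_int \<nu> * of_int (j - l) / of_nat m) * a j)"
  proof (intro sum.cong refl)
    fix \<nu> assume \<nu>: "\<nu> \<in> ?L"
    have "exp (pi * \<i> * of_int l * of_int \<nu> / of_nat m) * exp (- pi * \<i> * of_int j * of_int \<nu> / of_nat m) = exp (- pi * \<i> * of_int \<nu> * of_int (j - l) / of_nat m)" for j
      unfolding exp_add[symmetric] using m by (intro arg_cong[of _ _ exp]) (simp add: field_simps)
    thus "exp (pi * \<i> * of_int l * of_int \<nu> / of_nat m) * b \<nu> = (\<Sum>j\<in>?L. exp (- pi * \<i> * of_int \<nu> * of_int (j - l) / of_nat m) * a j)"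
      using b[of \<nu>] \<nu> by (simp add: sum_distrib_left mult.assoc[symmetric])
  qed
  also have "\<dots> = (\<Sum>j\<in>?L. (\<Sum>\<nu>\<in>?L. exp (- pi * \<i> * of_int \<nu> * of_int (j - l) / of_nat m)) * a j)"
    by (subst sum.swap) (simp add: sum_distrib_right)
  also have "\<dots> = (\<Sum>j\<in>?L. if j = l then 2 * of_nat m * a l else 0)"
  proof (intro sum.cong refl)
    fix j assume j: "j \<in> ?L"
    have "2 * int m dvd j - l \<longleftrightarrow> j = l"
      using j l by (auto dest: mod_eq_dvd_iff[THEN iffD2])
    thus "(\<Sum>\<nu>\<in>?L. exp (- pi * \<i> * of_int \<nu> * of_int (j - l) / of_nat m)) * a j = (if j = l then 2 * of_nat m * a l else 0)"
      unfolding sum_exp_orthogonal[OF m] by simp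
  qed
  also have "\<dots> = 2 * of_nat m * a l" using l by (subst sum.delta) auto
  finally show ?thesis using m by simp
qed

lemma theta_ml_cong: "l mod (2 * int m) = l' mod (2 * int m) \<Longrightarrow> theta_ml m l z \<tau> = theta_ml m l' z \<tau>"
  unfolding theta_ml_def by simp

text \<open>Up to an elementary factor this is the w-derivative of \<open>F_pol\<close>, which is
  why its inversion formula is needed.\<close>

definition theta_kernel :: "nat \<Rightarrow> complex \<Rightarrow> complex \<Rightarrow> complex \<Rightarrow> complex" where
  "theta_kernel m z w \<tau> = (\<Sum>l\<in>{0..<2 * int m}. theta_ml m l z \<tau> * theta_ml m l (- w) (- cnj \<tau>))"

text \<open>Since - \<i> \<tau> has positive real part it avoids the branch cut, so the second root
  is the conjugate of the first.\<close>

lemma csqrt_times_cnj: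
  assumes "Im \<tau> > 0"
  shows "csqrt (- \<i> * \<tau>) * csqrt (- \<i> * (- cnj \<tau>)) = of_real (cmod \<tau>)"
proof -
  have "- \<i> * (- cnj \<tau>) = cnj (- \<i> * \<tau>)" by simp
  moreover have "- \<i> * \<tau> \<notin> \<real>\<^sub>\<le>\<^sub>0" using assms by (auto simp: complex_nonpos_Reals_iff)
  ultimately have "csqrt (- \<i> * (- cnj \<tau>)) = cnj (csqrt (- \<i> * \<tau>))" using cnj_csqrt by metis
  hence "csqrt (- \<i> * \<tau>) * csqrt (- \<i> * (- cnj \<tau>)) = of_real ((cmod (csqrt (- \<i> * \<tau>)))\<^sup>2)"
    unfolding complex_norm_square by simp
  also have "(cmod (csqrt (- \<i> * \<tau>)))\<^sup>2 = cmod \<tau>" unfolding norm_csqrt by (simp add: norm_mult)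
  finally show ?thesis .
qed

text \<open>Both theta functions are inverted separately. Writing the second expansion with - \<mu>
  and - w keeps the shape of the kernel, and orthogonality in l leaves only the pairs with \<nu> +
  \<mu> divisible by 2m, which reassemble the kernel. The two square roots multiply to
  \<open>cmod \<tau>\<close>.\<close>

lemma theta_kernel_S:
  fixes z w \<tau> :: complex
  assumes m: "m > 0" and \<tau>: "Im \<tau> > 0"
  shows "theta_kernel m (z / \<tau>) (w / cnj \<tau>) (- 1 / \<tau>) = of_real (cmod \<tau>) * exp (2 * pi * \<i> * of_nat m * (z ^ 2 / \<tau> - w ^ 2 / cnj \<tau>)) * theta_kernel m z w \<tau>"
proof -
  let ?L = "{0..<2 * int m}"
  define t where "t = - cnj \<tau>"
  have t: "Im t > 0" using \<tau> by (simp add: t_def)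
  define c d where "c = csqrt (- \<i> * \<tau>) / of_real (sqrt (2 * real m)) * exp (2 * pi * \<i> * of_nat m * z ^ 2 / \<tau>)"
    and "d = csqrt (- \<i> * t) / of_real (sqrt (2 * real m)) * exp (2 * pi * \<i> * of_nat m * w ^ 2 / t)"
  define e where "e l \<nu> = exp (- pi * \<i> * of_int l * of_int \<nu> / of_nat m)" for l \<nu> :: int
  have A: "theta_ml m l (z / \<tau>) (- 1 / \<tau>) = c * (\<Sum>\<nu>\<in>?L. e l \<nu> * theta_ml m \<nu> z \<tau>)" for l
    unfolding c_def e_def by (rule theta_ml_S[OF m \<tau>])
  have B: "theta_ml m l (- (w / cnj \<tau>)) (- cnj (- 1 / \<tau>)) = d * (\<Sum>\<mu>\<in>?L. e l \<mu> * theta_ml m (- \<mu>) (- w) t)" for l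
  proof -
    have "- (w / cnj \<tau>) = w / t" "- cnj (- 1 / \<tau>) = - 1 / t" by (simp_all add: t_def)
    hence "theta_ml m l (- (w / cnj \<tau>)) (- cnj (- 1 / \<tau>)) = theta_ml m l (w / t) (- 1 / t)" by (simp only:)
    also have "\<dots> = d * (\<Sum>\<mu>\<in>?L. e l \<mu> * theta_ml m \<mu> w t)"
      unfolding d_def e_def by (rule theta_ml_S[OF m t])
    also have "(\<Sum>\<mu>\<in>?L. e l \<mu> * theta_ml m \<mu> w t) = (\<Sum>\<mu>\<in>?L. e l \<mu> * theta_ml m (- \<mu>) (- w) t)"
      using theta_ml_minus[of m _ "- w" t] by simp
    finally show ?thesis .
  qed
  have ee: "e l \<nu> * e l \<mu> = exp (- pi * \<i> * of_int l * of_int (\<nu> + \<mu>) / of_nat m)" for l \<nu> \<mu>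
    unfolding e_def exp_add[symmetric] using m by (intro arg_cong[of _ _ exp]) (simp add: field_simps)
  have "theta_kernel m (z / \<tau>) (w / cnj \<tau>) (- 1 / \<tau>) = (\<Sum>l\<in>?L. (c * (\<Sum>\<nu>\<in>?L. e l \<nu> * theta_ml m \<nu> z \<tau>)) * (d * (\<Sum>\<mu>\<in>?L. e l \<mu> * theta_ml m (- \<mu>) (- w) t)))"
    unfolding theta_kernel_def A B ..
  also have "\<dots> = c * d * (\<Sum>l\<in>?L. \<Sum>\<nu>\<in>?L. \<Sum>\<mu>\<in>?L. e l \<nu> * e l \<mu> * (theta_ml m \<nu> z \<tau> * theta_ml m (- \<mu>) (- w) t))"
  proof -
    have "(c * A) * (d * B) = c * d * (A * B)" for A B :: complex by (simp only: mult_ac)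
    moreover have "(\<Sum>\<nu>\<in>?L. e l \<nu> * theta_ml m \<nu> z \<tau>) * (\<Sum>\<mu>\<in>?L. e l \<mu> * theta_ml m (- \<mu>) (- w) t)
        = (\<Sum>\<nu>\<in>?L. \<Sum>\<mu>\<in>?L. e l \<nu> * e l \<mu> * (theta_ml m \<nu> z \<tau> * theta_ml m (- \<mu>) (- w) t))" for l
      unfolding sum_product by (simp only: mult_ac)
    ultimately show ?thesis by (simp only: sum_distrib_left[symmetric])
  qed
  also have "(\<Sum>l\<in>?L. \<Sum>\<nu>\<in>?L. \<Sum>\<mu>\<in>?L. e l \<nu> * e l \<mu> * (theta_ml m \<nu> z \<tau> * theta_ml m (- \<mu>) (- w) t))
     = (\<Sum>\<nu>\<in>?L. \<Sum>\<mu>\<in>?L. (\<Sum>l\<in>?L. e l \<nu> * e l \<mu>) * (theta_ml m \<nu> z \<tau> * theta_ml m (- \<mu>) (- w) t))"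
    unfolding sum_distrib_right by (subst sum.swap, rule sum.cong[OF refl], subst sum.swap) (rule refl)
  also have "\<dots> = (\<Sum>\<nu>\<in>?L. 2 * of_nat m * (theta_ml m \<nu> z \<tau> * theta_ml m \<nu> (- w) t))"
  proof (intro sum.cong refl)
    fix \<nu> assume \<nu>: "\<nu> \<in> ?L"
    \<comment> \<open>The only reduced \<mu> that survives orthogonality against \<nu>; theta at -
      \<mu>0 is theta at \<nu>.\<close>
    define \<mu>0 where "\<mu>0 = (- \<nu>) mod (2 * int m)"
    have \<mu>0: "\<mu>0 \<in> ?L" using m by (auto simp: \<mu>0_def)
    have dv: "2 * int m dvd \<nu> + \<mu> \<longleftrightarrow> \<mu> = \<mu>0" if "\<mu> \<in> ?L" for \<mu>
    proof -
      have "2 * int m dvd \<nu> + \<mu> \<longleftrightarrow> \<mu> mod (2 * int m) = (- \<nu>) mod (2 * int m)"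
        unfolding mod_eq_dvd_iff by (simp add: add.commute)
      thus ?thesis using that by (auto simp: \<mu>0_def)
    qed
    have "(- \<mu>0) mod (2 * int m) = \<nu> mod (2 * int m)" unfolding \<mu>0_def by (simp add: mod_minus_eq)
    hence th: "theta_ml m (- \<mu>0) (- w) t = theta_ml m \<nu> (- w) t" by (rule theta_ml_cong)
    have "(\<Sum>\<mu>\<in>?L. (\<Sum>l\<in>?L. e l \<nu> * e l \<mu>) * (theta_ml m \<nu> z \<tau> * theta_ml m (- \<mu>) (- w) t))
       = (\<Sum>\<mu>\<in>?L. if \<mu> = \<mu>0 then 2 * of_nat m * (theta_ml m \<nu> z \<tau> * theta_ml m (- \<mu>0) (- w) t) else 0)"
      unfolding ee sum_exp_orthogonal[OF m] using dv by (intro sum.cong refl) auto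
    also have "\<dots> = 2 * of_nat m * (theta_ml m \<nu> z \<tau> * theta_ml m \<nu> (- w) t)"
      using \<mu>0 th by (subst sum.delta) auto
    finally show "(\<Sum>\<mu>\<in>?L. (\<Sum>l\<in>?L. e l \<nu> * e l \<mu>) * (theta_ml m \<nu> z \<tau> * theta_ml m (- \<mu>) (- w) t)) = \<dots>" .
  qed
  also have "\<dots> = 2 * of_nat m * theta_kernel m z w \<tau>"
    unfolding theta_kernel_def t_def by (simp add: sum_distrib_left)
  finally have main: "theta_kernel m (z / \<tau>) (w / cnj \<tau>) (- 1 / \<tau>) = c * d * (2 * of_nat m * theta_kernel m z w \<tau>)" .
  have "c * d = (csqrt (- \<i> * \<tau>) * csqrt (- \<i> * t)) / (of_real (sqrt (2 * real m)) * of_real (sqrt (2 * real m)))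
      * (exp (2 * pi * \<i> * of_nat m * z ^ 2 / \<tau>) * exp (2 * pi * \<i> * of_nat m * w ^ 2 / t))"
    by (simp add: c_def d_def)
  also have "csqrt (- \<i> * \<tau>) * csqrt (- \<i> * t) = of_real (cmod \<tau>)" unfolding t_def by (rule csqrt_times_cnj[OF \<tau>])
  also have "of_real (sqrt (2 * real m)) * of_real (sqrt (2 * real m)) = (2 * of_nat m :: complex)"
    unfolding of_real_mult[symmetric] by simp
  also have "exp (2 * pi * \<i> * of_nat m * z ^ 2 / \<tau>) * exp (2 * pi * \<i> * of_nat m * w ^ 2 / t) = exp (2 * pi * \<i> * of_nat m * (z ^ 2 / \<tau> - w ^ 2 / cnj \<tau>))"
    unfolding exp_add[symmetric] t_def by (intro arg_cong[of _ _ exp]) (simp add: algebra_simps)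
  finally show ?thesis unfolding main using m by simp
qed

lemma F_pol_deriv_snd:
  fixes v w z \<tau> :: complex
  assumes m: "m > 0" "Im \<tau> > 0"
  shows "((\<lambda>w. F_pol m v w z \<tau>) has_field_derivative
     \<i> * of_real (sqrt (real m / Im \<tau>)) * exp (pi * of_nat m * (v - w) ^ 2 / of_real (Im \<tau>)) * theta_kernel m z w \<tau>) (at w)"
proof -
  let ?c = "\<i> * of_real (sqrt (real m / Im \<tau>)) * exp (pi * of_nat m * (v - w) ^ 2 / of_real (Im \<tau>))"
  have "((\<lambda>w. F_pol m v w z \<tau>) has_field_derivative
     0 - 1/2 * (\<Sum>l\<in>{0..<2 * int m}. (- 2 * \<i> * of_real (sqrt (real m / Im \<tau>)) * exp (pi * of_nat m * (v - w) ^ 2 / of_real (Im \<tau>)) * theta_ml m l (- w) (- cnj \<tau>)) * theta_ml m l z \<tau>)) (at w)"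
    unfolding F_pol_def by (intro DERIV_diff DERIV_const DERIV_cmult DERIV_sum DERIV_cmult_right R_pol_deriv_snd m)
  also have "(\<Sum>l\<in>{0..<2 * int m}. (- 2 * \<i> * of_real (sqrt (real m / Im \<tau>)) * exp (pi * of_nat m * (v - w) ^ 2 / of_real (Im \<tau>)) * theta_ml m l (- w) (- cnj \<tau>)) * theta_ml m l z \<tau>)
      = - 2 * ?c * theta_kernel m z w \<tau>"
    unfolding theta_kernel_def sum_distrib_left by (intro sum.cong refl) (simp add: mult_ac)
  finally have d: "((\<lambda>w. F_pol m v w z \<tau>) has_field_derivative 0 - 1/2 * (- 2 * ?c * theta_kernel m z w \<tau>)) (at w)" .
  have eq: "0 - 1/2 * (- 2 * ?c * theta_kernel m z w \<tau>) = ?c * theta_kernel m z w \<tau>" by simp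
  from d show ?thesis unfolding eq .
qed

subsection \<open>The inversion formula for the corrected Appell function\<close>

lemma neg_index_entire_zero:
  fixes G :: "complex \<Rightarrow> complex"
  assumes m: "m > 0" and \<tau>: "Im \<tau> > 0" and hol: "G holomorphic_on UNIV"
    and G1: "\<And>v. G (v + 1) = G v" and G2: "\<And>v. G (v + \<tau>) = exp (2 * pi * \<i> * of_nat m * (\<tau> + 2 * v)) * G v"
  shows "G v = 0"
proof -
  define y where "y = Im \<tau>"
  have y: "y > 0" using \<tau> by (simp add: y_def)
  \<comment> \<open>The Gaussian weight compensates the factor in the law for v + \<tau> exactly, so
    N is doubly periodic and bounded by its maximum on one closed parallelogram.\<close>
  define N where "N v = norm (G v) * exp (2 * pi * real m * (Im v)\<^sup>2 / y)" for v
  have N1: "N (v + 1) = N v" for v by (simp add: N_def G1)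
  have N2: "N (v + \<tau>) = N v" for v
  proof -
    have "norm (G (v + \<tau>)) = exp (- 2 * pi * real m * (y + 2 * Im v)) * norm (G v)"
      unfolding G2 norm_mult norm_exp_eq_Re by (simp add: y_def)
    moreover have "exp (- 2 * pi * real m * (y + 2 * Im v)) * exp (2 * pi * real m * (Im (v + \<tau>))\<^sup>2 / y) = exp (2 * pi * real m * (Im v)\<^sup>2 / y)"
      unfolding exp_add[symmetric] using y by (intro arg_cong[of _ _ exp]) (simp add: y_def field_simps power2_eq_square)
    ultimately show ?thesis unfolding N_def by (simp add: mult_ac)
  qed
  have "continuous_on UNIV G" using hol holomorphic_on_imp_continuous_on by blast
  hence "continuous_on (par_closed 0 \<tau>) N"
    unfolding N_def[abs_def] using y by (intro continuous_intros) (auto intro: continuous_on_subset)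
  moreover have "compact (par_closed 0 \<tau>)"
  proof -
    have "par_closed 0 \<tau> = (\<lambda>w. tau_coord \<tau> (w - 0)) -` {0..1} \<inter> (\<lambda>w. one_coord \<tau> (w - 0)) -` {0..1}"
      by (auto simp: par_closed_def)
    hence "closed (par_closed 0 \<tau>)" by (simp add: closed_Int closed_vimage continuous_intros)
    thus ?thesis using bounded_par_closed[OF \<tau>] compact_eq_bounded_closed by blast
  qed
  ultimately have "compact (N ` par_closed 0 \<tau>)" by (rule compact_continuous_image)
  then obtain B where B: "\<And>x. x \<in> par_closed 0 \<tau> \<Longrightarrow> norm (N x) \<le> B"
    using compact_imp_bounded bounded_iff by (metis image_eqI)
  have NB: "N v \<le> B" for v
  proof -
    define a b where "a = \<lfloor>tau_coord \<tau> v\<rfloor>" and "b = \<lfloor>one_coord \<tau> v\<rfloor>"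
    define s where "s = v + of_real (- of_int a) * \<tau> + of_real (- of_int b)"
    have "tau_coord \<tau> (s - 0) = tau_coord \<tau> v - of_int a" "one_coord \<tau> (s - 0) = one_coord \<tau> v - of_int b"
      unfolding diff_zero s_def coord_add_scaled[OF \<tau>] by auto
    hence "0 \<le> tau_coord \<tau> (s - 0)" "tau_coord \<tau> (s - 0) \<le> 1" "0 \<le> one_coord \<tau> (s - 0)" "one_coord \<tau> (s - 0) \<le> 1"
      unfolding a_def b_def by linarith+
    hence "s \<in> par_closed 0 \<tau>" by (simp add: par_closed_def)
    moreover have "N v = N s"
    proof (rule lattice_invariant[where g = N and \<tau> = \<tau>, OF N1 N2])
      have "v - s = of_int a * \<tau> + of_int b" by (simp add: s_def)
      thus "v - s \<in> lattice \<tau>" by (auto simp: lattice_def)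
    qed
    ultimately show ?thesis using B[of s] by simp
  qed
  have GB: "norm (G v) \<le> B * exp (- 2 * pi * real m * (Im v)\<^sup>2 / y)" for v
    using NB[of v] unfolding N_def by (simp add: exp_minus field_simps)
  have B0: "B \<ge> 0" using NB[of 0] unfolding N_def by (smt (verit) norm_ge_zero exp_gt_zero mult_nonneg_nonneg)
  have "norm (G v) \<le> B" for v
  proof -
    have "B * exp (- 2 * pi * real m * (Im v)\<^sup>2 / y) \<le> B * 1" using y B0 by (intro mult_left_mono) auto
    thus ?thesis using GB[of v] by simp
  qed
  hence "bounded (range G)" by (auto simp: bounded_iff)
  from Liouville_theorem[OF hol this] obtain c where c: "\<And>v. G v = c" by (auto simp: constant_on_def)
  \<comment> \<open>G is constant by now, and the Gaussian bound along the imaginary axis forces the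
    constant to be 0.\<close>
  have "((\<lambda>t::real. B * exp (- 2 * pi * real m * t\<^sup>2 / y)) \<longlongrightarrow> 0) at_top"
  proof -
    define k where "k = 2 * pi * real m / y"
    have "k > 0" using m y by (simp add: k_def)
    hence "((\<lambda>t::real. B * exp (- k * t\<^sup>2)) \<longlongrightarrow> 0) at_top" by real_asymp
    thus ?thesis by (simp add: k_def)
  qed
  moreover have "norm c \<le> B * exp (- 2 * pi * real m * t\<^sup>2 / y)" for t :: real
    using GB[of "\<i> * of_real t"] by (simp add: c)
  ultimately have "norm c \<le> 0"
    by (intro tendsto_lowerbound[of _ 0 at_top "norm c"]) auto
  thus ?thesis by (simp add: c)
qed

lemma coset_S_iff:
  assumes "\<tau> \<noteq> 0"
  shows "v / \<tau> \<in> coset (z / \<tau>) (- 1 / \<tau>) \<longleftrightarrow> v \<in> coset z \<tau>"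
proof -
  have *: "v / \<tau> = z / \<tau> + of_int n * (- 1 / \<tau>) + of_int k \<longleftrightarrow> v = z + of_int k * \<tau> + of_int (- n)" for n k :: int
    using assms by (auto simp: field_simps)
  show ?thesis unfolding coset_iff *
  proof safe
    fix n k :: int
    show "\<exists>n' k'. z + of_int n * \<tau> + of_int k = z + of_int k' * \<tau> + of_int (- n')"
      by (intro exI[of _ "- k"] exI[of _ n]) simp
  qed blast
qed

lemma F_pol_minus_tau:
  fixes v w z \<tau> :: complex
  assumes m: "m > 0" "Im \<tau> > 0" and v: "v \<notin> coset z \<tau>"
  shows "F_pol m (v - \<tau>) (w - cnj \<tau>) z \<tau> = exp (- (2 * pi * \<i> * of_nat m * (2 * v - \<tau>))) * F_pol m v w z \<tau>"
proof -
  have "v - \<tau> \<notin> coset z \<tau>"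
  proof
    assume "v - \<tau> \<in> coset z \<tau>"
    moreover have "v \<in> coset (v - \<tau>) \<tau>" unfolding coset_iff by (intro exI[of _ 1] exI[of _ 0]) simp
    ultimately show False using coset_trans v by blast
  qed
  from F_pol_plus_tau[OF m this, of "w - cnj \<tau>"]
  have "F_pol m v w z \<tau> = exp (2 * pi * \<i> * of_nat m * (\<tau> + 2 * (v - \<tau>))) * F_pol m (v - \<tau>) (w - cnj \<tau>) z \<tau>" by simp
  also have "\<tau> + 2 * (v - \<tau>) = 2 * v - \<tau>" by simp
  finally show ?thesis by (simp add: exp_minus)
qed

text \<open>The correction is treated without computing any Mordell-type integral: the difference of
  the two sides does not depend on w, which makes it a function of v alone to which the vanishing
  result for negative index applies.\<close>

lemma F_pol_S:
  fixes v w z \<tau> :: complex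
  assumes m: "m > 0" and \<tau>: "Im \<tau> > 0" and v: "v \<notin> coset z \<tau>"
  shows "F_pol m (v / \<tau>) (w / cnj \<tau>) (z / \<tau>) (- 1 / \<tau>) = \<tau> * exp (2 * pi * \<i> * of_nat m * (z ^ 2 - v ^ 2) / \<tau>) * F_pol m v w z \<tau>"
proof -
  have t0: "\<tau> \<noteq> 0" using \<tau> by auto
  have \<tau>': "Im (- 1 / \<tau>) > 0" by (rule Im_S_pos[OF \<tau>])
  define y where "y = Im \<tau>"
  have y: "y > 0" using \<tau> by (simp add: y_def)
  \<comment> \<open>The inverse of the expected exponential factor; D is then the difference of the
    two sides after division by \<tau> and that factor.\<close>
  define J where "J v = exp (- (2 * pi * \<i> * of_nat m * (z ^ 2 - v ^ 2) / \<tau>))" for v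
  define D where "D v w = J v / \<tau> * F_pol m (v / \<tau>) (w / cnj \<tau>) (z / \<tau>) (- 1 / \<tau>) - F_pol m v w z \<tau>" for v w
  have D_deriv: "((\<lambda>w. D v w) has_field_derivative 0) (at w)" for v w
  proof -
    let ?F' = "\<i> * of_real (sqrt (real m / Im (- 1 / \<tau>))) * exp (pi * of_nat m * (v / \<tau> - w / cnj \<tau>) ^ 2 / of_real (Im (- 1 / \<tau>))) * theta_kernel m (z / \<tau>) (w / cnj \<tau>) (- 1 / \<tau>)"
    have "((\<lambda>w. w / cnj \<tau>) has_field_derivative 1 / cnj \<tau>) (at w)" by (rule DERIV_cdivide[OF DERIV_ident])
    hence d: "((\<lambda>w. D v w) has_field_derivative J v / \<tau> * (?F' * (1 / cnj \<tau>)) -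
        \<i> * of_real (sqrt (real m / Im \<tau>)) * exp (pi * of_nat m * (v - w) ^ 2 / of_real (Im \<tau>)) * theta_kernel m z w \<tau>) (at w)"
      unfolding D_def by (intro DERIV_diff DERIV_cmult DERIV_chain2[OF F_pol_deriv_snd[OF m \<tau>']] F_pol_deriv_snd[OF m \<tau>])
    \<comment> \<open>This factor \<open>cmod \<tau>\<close> and the one from
      \<open>theta_kernel_S\<close> cancel against 1 / \<tau> in D and 1 / cnj \<tau> from the chain
      rule, by \<open>cc\<close>.\<close>
    have s: "sqrt (real m / Im (- 1 / \<tau>)) = cmod \<tau> * sqrt (real m / y)"
    proof -
      have "real m / Im (- 1 / \<tau>) = (cmod \<tau>)\<^sup>2 * (real m / y)" unfolding Im_S y_def[symmetric] by simp
      thus ?thesis by (simp only: real_sqrt_mult real_sqrt_abs abs_norm_cancel)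
    qed
    have cc: "complex_of_real (cmod \<tau>) * of_real (cmod \<tau>) = \<tau> * cnj \<tau>"
      unfolding complex_norm_square[symmetric] by (simp add: power2_eq_square)
    have "cnj \<tau> = \<tau> - 2 * \<i> * of_real y" using complex_diff_cnj[of \<tau>] unfolding y_def by (simp add: algebra_simps)
    hence Y: "of_real y = - \<i> / 2 * (\<tau> - cnj \<tau>)" by simp
    have ne: "\<tau> - cnj \<tau> \<noteq> 0" using y Y by auto
    have Y': "complex_of_real (Im (- 1 / \<tau>)) = of_real y / (\<tau> * cnj \<tau>)"
      unfolding Im_S y_def cc[symmetric] by (simp add: power2_eq_square)
    \<comment> \<open>The identity by which J, the Gaussian at -1/\<tau> and the factor of the theta
      kernel combine to the Gaussian at \<tau>. The z-dependence cancels between J and the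
      kernel.\<close>
    have key: "v ^ 2 / \<tau> - w ^ 2 / cnj \<tau> + (v / \<tau> - w / cnj \<tau>) ^ 2 * (\<tau> * cnj \<tau>) / (\<tau> - cnj \<tau>) = (v - w) ^ 2 / (\<tau> - cnj \<tau>)"
    proof -
      have "cnj \<tau> \<noteq> 0" using t0 by simp
      thus ?thesis using t0 ne by (simp add: divide_simps) (simp add: power2_eq_square algebra_simps)
    qed
    have iY: "pi * of_nat m * X / of_real y = 2 * pi * \<i> * of_nat m * (X / (\<tau> - cnj \<tau>))" for X :: complex
      unfolding Y using ne by (simp add: field_simps)
    have ex: "J v * exp (pi * of_nat m * (v / \<tau> - w / cnj \<tau>) ^ 2 / of_real (Im (- 1 / \<tau>))) * exp (2 * pi * \<i> * of_nat m * (z ^ 2 / \<tau> - w ^ 2 / cnj \<tau>))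
        = exp (pi * of_nat m * (v - w) ^ 2 / of_real y)"
    proof -
      have "pi * of_nat m * (v / \<tau> - w / cnj \<tau>) ^ 2 / of_real (Im (- 1 / \<tau>)) = pi * of_nat m * ((v / \<tau> - w / cnj \<tau>) ^ 2 * (\<tau> * cnj \<tau>)) / of_real y"
        unfolding Y' by simp
      hence "- (2 * pi * \<i> * of_nat m * (z ^ 2 - v ^ 2) / \<tau>) + pi * of_nat m * (v / \<tau> - w / cnj \<tau>) ^ 2 / of_real (Im (- 1 / \<tau>)) + 2 * pi * \<i> * of_nat m * (z ^ 2 / \<tau> - w ^ 2 / cnj \<tau>)
        = 2 * pi * \<i> * of_nat m * (v ^ 2 / \<tau> - w ^ 2 / cnj \<tau> + (v / \<tau> - w / cnj \<tau>) ^ 2 * (\<tau> * cnj \<tau>) / (\<tau> - cnj \<tau>))"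
        unfolding iY by (simp add: ring_distribs diff_divide_distrib)
      also have "\<dots> = pi * of_nat m * (v - w) ^ 2 / of_real y" unfolding key iY ..
      finally show ?thesis unfolding J_def exp_add[symmetric] by simp
    qed
    have "J v / \<tau> * (?F' * (1 / cnj \<tau>)) = (\<i> * of_real (sqrt (real m / y)) * ((of_real (cmod \<tau>) * of_real (cmod \<tau>)) / (\<tau> * cnj \<tau>)))
        * (J v * exp (pi * of_nat m * (v / \<tau> - w / cnj \<tau>) ^ 2 / of_real (Im (- 1 / \<tau>))) * exp (2 * pi * \<i> * of_nat m * (z ^ 2 / \<tau> - w ^ 2 / cnj \<tau>))) * theta_kernel m z w \<tau>"
      unfolding s theta_kernel_S[OF m \<tau>] of_real_mult by (simp add: mult_ac)
    also have "\<dots> = \<i> * of_real (sqrt (real m / Im \<tau>)) * exp (pi * of_nat m * (v - w) ^ 2 / of_real (Im \<tau>)) * theta_kernel m z w \<tau>"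
      unfolding ex cc using t0 by (simp add: y_def)
    finally show ?thesis using d by simp
  qed
  have D_const: "D v w = D v w'" for v w w'
  proof -
    have "\<exists>c. \<forall>w\<in>UNIV. D v w = c"
      by (rule has_field_derivative_zero_constant) (auto intro: D_deriv)
    thus ?thesis by auto
  qed
  have cS: "v / \<tau> \<in> coset (z / \<tau>) (- 1 / \<tau>) \<longleftrightarrow> v \<in> coset z \<tau>" for v by (rule coset_S_iff[OF t0])
  \<comment> \<open>Any fixed w would do. By \<open>D_const\<close> it may be moved along with v, by
    1 or by cnj \<tau>, in the two translation laws below.\<close>
  define g where "g v = D v 0" for v
  have g1: "g (v + 1) = g v" if v: "v \<notin> coset z \<tau>" for v
  proof -
    have "F_pol m ((v + 1) / \<tau>) ((0 + 1) / cnj \<tau>) (z / \<tau>) (- 1 / \<tau>) = F_pol m (v / \<tau> - (- 1 / \<tau>)) (0 / cnj \<tau> - cnj (- 1 / \<tau>)) (z / \<tau>) (- 1 / \<tau>)"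
      by (simp add: add_divide_distrib)
    also have "\<dots> = exp (- (2 * pi * \<i> * of_nat m * (2 * (v / \<tau>) - (- 1 / \<tau>)))) * F_pol m (v / \<tau>) (0 / cnj \<tau>) (z / \<tau>) (- 1 / \<tau>)"
      by (rule F_pol_minus_tau[OF m \<tau>']) (use cS v in blast)
    finally have F: "F_pol m ((v + 1) / \<tau>) ((0 + 1) / cnj \<tau>) (z / \<tau>) (- 1 / \<tau>) = \<dots>" .
    have J: "J (v + 1) * exp (- (2 * pi * \<i> * of_nat m * (2 * (v / \<tau>) - (- 1 / \<tau>)))) = J v"
      unfolding J_def exp_add[symmetric] using t0 by (intro arg_cong[of _ _ exp]) (simp add: field_simps power2_eq_square)
    have "g (v + 1) = D (v + 1) (0 + 1)" unfolding g_def by (rule D_const)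
    also have "\<dots> = (J (v + 1) * exp (- (2 * pi * \<i> * of_nat m * (2 * (v / \<tau>) - (- 1 / \<tau>))))) / \<tau> * F_pol m (v / \<tau>) (0 / cnj \<tau>) (z / \<tau>) (- 1 / \<tau>) - F_pol m v 0 z \<tau>"
      unfolding D_def F F_pol_plus_1 by simp
    also have "\<dots> = g v" unfolding J g_def D_def ..
    finally show ?thesis .
  qed
  have g2: "g (v + \<tau>) = exp (2 * pi * \<i> * of_nat m * (\<tau> + 2 * v)) * g v" if v: "v \<notin> coset z \<tau>" for v
  proof -
    have "(v + \<tau>) / \<tau> = v / \<tau> + 1" "(0 + cnj \<tau>) / cnj \<tau> = 0 / cnj \<tau> + 1" using t0 by (simp_all add: add_divide_distrib)
    hence F: "F_pol m ((v + \<tau>) / \<tau>) ((0 + cnj \<tau>) / cnj \<tau>) (z / \<tau>) (- 1 / \<tau>) = F_pol m (v / \<tau>) (0 / cnj \<tau>) (z / \<tau>) (- 1 / \<tau>)"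
      by (simp only: F_pol_plus_1)
    have J: "J (v + \<tau>) = exp (2 * pi * \<i> * of_nat m * (\<tau> + 2 * v)) * J v"
      unfolding J_def exp_add[symmetric] using t0 by (intro arg_cong[of _ _ exp]) (simp add: field_simps power2_eq_square)
    have "g (v + \<tau>) = D (v + \<tau>) (0 + cnj \<tau>)" unfolding g_def by (rule D_const)
    also have "\<dots> = exp (2 * pi * \<i> * of_nat m * (\<tau> + 2 * v)) * g v"
      unfolding g_def D_def F J F_pol_plus_tau[OF m \<tau> v] by (simp add: algebra_simps)
    finally show ?thesis .
  qed
  have g_hol: "g holomorphic_on - coset z \<tau>"
  proof -
    have "(\<lambda>v. F_pol m (v / \<tau>) (0 / cnj \<tau>) (z / \<tau>) (- 1 / \<tau>)) holomorphic_on - coset z \<tau>"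
      by (rule holomorphic_on_compose_gen[of "\<lambda>v. v / \<tau>" _ "\<lambda>v. F_pol m v (0 / cnj \<tau>) (z / \<tau>) (- 1 / \<tau>)", unfolded o_def, OF _ F_pol_holomorphic[OF m \<tau>']])
         (use cS t0 in \<open>auto intro!: holomorphic_intros\<close>)
    thus ?thesis unfolding g_def[abs_def] D_def J_def using t0
      by (intro holomorphic_intros F_pol_holomorphic[OF m \<tau>]) auto
  qed
  \<comment> \<open>Both Appell functions have residue 1 / (2 pi \<i>) at their pole, the rescaling
    by \<tau> is matched by the factor 1 / \<tau> in D, and J z = 1, so the simple poles at z
    cancel.\<close>
  have lim: "((\<lambda>v. (v - z) * g v) \<longlongrightarrow> 0) (at z)"
  proof -
    have "filterlim (\<lambda>v. v / \<tau>) (at (z / \<tau>)) (at z)"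
      using t0 by (intro filterlim_atI tendsto_intros) (auto simp: eventually_at_filter)
    from filterlim_compose[OF F_pol_residue_limit[OF m \<tau>', of "z / \<tau>" "0 / cnj \<tau>"] this]
    have "((\<lambda>v. (v / \<tau> - z / \<tau>) * F_pol m (v / \<tau>) (0 / cnj \<tau>) (z / \<tau>) (- 1 / \<tau>)) \<longlongrightarrow> 1 / (2 * pi * \<i>)) (at z)" .
    moreover have "(J \<longlongrightarrow> J z) (at z)" unfolding J_def[abs_def] using t0 by (intro tendsto_intros)
    ultimately have "((\<lambda>v. J v * ((v / \<tau> - z / \<tau>) * F_pol m (v / \<tau>) (0 / cnj \<tau>) (z / \<tau>) (- 1 / \<tau>)) - (v - z) * F_pol m v 0 z \<tau>) \<longlongrightarrow> J z * (1 / (2 * pi * \<i>)) - 1 / (2 * pi * \<i>)) (at z)"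
      by (intro tendsto_intros F_pol_residue_limit m \<tau>)
    moreover have "J v * ((v / \<tau> - z / \<tau>) * F_pol m (v / \<tau>) (0 / cnj \<tau>) (z / \<tau>) (- 1 / \<tau>)) - (v - z) * F_pol m v 0 z \<tau> = (v - z) * g v" for v
      unfolding g_def D_def using t0 by (simp add: diff_divide_distrib[symmetric] right_diff_distrib mult_ac)
    moreover have "J z = 1" by (simp add: J_def)
    ultimately show ?thesis by simp
  qed
  have oA: "open (- (coset z \<tau> - {c}))" for c
    by (rule open_Compl, rule sparse_in_UNIV_imp_closed, rule sparse_in_subset2[OF coset_sparse[OF \<tau>]]) auto
  have g_hol': "g holomorphic_on - (coset z \<tau> - {c}) - {c}" for c
    by (rule holomorphic_on_subset[OF g_hol]) auto
  have ev: "\<forall>\<^sub>F v in at c. v \<notin> coset z \<tau>" for c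
    by (rule sparse_imp_eventually_not_in[OF coset_sparse[OF \<tau>]])
  \<comment> \<open>The singularity at z is removable, and the translation laws carry this to the
    whole coset. Transporting only the existence of a limit avoids tracking its value.\<close>
  have ex_lim: "\<exists>L. (g \<longlongrightarrow> L) (at c)" for c
  proof (cases "c \<in> coset z \<tau>")
    case False
    hence "isCont g c" using g_hol holomorphic_on_imp_continuous_on open_Compl_coset[OF \<tau>] continuous_on_eq_continuous_at by blast
    thus ?thesis by (auto simp: isCont_def)
  next
    case True
    have sh: "(g \<longlongrightarrow> L) (at (c + d)) \<longleftrightarrow> ((\<lambda>v. g (v + d)) \<longlongrightarrow> L) (at c)" for L c d
      using filterlim_shift_iff[of g d "nhds L" "c + d"] by (simp add: o_def add.commute)
    have "(\<exists>L. (g \<longlongrightarrow> L) (at c)) = (\<exists>L. (g \<longlongrightarrow> L) (at z))"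
    proof (rule lattice_invariant[where g = "\<lambda>c. \<exists>L. (g \<longlongrightarrow> L) (at c)" and \<tau> = \<tau>])
      show "(\<exists>L. (g \<longlongrightarrow> L) (at (c + 1))) = (\<exists>L. (g \<longlongrightarrow> L) (at c))" for c
      proof -
        have "((\<lambda>v. g (v + 1)) \<longlongrightarrow> L) (at c) \<longleftrightarrow> (g \<longlongrightarrow> L) (at c)" for L
          by (rule tendsto_cong[OF eventually_mono[OF ev]]) (rule g1)
        thus ?thesis unfolding sh by simp
      qed
      show "(\<exists>L. (g \<longlongrightarrow> L) (at (c + \<tau>))) = (\<exists>L. (g \<longlongrightarrow> L) (at c))" for c
      proof
        let ?e = "\<lambda>v. exp (2 * pi * \<i> * of_nat m * (\<tau> + 2 * v))"
        assume "\<exists>L. (g \<longlongrightarrow> L) (at (c + \<tau>))"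
        then obtain L where "((\<lambda>v. g (v + \<tau>)) \<longlongrightarrow> L) (at c)" unfolding sh by blast
        hence "((\<lambda>v. inverse (?e v) * g (v + \<tau>)) \<longlongrightarrow> inverse (?e c) * L) (at c)" by (intro tendsto_intros) auto
        moreover have "\<forall>\<^sub>F v in at c. inverse (?e v) * g (v + \<tau>) = g v"
          by (rule eventually_mono[OF ev]) (simp add: g2)
        ultimately show "\<exists>L. (g \<longlongrightarrow> L) (at c)" using Lim_transform_eventually by blast
      next
        let ?e = "\<lambda>v. exp (2 * pi * \<i> * of_nat m * (\<tau> + 2 * v))"
        assume "\<exists>L. (g \<longlongrightarrow> L) (at c)"
        then obtain L where "(g \<longlongrightarrow> L) (at c)" by blast
        hence l: "((\<lambda>v. ?e v * g v) \<longlongrightarrow> ?e c * L) (at c)" by (intro tendsto_intros)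
        have "\<forall>\<^sub>F v in at c. ?e v * g v = g (v + \<tau>)"
          by (rule eventually_mono[OF ev]) (simp add: g2)
        from Lim_transform_eventually[OF l this] show "\<exists>L. (g \<longlongrightarrow> L) (at (c + \<tau>))" unfolding sh by blast
      qed
    qed (use True in \<open>simp add: coset_def\<close>)
    moreover have "\<exists>L. (g \<longlongrightarrow> L) (at z)"
    proof -
      have zA: "z \<in> interior (- (coset z \<tau> - {z}))" using oA[of z] by (simp add: interior_open)
      obtain k where k: "k holomorphic_on - (coset z \<tau> - {z})" "\<And>v. v \<in> - (coset z \<tau> - {z}) - {z} \<Longrightarrow> k v = g v"
        using holomorphic_on_extend_lim[OF g_hol' zA] lim by blast
      have "isCont k z" using k(1) oA[of z] holomorphic_on_imp_continuous_on continuous_on_eq_continuous_at by blast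
      hence "(k \<longlongrightarrow> k z) (at z)" by (simp add: isCont_def)
      moreover have "\<forall>\<^sub>F v in at z. k v = g v"
        by (rule eventually_mono[OF ev]) (use k(2) coset_refl[of z \<tau>] in auto)
      ultimately show ?thesis using Lim_transform_eventually by blast
    qed
    ultimately show ?thesis by blast
  qed
  \<comment> \<open>At points of the coset g has no meaningful value; removing the singularities
    gives an entire function.\<close>
  define G where "G = remove_sings g"
  have G_eq: "G v = g v" if "v \<notin> coset z \<tau>" for v
    unfolding G_def by (rule remove_sings_at_analytic) (use that g_hol open_Compl_coset[OF \<tau>, of z] in \<open>auto intro: holomorphic_on_imp_analytic_at\<close>)
  have G_an: "G analytic_on {c}" for c
  proof -
    have "isolated_singularity_at g c" by (rule isolated_singularity_at_holomorphic[OF g_hol' oA]) auto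
    moreover obtain L where "(g \<longlongrightarrow> L) (at c)" using ex_lim by blast
    ultimately show ?thesis unfolding G_def by (rule remove_sings_analytic_at)
  qed
  hence G_hol: "G holomorphic_on UNIV" using analytic_on_analytic_at analytic_imp_holomorphic by blast
  have G_cont: "isCont G c" for c using G_an by (simp add: analytic_at_imp_isCont)
  \<comment> \<open>The laws of g hold off the coset only. For G they extend by continuity, because
    the coset is sparse.\<close>
  have eqI: "f c = h c" if "isCont f c" "isCont h c" "\<And>v. v \<notin> coset z \<tau> \<Longrightarrow> f v = h v" for f h :: "complex \<Rightarrow> complex" and c
  proof -
    have "(h \<longlongrightarrow> f c) (at c)" using that(1) unfolding isCont_def
      by (rule tendsto_cong[THEN iffD1, rotated]) (rule eventually_mono[OF ev], rule that(3))
    thus ?thesis using that(2) unfolding isCont_def by (intro tendsto_unique[of "at c" h]) auto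
  qed
  have shift: "v + d \<notin> coset z \<tau>" if "v \<notin> coset z \<tau>" "d = 1 \<or> d = \<tau>" for v d
  proof
    assume "v + d \<in> coset z \<tau>"
    moreover have "v \<in> coset (v + d) \<tau>"
      using that(2) unfolding coset_iff
    proof
      assume "d = 1" thus "\<exists>n k::int. v = v + d + of_int n * \<tau> + of_int k" by (intro exI[of _ 0] exI[of _ "-1"]) simp
    next
      assume "d = \<tau>" thus "\<exists>n k::int. v = v + d + of_int n * \<tau> + of_int k" by (intro exI[of _ "-1"] exI[of _ 0]) simp
    qed
    ultimately show False using coset_trans that(1) by blast
  qed
  have "G v = 0" for v
  proof (rule neg_index_entire_zero[OF m \<tau> G_hol])
    have cs: "isCont (\<lambda>v. G (v + d)) v" for v d by (rule isCont_o2[OF _ G_cont]) (intro continuous_intros)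
    show "G (v + 1) = G v" for v
      by (rule eqI[where f = "\<lambda>v. G (v + 1)"]) (auto simp: cs G_cont G_eq shift g1)
    show "G (v + \<tau>) = exp (2 * pi * \<i> * of_nat m * (\<tau> + 2 * v)) * G v" for v
      by (rule eqI[where f = "\<lambda>v. G (v + \<tau>)" and h = "\<lambda>v. exp (2 * pi * \<i> * of_nat m * (\<tau> + 2 * v)) * G v"])
         (auto simp: cs G_eq shift g2 intro!: continuous_intros G_cont)
  qed
  hence "D v w = 0" using G_eq[OF v] D_const[of v w 0] by (simp add: g_def)
  hence D0: "J v / \<tau> * F_pol m (v / \<tau>) (w / cnj \<tau>) (z / \<tau>) (- 1 / \<tau>) = F_pol m v w z \<tau>" by (simp add: D_def)
  have "J v * exp (2 * pi * \<i> * of_nat m * (z ^ 2 - v ^ 2) / \<tau>) = 1" unfolding J_def exp_add[symmetric] by simp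
  hence "F_pol m (v / \<tau>) (w / cnj \<tau>) (z / \<tau>) (- 1 / \<tau>) = \<tau> * exp (2 * pi * \<i> * of_nat m * (z ^ 2 - v ^ 2) / \<tau>) * (J v / \<tau> * F_pol m (v / \<tau>) (w / cnj \<tau>) (z / \<tau>) (- 1 / \<tau>))"
    using t0 by (simp add: field_simps)
  thus ?thesis unfolding D0 .
qed

subsection \<open>Modular transformations of the coefficients\<close>

lemma elliptic_meromorphic_slice:
  fixes \<phi> :: "complex \<Rightarrow> complex \<Rightarrow> complex"
  assumes m: "m > 0" and \<tau>: "Im \<tau> > 0"
    and mero: "(\<lambda>z. \<phi> z \<tau>) meromorphic_on UNIV"
    and cont: "\<And>z. z \<notin> Sing \<phi> \<tau> \<Longrightarrow> isCont (\<lambda>w. \<phi> w \<tau>) z"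
    and E: "condE m \<phi>"
  shows "elliptic_meromorphic m \<tau> (\<lambda>z. \<phi> z \<tau>)"
proof
  show "isCont (\<lambda>z. \<phi> z \<tau>) z" if "\<not> is_pole (\<lambda>z. \<phi> z \<tau>) z" for z
    using cont[of z] that by (simp add: Sing_def)
  show "\<phi> (z + of_int n * \<tau> + of_int \<mu>) \<tau> = exp (- 2 * pi * \<i> * of_nat m * (of_int n ^ 2 * \<tau> + 2 * of_int n * z)) * \<phi> z \<tau>"
    if "\<not> is_pole (\<lambda>z. \<phi> z \<tau>) z" for z n \<mu>
    using E \<tau> that unfolding condE_def Sing_def by simp
qed (use m \<tau> mero in auto)

lemma (in elliptic_meromorphic) Compl_poles_nonempty: "- poles \<noteq> {}"
proof
  assume "- poles = {}"
  hence "poles = UNIV" by blast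
  with countable_poles uncountable_UNIV_complex show False by metis
qed

text \<open>\<tau> and \<tau> + 1 have the same lattice and the same poles, and \<open>F_pol\<close>
  is invariant, so the pole parts of the two expansions coincide. The phase comes from the theta
  functions alone.\<close>

lemma h_val_T:
  assumes "elliptic_meromorphic m \<tau> \<phi>" "elliptic_meromorphic m (\<tau> + 1) \<psi>"
    and eq: "\<And>v. \<not> is_pole \<phi> v \<Longrightarrow> \<psi> v = \<phi> v"
  shows "elliptic_meromorphic.h_val m (\<tau> + 1) \<psi> l = exp (- pi * \<i> * of_int l ^ 2 / (2 * of_nat m)) * elliptic_meromorphic.h_val m \<tau> \<phi> l"
proof -
  interpret A: elliptic_meromorphic m \<tau> \<phi> by fact
  interpret B: elliptic_meromorphic m "\<tau> + 1" \<psi> by fact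
  note m = A.m_pos
  have ev: "\<forall>\<^sub>F v in at u. \<psi> v = \<phi> v" for u
    by (rule eventually_mono[OF A.eventually_not_pole]) (rule eq)
  have pole: "is_pole \<psi> u \<longleftrightarrow> is_pole \<phi> u" for u by (rule is_pole_cong[OF ev refl])
  have lat: "w \<in> lattice (\<tau> + 1) \<longleftrightarrow> w \<in> lattice \<tau>" for w
  proof
    assume "w \<in> lattice (\<tau> + 1)"
    then obtain a b :: int where "w = of_int a * (\<tau> + 1) + of_int b" by (auto simp: lattice_def)
    hence "w = of_int a * \<tau> + of_int (a + b)" by (simp add: algebra_simps)
    thus "w \<in> lattice \<tau>" unfolding lattice_def by blast
  next
    assume "w \<in> lattice \<tau>"
    then obtain a b :: int where "w = of_int a * \<tau> + of_int b" by (auto simp: lattice_def)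
    hence "w = of_int a * (\<tau> + 1) + of_int (b - a)" by (simp add: algebra_simps)
    thus "w \<in> lattice (\<tau> + 1)" unfolding lattice_def by blast
  qed
  have pr: "B.pole_res z u = A.pole_res z u" for z u
    unfolding A.pole_res_def B.pole_res_def F_pol_tau_plus_1[OF m]
    by (rule residue_cong[OF eventually_mono[OF ev] refl]) simp
  obtain S where S: "S \<subseteq> A.poles" "\<forall>u\<in>A.poles. \<exists>!s\<in>S. u - s \<in> lattice \<tau>" by (rule A.exists_representatives)
  \<comment> \<open>Coefficients are compared for reduced indices; the phase depends on l only
    modulo 2m.\<close>
  define \<nu> where "\<nu> = l mod (2 * int m)"
  have \<nu>: "0 \<le> \<nu>" "\<nu> < 2 * int m" "l mod (2 * int m) = \<nu> mod (2 * int m)" using m by (auto simp: \<nu>_def)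
  note ne = A.Compl_poles_nonempty
  have "B.h_val \<nu> * exp (pi * \<i> * of_int \<nu> ^ 2 / (2 * of_nat m)) = A.h_val \<nu>"
  proof (rule A.theta_coefficients_unique[OF A.open_Compl_poles ne _ \<nu>(1,2)])
    fix z assume z: "z \<in> - A.poles"
    have "\<psi> z = (\<Sum>l\<in>{0..<2 * int m}. B.h_val l * theta_ml m l z (\<tau> + 1)) - 2 * pi * \<i> * (\<Sum>u\<in>S. B.pole_res z u)"
      by (rule B.formula) (use z S in \<open>simp_all add: pole lat\<close>)
    moreover have "\<phi> z = (\<Sum>l\<in>{0..<2 * int m}. A.h_val l * theta_ml m l z \<tau>) - 2 * pi * \<i> * (\<Sum>u\<in>S. A.pole_res z u)"
      by (rule A.formula) (use z S in auto)
    moreover have "\<psi> z = \<phi> z" using z eq by simp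
    ultimately show "(\<Sum>l\<in>{0..<2 * int m}. B.h_val l * exp (pi * \<i> * of_int l ^ 2 / (2 * of_nat m)) * theta_ml m l z \<tau>) = (\<Sum>l\<in>{0..<2 * int m}. A.h_val l * theta_ml m l z \<tau>)"
      unfolding theta_ml_tau_plus_1[OF m] pr by (simp add: mult.assoc)
  qed
  hence main: "B.h_val \<nu> = exp (- 1 * (pi * \<i> * of_int \<nu> ^ 2 / (2 * of_nat m))) * A.h_val \<nu>"
    by (auto simp: exp_minus field_simps)
  have "B.h_val l = B.h_val \<nu>" "A.h_val l = A.h_val \<nu>" unfolding A.h_val_def B.h_val_def using \<nu> by simp_all
  moreover have "exp (- 1 * (pi * \<i> * of_int l ^ 2 / (2 * of_nat m))) = exp (- 1 * (pi * \<i> * of_int \<nu> ^ 2 / (2 * of_nat m)))"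
    by (rule exp_rclass_square[OF m]) (use \<nu>(3) in auto)
  ultimately show ?thesis using main by simp
qed

text \<open>The expansions of \<psi> at z / \<tau> and of \<phi> at z are compared. Their pole parts
  match, \<open>theta_ml_S\<close> rewrites the theta functions at -1/\<tau>, and equating theta
  coefficients gives a finite Fourier relation that \<open>dft_inverse\<close> solves.\<close>

lemma h_val_S:
  fixes \<tau> :: complex
  assumes "elliptic_meromorphic m \<tau> \<phi>" "elliptic_meromorphic m (- 1 / \<tau>) \<psi>"
    and eq: "\<And>v. \<not> is_pole \<phi> v \<Longrightarrow> \<psi> (v / \<tau>) = \<tau> powi k * exp (2 * pi * \<i> * of_nat m * v ^ 2 / \<tau>) * \<phi> v"
  shows "elliptic_meromorphic.h_val m (- 1 / \<tau>) \<psi> l = \<tau> powi k / csqrt (- \<i> * \<tau>) * (1 / of_real (sqrt (2 * real m)))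
     * (\<Sum>\<nu>\<in>{0..<2 * int m}. exp (pi * \<i> * of_int l * of_int \<nu> / of_nat m) * elliptic_meromorphic.h_val m \<tau> \<phi> \<nu>)"
proof -
  interpret A: elliptic_meromorphic m \<tau> \<phi> by fact
  interpret B: elliptic_meromorphic m "- 1 / \<tau>" \<psi> by fact
  note m = A.m_pos and \<tau> = A.tau
  have t0: "\<tau> \<noteq> 0" using \<tau> by auto
  let ?L = "{0..<2 * int m}"
  have ev: "\<forall>\<^sub>F v in at u. \<not> is_pole \<phi> v" for u by (rule A.eventually_not_pole)
  have pole: "is_pole \<psi> (u / \<tau>) \<longleftrightarrow> is_pole \<phi> u" for u
  proof -
    have "is_pole \<psi> (u / \<tau>) \<longleftrightarrow> is_pole (\<lambda>v. \<psi> (1 / \<tau> * v + 0)) u"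
      using is_pole_affine_iff[of "1 / \<tau>" \<psi> 0 u] t0 by simp
    also have "\<dots> \<longleftrightarrow> is_pole (\<lambda>v. (\<tau> powi k * exp (2 * pi * \<i> * of_nat m * v ^ 2 / \<tau>)) * \<phi> v) u"
      by (rule is_pole_cong[OF eventually_mono[OF ev] refl]) (simp add: eq)
    also have "\<dots> \<longleftrightarrow> is_pole \<phi> u"
      using t0 by (intro is_pole_mult_analytic_nonzero1_iff) (auto intro!: analytic_intros)
    finally show ?thesis .
  qed
  have lat: "u / \<tau> - s / \<tau> \<in> lattice (- 1 / \<tau>) \<longleftrightarrow> u - s \<in> lattice \<tau>" for u s
    using coset_S_iff[OF t0, of u s] by (simp add: coset_def)
  \<comment> \<open>The factor \<tau> from \<open>F_pol_S\<close> is cancelled by the factor 1 /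
    \<tau> of the substitution v / \<tau> in the residue, and the exponentials in v cancel against
    those of \<psi>. So the pole terms scale by the same factor as \<phi>(z), which is where the
    weight k comes from.\<close>
  have pr: "B.pole_res (z / \<tau>) (u / \<tau>) = \<tau> powi k * exp (2 * pi * \<i> * of_nat m * z ^ 2 / \<tau>) * A.pole_res z u"
    if z: "\<not> is_pole \<phi> z" and u: "is_pole \<phi> u" for z u
  proof -
    have uz: "u \<notin> coset z \<tau>" using A.is_pole_lattice z u by blast
    define g where "g v = F_pol m v (cnj (u / \<tau>)) (z / \<tau>) (- 1 / \<tau>) * \<psi> v" for v
    have "u / \<tau> \<notin> coset (z / \<tau>) (- 1 / \<tau>)" using coset_S_iff[OF t0] uz by blast
    hence an: "(\<lambda>v. F_pol m v (cnj (u / \<tau>)) (z / \<tau>) (- 1 / \<tau>)) analytic_on {u / \<tau>}"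
      using F_pol_holomorphic[OF m B.tau, of "cnj (u / \<tau>)" "z / \<tau>"] open_Compl_coset[OF B.tau, of "z / \<tau>"]
      by (meson ComplI holomorphic_on_imp_analytic_at)
    have "1 / \<tau> * u + 0 = u / \<tau>" by simp
    hence iso: "isolated_singularity_at g (1 / \<tau> * u + 0)" and ne: "not_essential g (1 / \<tau> * u + 0)"
      unfolding g_def
      using isolated_singularity_at_times[OF isolated_singularity_at_analytic[OF an] B.isolated[of "u / \<tau>"]]
        not_essential_times[OF not_essential_analytic[OF an] B.not_ess[of "u / \<tau>"] isolated_singularity_at_analytic[OF an] B.isolated[of "u / \<tau>"]]
      by (simp_all only:)
    have "residue g (u / \<tau>) = residue (\<lambda>v. g (v / \<tau>)) u / \<tau>"
      using residue_affine[OF iso ne] t0 by simp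
    also have "residue (\<lambda>v. g (v / \<tau>)) u = residue (\<lambda>v. (\<tau> * \<tau> powi k * exp (2 * pi * \<i> * of_nat m * z ^ 2 / \<tau>)) * (F_pol m v (cnj u) z \<tau> * \<phi> v)) u"
    proof (rule residue_cong[OF _ refl])
      show "\<forall>\<^sub>F v in at u. g (v / \<tau>) = (\<tau> * \<tau> powi k * exp (2 * pi * \<i> * of_nat m * z ^ 2 / \<tau>)) * (F_pol m v (cnj u) z \<tau> * \<phi> v)"
        using ev[of u] sparse_imp_eventually_not_in[OF coset_sparse[OF \<tau>], of z u]
      proof eventually_elim
        case (elim v)
        have "F_pol m (v / \<tau>) (cnj (u / \<tau>)) (z / \<tau>) (- 1 / \<tau>) = \<tau> * exp (2 * pi * \<i> * of_nat m * (z ^ 2 - v ^ 2) / \<tau>) * F_pol m v (cnj u) z \<tau>"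
          using F_pol_S[OF m \<tau> elim(2), of "cnj u"] by simp
        moreover have "exp (2 * pi * \<i> * of_nat m * (z ^ 2 - v ^ 2) / \<tau>) * exp (2 * pi * \<i> * of_nat m * v ^ 2 / \<tau>) = exp (2 * pi * \<i> * of_nat m * z ^ 2 / \<tau>)"
          unfolding exp_add[symmetric] by (intro arg_cong[of _ _ exp]) (simp add: right_diff_distrib diff_divide_distrib)
        ultimately show ?case unfolding g_def eq[OF elim(1)] by (simp add: mult_ac)
      qed
    qed
    also have "\<dots> = (\<tau> * \<tau> powi k * exp (2 * pi * \<i> * of_nat m * z ^ 2 / \<tau>)) * A.pole_res z u"
      unfolding A.pole_res_def
      by (rule residue_lmul[OF A.open_punctured[of z u]]) (auto intro!: holomorphic_on_subset[OF A.F_phi_holomorphic])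
    finally show ?thesis unfolding B.pole_res_def g_def[symmetric] using t0 by simp
  qed
  obtain S where S: "S \<subseteq> A.poles" "\<forall>u\<in>A.poles. \<exists>!s\<in>S. u - s \<in> lattice \<tau>" by (rule A.exists_representatives)
  \<comment> \<open>The lattice of -1/\<tau> is that of \<tau> divided by \<tau>, so representatives
    go to representatives and the same S serves both pole sums.\<close>
  have S': "(\<lambda>u. u / \<tau>) ` S \<subseteq> B.poles" "\<forall>u\<in>B.poles. \<exists>!s\<in>(\<lambda>u. u / \<tau>) ` S. u - s \<in> lattice (- 1 / \<tau>)"
  proof -
    show "(\<lambda>u. u / \<tau>) ` S \<subseteq> B.poles" using S(1) pole by auto
    show "\<forall>u\<in>B.poles. \<exists>!s\<in>(\<lambda>u. u / \<tau>) ` S. u - s \<in> lattice (- 1 / \<tau>)"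
    proof
      fix u assume "u \<in> B.poles"
      hence "u * \<tau> \<in> A.poles" using pole[of "u * \<tau>"] t0 by simp
      hence *: "\<exists>!s\<in>S. u * \<tau> - s \<in> lattice \<tau>" using S(2) by blast
      have l: "u - s / \<tau> \<in> lattice (- 1 / \<tau>) \<longleftrightarrow> u * \<tau> - s \<in> lattice \<tau>" for s
        using lat[of "u * \<tau>" s] t0 by simp
      obtain s where s: "s \<in> S \<and> u * \<tau> - s \<in> lattice \<tau>" and uniq: "\<forall>s'. s' \<in> S \<and> u * \<tau> - s' \<in> lattice \<tau> \<longrightarrow> s' = s"
        using * unfolding Ex1_def by (elim exE conjE) (rule that, blast+)
      show "\<exists>!s\<in>(\<lambda>u. u / \<tau>) ` S. u - s \<in> lattice (- 1 / \<tau>)"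
      proof (rule ex1I[of _ "s / \<tau>"])
        show "s / \<tau> \<in> (\<lambda>u. u / \<tau>) ` S \<and> u - s / \<tau> \<in> lattice (- 1 / \<tau>)"
          unfolding l using s by (intro conjI imageI) auto
        fix x assume x: "x \<in> (\<lambda>u. u / \<tau>) ` S \<and> u - x \<in> lattice (- 1 / \<tau>)"
        then obtain s' where s': "s' \<in> S" "x = s' / \<tau>" by blast
        have "u * \<tau> - s' \<in> lattice \<tau>" using x unfolding s'(2) l by (rule conjunct2)
        thus "x = s / \<tau>" using uniq s' by simp
      qed
    qed
  qed
  define c where "c = csqrt (- \<i> * \<tau>) / of_real (sqrt (2 * real m))"
  have c0: "c \<noteq> 0" using csqrt_upper_half(2)[OF \<tau>] m by (simp add: c_def)
  note ne = A.Compl_poles_nonempty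
  have coef: "c * (\<Sum>l\<in>?L. exp (- pi * \<i> * of_int l * of_int \<nu> / of_nat m) * B.h_val l) = \<tau> powi k * A.h_val \<nu>"
    if \<nu>: "0 \<le> \<nu>" "\<nu> < 2 * int m" for \<nu>
  proof (rule A.theta_coefficients_unique[OF A.open_Compl_poles ne _ \<nu>])
    fix z assume z: "z \<in> - A.poles"
    define J where "J = \<tau> powi k * exp (2 * pi * \<i> * of_nat m * z ^ 2 / \<tau>)"
    have "\<psi> (z / \<tau>) = (\<Sum>l\<in>?L. B.h_val l * theta_ml m l (z / \<tau>) (- 1 / \<tau>)) - 2 * pi * \<i> * (\<Sum>u\<in>(\<lambda>u. u / \<tau>) ` S. B.pole_res (z / \<tau>) u)"
      by (rule B.formula[OF _ S']) (use z pole in auto)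
    also have "(\<Sum>u\<in>(\<lambda>u. u / \<tau>) ` S. B.pole_res (z / \<tau>) u) = (\<Sum>u\<in>S. B.pole_res (z / \<tau>) (u / \<tau>))"
      by (subst sum.reindex) (use t0 in \<open>auto simp: inj_on_def\<close>)
    also have "\<dots> = (\<Sum>u\<in>S. J * A.pole_res z u)"
      using S(1) z unfolding J_def by (intro sum.cong refl pr) auto
    finally have 1: "\<psi> (z / \<tau>) = (\<Sum>l\<in>?L. B.h_val l * theta_ml m l (z / \<tau>) (- 1 / \<tau>)) - 2 * pi * \<i> * (J * (\<Sum>u\<in>S. A.pole_res z u))"
      by (simp only: sum_distrib_left)
    have 2: "\<phi> z = (\<Sum>l\<in>?L. A.h_val l * theta_ml m l z \<tau>) - 2 * pi * \<i> * (\<Sum>u\<in>S. A.pole_res z u)"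
      by (rule A.formula) (use z S in auto)
    have "\<psi> (z / \<tau>) = J * \<phi> z" using eq[of z] z by (simp add: J_def)
    hence 3: "(\<Sum>l\<in>?L. B.h_val l * theta_ml m l (z / \<tau>) (- 1 / \<tau>)) = J * (\<Sum>l\<in>?L. A.h_val l * theta_ml m l z \<tau>)"
      unfolding 1 2 by (simp add: algebra_simps)
    define x where "x = exp (2 * pi * \<i> * of_nat m * z ^ 2 / \<tau>)"
    have "theta_ml m l (z / \<tau>) (- 1 / \<tau>) = c * x * (\<Sum>\<nu>\<in>?L. exp (- pi * \<i> * of_int l * of_int \<nu> / of_nat m) * theta_ml m \<nu> z \<tau>)" for l
      unfolding c_def x_def by (rule theta_ml_S[OF m \<tau>])
    hence "(\<Sum>l\<in>?L. B.h_val l * theta_ml m l (z / \<tau>) (- 1 / \<tau>)) = (\<Sum>l\<in>?L. \<Sum>\<nu>\<in>?L. x * (c * (exp (- pi * \<i> * of_int l * of_int \<nu> / of_nat m) * B.h_val l) * theta_ml m \<nu> z \<tau>))"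
      by (simp only: sum_distrib_left mult_ac)
    also have "\<dots> = x * (\<Sum>\<nu>\<in>?L. c * (\<Sum>l\<in>?L. exp (- pi * \<i> * of_int l * of_int \<nu> / of_nat m) * B.h_val l) * theta_ml m \<nu> z \<tau>)"
      unfolding sum_distrib_left sum_distrib_right by (rule sum.swap)
    finally have "x * (\<Sum>\<nu>\<in>?L. c * (\<Sum>l\<in>?L. exp (- pi * \<i> * of_int l * of_int \<nu> / of_nat m) * B.h_val l) * theta_ml m \<nu> z \<tau>) = x * (\<Sum>\<nu>\<in>?L. \<tau> powi k * A.h_val \<nu> * theta_ml m \<nu> z \<tau>)"
      unfolding 3 J_def x_def by (simp add: sum_distrib_left mult_ac)
    moreover have "x \<noteq> 0" by (simp add: x_def)
    ultimately show "(\<Sum>\<nu>\<in>?L. c * (\<Sum>l\<in>?L. exp (- pi * \<i> * of_int l * of_int \<nu> / of_nat m) * B.h_val l) * theta_ml m \<nu> z \<tau>) = (\<Sum>\<nu>\<in>?L. \<tau> powi k * A.h_val \<nu> * theta_ml m \<nu> z \<tau>)"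
      by simp
  qed
  define \<mu> where "\<mu> = l mod (2 * int m)"
  have \<mu>: "0 \<le> \<mu>" "\<mu> < 2 * int m" using m by (auto simp: \<mu>_def)
  have "B.h_val \<mu> = (\<Sum>\<nu>\<in>?L. exp (pi * \<i> * of_int \<mu> * of_int \<nu> / of_nat m) * (\<tau> powi k * A.h_val \<nu> / c)) / (2 * of_nat m)"
    by (rule dft_inverse[OF m _ \<mu>]) (use coef c0 in \<open>simp add: field_simps\<close>)
  also have "\<dots> = \<tau> powi k * (1 / (c * (2 * of_nat m))) * (\<Sum>\<nu>\<in>?L. exp (pi * \<i> * of_int \<mu> * of_int \<nu> / of_nat m) * A.h_val \<nu>)"
    by (simp add: sum_distrib_left sum_divide_distrib mult_ac)
  also have "1 / (c * (2 * of_nat m)) = 1 / csqrt (- \<i> * \<tau>) * (1 / of_real (sqrt (2 * real m)))"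
  proof -
    have "(2 * of_nat m :: complex) = of_real (sqrt (2 * real m)) * of_real (sqrt (2 * real m))"
      unfolding of_real_mult[symmetric] by simp
    moreover have "complex_of_real (sqrt (2 * real m)) \<noteq> 0" using m by simp
    ultimately show ?thesis unfolding c_def by simp
  qed
  also have "(\<Sum>\<nu>\<in>?L. exp (pi * \<i> * of_int \<mu> * of_int \<nu> / of_nat m) * A.h_val \<nu>) = (\<Sum>\<nu>\<in>?L. exp (pi * \<i> * of_int l * of_int \<nu> / of_nat m) * A.h_val \<nu>)"
  \<comment> \<open>The claim is for arbitrary l while the inversion was done for its reduced value;
    since \<nu> is an integer, the characters agree.\<close>
  proof (intro sum.cong refl arg_cong2[of _ _ _ _ times])
    fix \<nu> :: int
    have "of_int l = of_int \<mu> + 2 * of_nat m * (of_int (l div (2 * int m)) :: complex)"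
    proof -
      have "l = \<mu> + 2 * int m * (l div (2 * int m))" unfolding \<mu>_def by simp
      from arg_cong[OF this, of "of_int :: int \<Rightarrow> complex"] show ?thesis by simp
    qed
    hence "pi * \<i> * of_int l * of_int \<nu> / of_nat m = pi * \<i> * of_int \<mu> * of_int \<nu> / of_nat m + 2 * of_real pi * \<i> * of_int (l div (2 * int m) * \<nu>)"
      using m by (simp add: field_simps)
    from exp_eq_int_shift[OF this] show "exp (pi * \<i> * of_int \<mu> * of_int \<nu> / of_nat m) = exp (pi * \<i> * of_int l * of_int \<nu> / of_nat m)" by simp
  qed
  finally have "B.h_val \<mu> = \<tau> powi k * (1 / csqrt (- \<i> * \<tau>) * (1 / of_real (sqrt (2 * real m)))) * (\<Sum>\<nu>\<in>?L. exp (pi * \<i> * of_int l * of_int \<nu> / of_nat m) * A.h_val \<nu>)" .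
  moreover have "B.h_val l = B.h_val \<mu>" unfolding B.h_val_def \<mu>_def by simp
  ultimately show ?thesis by simp
qed

text \<open>The assumption \<open>cont\<close> expresses that poles are the only singular points,
  since a formally meromorphic function may take arbitrary values at isolated points. One h serves
  all base points p, and \<open>S\<close> ranges over all choices of representatives of the poles
  modulo the lattice.\<close>

theorem theorem3p9:
  fixes k :: int and m :: nat and \<phi> :: "complex \<Rightarrow> complex \<Rightarrow> complex"
  assumes m_pos: "m > 0"
    and mero: "\<And>\<tau>. Im \<tau> > 0 \<Longrightarrow> (\<lambda>z. \<phi> z \<tau>) meromorphic_on UNIV"
    and cont: "\<And>\<tau> z. Im \<tau> > 0 \<Longrightarrow> z \<notin> Sing \<phi> \<tau> \<Longrightarrow> isCont (\<lambda>w. \<phi> w \<tau>) z"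
    and E: "condE m \<phi>"
  shows "\<exists>h :: int \<Rightarrow> complex \<Rightarrow> complex.
     (\<forall>l \<tau>. h (l + 2 * int m) \<tau> = h l \<tau>)
   \<and> (\<forall>\<tau> p l. Im \<tau> > 0 \<and> 0 \<le> l \<and> l < 2 * int m \<and> Sing \<phi> \<tau> \<inter> par_boundary p \<tau> = {}
          \<longrightarrow> h l \<tau> = h_formula m \<phi> l \<tau> p)
   \<and> (\<forall>\<tau> z S. Im \<tau> > 0 \<and> z \<notin> Sing \<phi> \<tau> \<and> S \<subseteq> Sing \<phi> \<tau>
          \<and> (\<forall>u\<in>Sing \<phi> \<tau>. \<exists>!s\<in>S. u - s \<in> lattice \<tau>)
          \<longrightarrow> \<phi> z \<tau> = (\<Sum>l\<in>{0..<2 * int m}. h l \<tau> * theta_ml m l z \<tau>)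
                 - 2 * pi * \<i> * (\<Sum>u\<in>S. res_ra (\<lambda>v. f_tilde m v z \<tau>) (\<lambda>v. \<phi> v \<tau>) u))
   \<and> (condM k m \<phi> \<longrightarrow>
        (\<forall>l \<tau>. Im \<tau> > 0 \<longrightarrow>
           h l (\<tau> + 1) = exp (- pi * \<i> * of_int l ^ 2 / (2 * of_nat m)) * h l \<tau>
         \<and> h l (- 1 / \<tau>) = \<tau> powi k / csqrt (- \<i> * \<tau>) * (1 / of_real (sqrt (2 * real m)))
              * (\<Sum>\<nu>\<in>{0..<2 * int m}. exp (pi * \<i> * of_int l * of_int \<nu> / of_nat m) * h \<nu> \<tau>)))"
proof -
  \<comment> \<open>Periodicity in l is claimed for every \<tau>, so h needs a value periodic in l
    off the upper half-plane as well; 0 is one.\<close>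
  define h where "h l \<tau> = (if Im \<tau> > 0 then elliptic_meromorphic.h_val m \<tau> (\<lambda>z. \<phi> z \<tau>) l else 0)" for l \<tau>
  have loc: "elliptic_meromorphic m \<tau> (\<lambda>z. \<phi> z \<tau>)" if "Im \<tau> > 0" for \<tau>
    using elliptic_meromorphic_slice[where \<phi> = \<phi>, OF m_pos that mero[OF that] cont[OF that] E] .
  have "h (l + 2 * int m) \<tau> = h l \<tau>" for l \<tau>
    using elliptic_meromorphic.h_val_periodic[OF loc] by (simp add: h_def)
  moreover have "h l \<tau> = h_formula m \<phi> l \<tau> p"
    if \<tau>: "Im \<tau> > 0" and l: "0 \<le> l" "l < 2 * int m" and p: "Sing \<phi> \<tau> \<inter> par_boundary p \<tau> = {}" for \<tau> p l
  proof -
    interpret elliptic_meromorphic m \<tau> "\<lambda>z. \<phi> z \<tau>" by (rule loc[OF \<tau>])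
    have "h l \<tau> = h_par l p" unfolding h_def using \<tau> l p by (simp add: h_val_eq good_def Sing_def)
    also have "\<dots> = h_formula m \<phi> l \<tau> p"
      unfolding h_par_def h_formula_def Sing_def using R_res_eq_res_ra by simp
    finally show ?thesis .
  qed
  moreover have "\<phi> z \<tau> = (\<Sum>l\<in>{0..<2 * int m}. h l \<tau> * theta_ml m l z \<tau>)
                 - 2 * pi * \<i> * (\<Sum>u\<in>S. res_ra (\<lambda>v. f_tilde m v z \<tau>) (\<lambda>v. \<phi> v \<tau>) u)"
    if \<tau>: "Im \<tau> > 0" and z: "z \<notin> Sing \<phi> \<tau>" and S: "S \<subseteq> Sing \<phi> \<tau>" "\<forall>u\<in>Sing \<phi> \<tau>. \<exists>!s\<in>S. u - s \<in> lattice \<tau>" for \<tau> z S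
  proof -
    interpret elliptic_meromorphic m \<tau> "\<lambda>z. \<phi> z \<tau>" by (rule loc[OF \<tau>])
    have "\<phi> z \<tau> = (\<Sum>l\<in>{0..<2 * int m}. h_val l * theta_ml m l z \<tau>) - 2 * pi * \<i> * (\<Sum>u\<in>S. pole_res z u)"
      using z S unfolding Sing_def by (intro formula) auto
    also have "(\<Sum>u\<in>S. pole_res z u) = (\<Sum>u\<in>S. res_ra (\<lambda>v. f_tilde m v z \<tau>) (\<lambda>v. \<phi> v \<tau>) u)"
      using z S unfolding Sing_def by (intro sum.cong refl pole_res_eq_res_ra) auto
    finally show ?thesis using \<tau> by (simp add: h_def)
  qed
  moreover have "h l (\<tau> + 1) = exp (- pi * \<i> * of_int l ^ 2 / (2 * of_nat m)) * h l \<tau>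
         \<and> h l (- 1 / \<tau>) = \<tau> powi k / csqrt (- \<i> * \<tau>) * (1 / of_real (sqrt (2 * real m)))
              * (\<Sum>\<nu>\<in>{0..<2 * int m}. exp (pi * \<i> * of_int l * of_int \<nu> / of_nat m) * h \<nu> \<tau>)"
    if M: "condM k m \<phi>" and \<tau>: "Im \<tau> > 0" for l \<tau>
  proof
    have M': "\<phi> (z / (of_int c * \<tau> + of_int d)) ((of_int a * \<tau> + of_int b) / (of_int c * \<tau> + of_int d))
        = (of_int c * \<tau> + of_int d) powi k * exp (2 * pi * \<i> * of_nat m * of_int c * z ^ 2 / (of_int c * \<tau> + of_int d)) * \<phi> z \<tau>"
      if "a * d - b * c = 1" "\<not> is_pole (\<lambda>z. \<phi> z \<tau>) z" for a b c d z
      using M \<tau> that unfolding condM_def Sing_def by blast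
    show "h l (\<tau> + 1) = exp (- pi * \<i> * of_int l ^ 2 / (2 * of_nat m)) * h l \<tau>"
    proof -
      have \<tau>': "Im (\<tau> + 1) > 0" using \<tau> by simp
      have "\<phi> v (\<tau> + 1) = \<phi> v \<tau>" if "\<not> is_pole (\<lambda>z. \<phi> z \<tau>) v" for v
        \<comment> \<open>The instantiation is in the order a, d, b, c and gives the matrix with
          rows (1, 1) and (0, 1).\<close>
        using M'[of 1 1 1 0 v] that by simp
      from h_val_T[OF loc[OF \<tau>] loc[OF \<tau>'] this] show ?thesis using \<tau> by (simp add: h_def)
    qed
    show "h l (- 1 / \<tau>) = \<tau> powi k / csqrt (- \<i> * \<tau>) * (1 / of_real (sqrt (2 * real m)))
              * (\<Sum>\<nu>\<in>{0..<2 * int m}. exp (pi * \<i> * of_int l * of_int \<nu> / of_nat m) * h \<nu> \<tau>)"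
    proof -
      have \<tau>': "Im (- 1 / \<tau>) > 0" by (rule Im_S_pos[OF \<tau>])
      have eq: "\<phi> (v / \<tau>) (- 1 / \<tau>) = \<tau> powi k * exp (2 * pi * \<i> * of_nat m * v ^ 2 / \<tau>) * \<phi> v \<tau>" if "\<not> is_pole (\<lambda>z. \<phi> z \<tau>) v" for v
        \<comment> \<open>In the same order, the matrix with rows (0, -1) and (1, 0).\<close>
        using M'[of 0 0 "-1" 1 v] that by simp
      show ?thesis unfolding h_def if_P[OF \<tau>] if_P[OF \<tau>']
        by (rule h_val_S[OF loc[OF \<tau>] loc[OF \<tau>']]) (rule eq)
    qed
  qed
  ultimately show ?thesis by (intro exI[of _ h]) blast
qed

end
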